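(* Assume that every finite $M$-group of odd order is a super $M$-group. Then every normal subgroup of a finite $M$-group of odd order is also an $M$-group.
   Context: All groups are finite. $\mathrm{Irr}(G)$ denotes the set of irreducible complex characters of $G$. A character is linear if it has degree $1$. For $H\le G$ and a character $\lambda$ of $H$, $\lambda^G$ denotes the induced character; "$\lambda$ induces $\chi$" means $\lambda^G=\chi$. A character of $G$ is monomial if it is induced from a linear character of some (not necessarily proper) subgroup of $G$. $G$ is an $M$-group if every $\chi\in\mathrm{Irr}(G)$ is monomial. An irreducible character is primitive if it is not induced from a character of a proper subgroup. A character $\chi\in\mathrm{Irr}(G)$ is super-monomial if every primitive character (of some subgroup of $G$, possibly $G$ itself) inducing $\chi$ is linear. $G$ is a super $M$-group if every $\chi\in\mathrm{Irr}(G)$ is super-monomial. The hypothesis of the claim is known as Isaacs' conjecture. *)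

theory Defs
  imports "Jordan_Normal_Form.VS_Connect" "HOL-Algebra.Coset"
begin

text \<open>Complex matrix representations of a group.  A subgroup \<open>H\<close> of \<open>G\<close> is regarded as a group
  in its own right as \<open>G\<lparr>carrier := H\<rparr>\<close>.\<close>

definition GL_complex :: "nat \<Rightarrow> complex mat monoid" where
  "GL_complex n = units_of (ring_mat TYPE(complex) n ())"

definition is_rep :: "('a, 'b) monoid_scheme \<Rightarrow> nat \<Rightarrow> ('a \<Rightarrow> complex mat) \<Rightarrow> bool" where
  "is_rep G n \<rho> \<longleftrightarrow> n > 0 \<and> \<rho> \<in> hom G (GL_complex n)"

definition irreducible_rep :: "('a, 'b) monoid_scheme \<Rightarrow> nat \<Rightarrow> ('a \<Rightarrow> complex mat) \<Rightarrow> bool" where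
  "irreducible_rep G n \<rho> \<longleftrightarrow> is_rep G n \<rho> \<and>
     (\<forall>W. subspace class_ring W (module_vec TYPE(complex) n) \<and>
          (\<forall>g\<in>carrier G. \<forall>w\<in>W. \<rho> g *\<^sub>v w \<in> W)
        \<longrightarrow> W = {0\<^sub>v n} \<or> W = carrier_vec n)"

definition mat_trace :: "complex mat \<Rightarrow> complex" where
  "mat_trace A = (\<Sum>i<dim_row A. A $$ (i, i))"

text \<open>Class functions on \<open>G\<close> are total functions that vanish outside \<open>carrier G\<close>.  Thus equality of
  characters is equality of functions, and a character of a subgroup \<open>H\<close> comes with the extension
  by zero that occurs in the usual formula for the induced character.\<close>

definition rep_character :: "('a, 'b) monoid_scheme \<Rightarrow> ('a \<Rightarrow> complex mat) \<Rightarrow> 'a \<Rightarrow> complex" where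
  "rep_character G \<rho> = (\<lambda>g. if g \<in> carrier G then mat_trace (\<rho> g) else 0)"

definition is_character :: "('a, 'b) monoid_scheme \<Rightarrow> ('a \<Rightarrow> complex) \<Rightarrow> bool" where
  "is_character G \<chi> \<longleftrightarrow> (\<exists>n \<rho>. is_rep G n \<rho> \<and> \<chi> = rep_character G \<rho>)"

definition Irr :: "('a, 'b) monoid_scheme \<Rightarrow> ('a \<Rightarrow> complex) set" where
  "Irr G = {\<chi>. \<exists>n \<rho>. irreducible_rep G n \<rho> \<and> \<chi> = rep_character G \<rho>}"

definition linear_character :: "('a, 'b) monoid_scheme \<Rightarrow> ('a \<Rightarrow> complex) \<Rightarrow> bool" where
  "linear_character G \<chi> \<longleftrightarrow> is_character G \<chi> \<and> \<chi> \<one>\<^bsub>G\<^esub> = 1"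

text \<open>The induced character: since \<open>\<phi>\<close> vanishes outside \<open>H\<close>, only those \<open>x\<close> with
  \<open>x g x\<^sup>-\<^sup>1 \<in> H\<close> contribute.\<close>

definition induced_character ::
  "('a, 'b) monoid_scheme \<Rightarrow> 'a set \<Rightarrow> ('a \<Rightarrow> complex) \<Rightarrow> 'a \<Rightarrow> complex" where
  "induced_character G H \<phi> = (\<lambda>g. if g \<in> carrier G
     then (\<Sum>x\<in>carrier G. \<phi> (x \<otimes>\<^bsub>G\<^esub> g \<otimes>\<^bsub>G\<^esub> inv\<^bsub>G\<^esub> x)) / of_nat (card H)
     else 0)"

definition monomial_character :: "('a, 'b) monoid_scheme \<Rightarrow> ('a \<Rightarrow> complex) \<Rightarrow> bool" where
  "monomial_character G \<chi> \<longleftrightarrow>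
     (\<exists>H \<phi>. subgroup H G \<and> linear_character (G\<lparr>carrier := H\<rparr>) \<phi> \<and> induced_character G H \<phi> = \<chi>)"

definition primitive_character :: "('a, 'b) monoid_scheme \<Rightarrow> ('a \<Rightarrow> complex) \<Rightarrow> bool" where
  "primitive_character G \<chi> \<longleftrightarrow> \<chi> \<in> Irr G \<and>
     \<not> (\<exists>H \<psi>. subgroup H G \<and> H \<noteq> carrier G \<and> is_character (G\<lparr>carrier := H\<rparr>) \<psi> \<and>
               induced_character G H \<psi> = \<chi>)"

definition super_monomial :: "('a, 'b) monoid_scheme \<Rightarrow> ('a \<Rightarrow> complex) \<Rightarrow> bool" where
  "super_monomial G \<chi> \<longleftrightarrow> \<chi> \<in> Irr G \<and>
     (\<forall>H \<psi>. subgroup H G \<and> primitive_character (G\<lparr>carrier := H\<rparr>) \<psi> \<and>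
             induced_character G H \<psi> = \<chi>
        \<longrightarrow> linear_character (G\<lparr>carrier := H\<rparr>) \<psi>)"

definition M_group :: "('a, 'b) monoid_scheme \<Rightarrow> bool" where
  "M_group G \<longleftrightarrow> group G \<and> finite (carrier G) \<and> (\<forall>\<chi>\<in>Irr G. monomial_character G \<chi>)"

definition super_M_group :: "('a, 'b) monoid_scheme \<Rightarrow> bool" where
  "super_M_group G \<longleftrightarrow> group G \<and> finite (carrier G) \<and> (\<forall>\<chi>\<in>Irr G. super_monomial G \<chi>)"

text \<open>HOL cannot quantify over types inside a formula.  Every finite group is isomorphic to one
  whose elements are natural numbers, so this quantifies over all finite groups up to isomorphism.\<close>

definition Isaacs_conjecture :: bool where
  "Isaacs_conjecture \<longleftrightarrow> (\<forall>K :: nat monoid. M_group K \<and> odd (Coset.order K) \<longrightarrow> super_M_group K)"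

end

theory Submission
  imports Defs "Jordan_Normal_Form.DL_Rank" "Jordan_Normal_Form.Char_Poly"
    "HOL-Computational_Algebra.Fundamental_Theorem_Algebra" "HOL-Algebra.Multiplicative_Group"
begin

text \<open>
  Induction on \<open>|G|\<close>.  If \<open>N \<noteq> G\<close>, the M-property yields a linear character \<open>\<nu>\<close> of prime order \<open>p\<close>
  whose kernel \<open>K\<close> contains \<open>N\<close>, and it suffices that \<open>K\<close> is again an M-group.  Let \<open>\<theta>\<close> be an
  irreducible character of \<open>K\<close> and let the irreducible character \<open>\<chi>\<close> of \<open>G\<close> lie over \<open>\<theta>\<close>.

  If no twist of \<open>\<chi>\<close> by a nontrivial power of \<open>\<nu>\<close> is \<open>\<chi>\<close> itself, then \<open>\<chi>\<close> restricts to \<open>\<theta>\<close>;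
  a linear character \<open>\<mu>\<close> of \<open>U\<close> inducing \<open>\<chi>\<close> has \<open>U\<close> not inside \<open>K\<close>, so \<open>G = UK\<close> and \<open>\<theta>\<close> is induced from
  the restriction of \<open>\<mu>\<close> to \<open>U \<inter> K\<close>.  Otherwise \<open>\<chi>\<close> vanishes off \<open>K\<close> and is induced from \<open>\<theta>\<close>;
  a primitive character inducing \<open>\<theta>\<close> then induces \<open>\<chi>\<close>, so it is linear by Isaacs' conjecture.
\<close>

section \<open>Matrices and subspaces\<close>

text \<open>Prime order is wanted because then no subgroup lies strictly between \<open>K\<close>
  and \<open>G\<close>. When \<open>\<chi>\<close> vanishes off \<open>K\<close>, its restriction to
  \<open>K\<close> contains all conjugates of \<open>\<theta>\<close> with one multiplicity
  \<open>m\<close>, and \<open>m * m\<close> is the index of \<open>K\<close> in the inertia group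
  of \<open>\<theta>\<close>. That index is 1 or \<open>p\<close>, and a prime is not a square, so
  \<open>m = 1\<close>. This takes the place of Clifford's theorem; it comes from a convolution of
  characters over \<open>K\<close>. In the first case \<open>U\<close> cannot lie inside
  \<open>K\<close>: otherwise \<open>\<chi>\<close> would vanish off \<open>K\<close> and its
  restriction would have norm \<open>p\<close> instead of 1. In the second case a linear character
  of \<open>U\<close> inducing \<open>\<chi>\<close> says nothing about \<open>\<theta>\<close>,
  since \<open>U\<close> need not lie in \<open>K\<close>. The remedy is to start from a primitive
  character that induces \<open>\<theta>\<close>, and only the conjecture makes that one
  linear.\<close>

lemma mat_trace_comm:
  assumes "A \<in> carrier_mat n m" "B \<in> carrier_mat m n"
  shows "mat_trace (A * B) = mat_trace (B * A)"
proof -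
  have "mat_trace (A * B) = (\<Sum>i<n. \<Sum>j<m. A $$ (i, j) * B $$ (j, i))"
    using assms by (auto simp: mat_trace_def scalar_prod_def atLeast0LessThan intro!: sum.cong)
  also have "\<dots> = (\<Sum>j<m. \<Sum>i<n. B $$ (j, i) * A $$ (i, j))"
    by (subst sum.swap) (simp add: mult.commute)
  also have "\<dots> = mat_trace (B * A)"
    using assms by (auto simp: mat_trace_def scalar_prod_def atLeast0LessThan intro!: sum.cong)
  finally show ?thesis .
qed

lemma mat_trace_add:
  assumes "A \<in> carrier_mat n n" "B \<in> carrier_mat n n"
  shows "mat_trace (A + B) = mat_trace A + mat_trace B"
  using assms by (auto simp: mat_trace_def sum.distrib)

lemma mat_trace_smult: "A \<in> carrier_mat n n \<Longrightarrow> mat_trace (c \<cdot>\<^sub>m A) = c * mat_trace A"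
  by (auto simp: mat_trace_def sum_distrib_left)

lemma mat_trace_one [simp]: "mat_trace (1\<^sub>m n) = of_nat n"
  by (simp add: mat_trace_def)

lemma subspace_vec_iff:
  "VectorSpace.subspace class_ring W (module_vec TYPE(complex) n) \<longleftrightarrow>
     W \<subseteq> carrier_vec n \<and> 0\<^sub>v n \<in> W \<and> (\<forall>v\<in>W. \<forall>w\<in>W. v + w \<in> W) \<and> (\<forall>c. \<forall>v\<in>W. c \<cdot>\<^sub>v v \<in> W)"
  using vec_vs[where 'a=complex, of n] vec_module[where 'a=complex, of n]
  unfolding VectorSpace.subspace_def LinearCombinations.submodule_def
  by (auto simp: module_vec_simps class_ring_simps)

lemma mult_mat_vec_zero_cols: "A \<in> carrier_mat n 0 \<Longrightarrow> v \<in> carrier_vec 0 \<Longrightarrow> A *\<^sub>v v = (0\<^sub>v n :: 'a :: comm_ring_1 vec)"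
  by (auto simp: scalar_prod_def)

text \<open>The Gram matrix \<open>C * A\<close>, with \<open>C\<close> the conjugate transpose of
  \<open>A\<close>, is invertible: a vector \<open>v\<close> in its kernel makes the squared norm of
  \<open>A *\<^sub>v v\<close> zero. Its inverse times \<open>C\<close> is the left inverse.\<close>

lemma injective_mat_left_inverse:
  fixes A :: "complex mat"
  assumes A: "A \<in> carrier_mat n r" and inj: "\<And>v. v \<in> carrier_vec r \<Longrightarrow> A *\<^sub>v v = 0\<^sub>v n \<Longrightarrow> v = 0\<^sub>v r"
  obtains B where "B \<in> carrier_mat r n" "B * A = 1\<^sub>m r"
proof -
  define C where "C = mat r n (\<lambda>(i, j). cnj (A $$ (j, i)))"
  have C: "C \<in> carrier_mat r n" by (simp add: C_def)
  have CA: "C * A \<in> carrier_mat r r" using A C by simp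
  have "det (C * A) \<noteq> 0"
  proof
    assume "det (C * A) = 0"
    then obtain v where v: "v \<in> carrier_vec r" "v \<noteq> 0\<^sub>v r" "(C * A) *\<^sub>v v = 0\<^sub>v r"
      using det_0_iff_vec_prod_zero_field[OF CA] by blast
    define w where "w = A *\<^sub>v v"
    have w: "w \<in> carrier_vec n" using A v by (simp add: w_def)
    have "C *\<^sub>v w = 0\<^sub>v r" using v A C by (simp add: w_def)
    then have Cw: "(\<Sum>j<n. cnj (A $$ (j, i)) * w $ j) = 0" if "i < r" for i
      using that w C by (auto simp: C_def scalar_prod_def atLeast0LessThan dest!: arg_cong[where f = "\<lambda>u. u $ i"])
    have wj: "w $ j = (\<Sum>i<r. A $$ (j, i) * v $ i)" if "j < n" for j
      using that A v by (auto simp: w_def scalar_prod_def atLeast0LessThan intro!: sum.cong)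
    have "(\<Sum>j<n. cnj (w $ j) * w $ j) = (\<Sum>j<n. \<Sum>i<r. cnj (A $$ (j, i)) * cnj (v $ i) * w $ j)"
      by (rule sum.cong) (simp_all add: wj sum_distrib_right)
    also have "\<dots> = (\<Sum>i<r. cnj (v $ i) * (\<Sum>j<n. cnj (A $$ (j, i)) * w $ j))"
      by (subst sum.swap) (simp add: sum_distrib_left mult_ac)
    also have "\<dots> = 0" using Cw by simp
    finally have "(\<Sum>j<n. cnj (w $ j) * w $ j) = 0" .
    moreover have norm_sq: "cnj z * z = of_real ((cmod z)\<^sup>2)" for z
      using complex_norm_square[of z] by (simp add: mult.commute)
    ultimately have "(\<Sum>j<n. of_real ((cmod (w $ j))\<^sup>2)) = (0 :: complex)"
      by (simp only: norm_sq)
    then have "(\<Sum>j<n. (cmod (w $ j))\<^sup>2) = 0"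
      by (metis of_real_0 of_real_eq_iff of_real_sum)
    then have "\<forall>j<n. w $ j = 0" by (subst (asm) sum_nonneg_eq_0_iff) auto
    then have "w = 0\<^sub>v n" using w by auto
    then show False using inj v by (auto simp: w_def)
  qed
  then obtain D where D: "D \<in> carrier_mat r r" "D * (C * A) = 1\<^sub>m r"
    using det_non_zero_imp_unit[OF CA, of "()"] by (auto simp: Units_def ring_mat_def)
  show ?thesis
  proof
    show "D * C \<in> carrier_mat r n" using C D by simp
    show "(D * C) * A = 1\<^sub>m r" using A C D by (simp add: assoc_mult_mat[of D r r C n A r])
  qed
qed

text \<open>The columns of \<open>A\<close> are a basis of \<open>W\<close>, found as a maximal
  independent subset, and \<open>B\<close> is a left inverse of \<open>A\<close>. So
  \<open>A * B\<close> is a projection onto \<open>W\<close>, and membership in \<open>W\<close>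
  becomes a matrix equation, the form in which \<open>reducible_rep_split\<close> uses it.\<close>

lemma subspace_factorization:
  assumes W: "VectorSpace.subspace class_ring W (module_vec TYPE(complex) n)"
  obtains r A B where "A \<in> carrier_mat n r" "B \<in> carrier_mat r n" "B * A = 1\<^sub>m r"
    "\<And>w. w \<in> carrier_vec n \<Longrightarrow> w \<in> W \<longleftrightarrow> A *\<^sub>v (B *\<^sub>v w) = w"
proof -
  interpret vs: vec_space "TYPE(complex)" n .
  have WC: "W \<subseteq> carrier_vec n" using W by (simp add: subspace_vec_iff)
  have sm: "submodule class_ring W (module_vec TYPE(complex) n)" using W by (simp add: VectorSpace.subspace_def)
  let ?P = "\<lambda>S. S \<subseteq> W \<and> vs.lin_indpt S"
  have "\<exists>S. finite S \<and> maximal S ?P"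
  proof (rule maximal_exists)
    show "finite S \<and> card S \<le> vs.dim" if "?P S" for S
      using vs.li_le_dim[OF vs.fin_dim, of S] that WC by auto
    show "?P {}" by (simp add: vs.lin_dep_def)
  qed
  then obtain S where fS: "finite S" and mS: "maximal S ?P" by blast
  have S: "finite S" "S \<subseteq> W" "vs.lin_indpt S" using fS mS by (simp_all add: maximal_def)
  have max: "T = S" if "S \<subseteq> T" "T \<subseteq> W" "vs.lin_indpt T" for T
    using mS that by (simp add: maximal_def)
  have SC: "S \<subseteq> carrier_vec n" using S WC by auto
  obtain bs where bs: "set bs = S" "distinct bs" using S(1) finite_distinct_list by blast
  define r where "r = length bs"
  define A where "A = mat_of_cols n bs"
  have A: "A \<in> carrier_mat n r" by (simp add: A_def r_def)
  have cols: "cols A = bs" using bs SC by (simp add: A_def)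
  have inj: "v = 0\<^sub>v r" if "v \<in> carrier_vec r" "A *\<^sub>v v = 0\<^sub>v n" for v
    using vs.lin_depI[OF A that(1) _ that(2)] S(3) bs cols by auto
  obtain B where B: "B \<in> carrier_mat r n" "B * A = 1\<^sub>m r"
    using injective_mat_left_inverse[OF A inj] by blast
  have spanS: "vs.span S = W"
  proof
    show "vs.span S \<subseteq> W" using vs.span_is_subset[OF S(2) sm] .
    show "W \<subseteq> vs.span S"
    proof
      fix w assume w: "w \<in> W"
      show "w \<in> vs.span S"
      proof (cases "w \<in> S")
        case True
        then show ?thesis using vs.in_own_span SC by auto
      next
        case False
        then have "vs.lin_dep (S \<union> {w})" using max[of "S \<union> {w}"] w S by auto
        then show ?thesis using vs.lin_dep_iff_in_span[of S w] SC S(3) w WC False by auto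
      qed
    qed
  qed
  have W_iff: "w \<in> W \<longleftrightarrow> (\<exists>v\<in>carrier_vec r. w = A *\<^sub>v v)" if "w \<in> carrier_vec n" for w
  proof
    assume "w \<in> W"
    then obtain a where "w = vs.lincomb a S"
      using spanS vs.finite_in_span[OF S(1)] SC by auto
    then have "w = A *\<^sub>v vec r (\<lambda>i. a (col A i))"
      using vs.mat_mult_eq_lincomb[OF A, of a] bs cols by simp
    then show "\<exists>v\<in>carrier_vec r. w = A *\<^sub>v v" by auto
  next
    assume "\<exists>v\<in>carrier_vec r. w = A *\<^sub>v v"
    then obtain v where v: "v \<in> carrier_vec r" "w = A *\<^sub>v v" by blast
    have "w = vs.lincomb (\<lambda>a. v $ find_first a (cols A)) S"
      using vs.lincomb_eq_mat_mult[OF A v(1)] bs cols v(2) by simp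
    then show "w \<in> W" using spanS S(1) unfolding vs.span_def by blast
  qed
  show ?thesis
  proof
    show "A \<in> carrier_mat n r" "B \<in> carrier_mat r n" "B * A = 1\<^sub>m r" by fact+
    fix w :: "complex vec" assume w: "w \<in> carrier_vec n"
    show "w \<in> W \<longleftrightarrow> A *\<^sub>v (B *\<^sub>v w) = w"
    proof
      assume "w \<in> W"
      then obtain v where v: "v \<in> carrier_vec r" "w = A *\<^sub>v v" using W_iff[OF w] by blast
      have "B *\<^sub>v (A *\<^sub>v v) = v" using A B v(1) assoc_mult_mat_vec[OF B(1) A v(1)] by simp
      then show "A *\<^sub>v (B *\<^sub>v w) = w" using v by simp
    next
      assume "A *\<^sub>v (B *\<^sub>v w) = w"
      then show "w \<in> W" using W_iff[OF w] B(1) w by (metis mult_mat_vec_carrier)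
    qed
  qed
qed

section \<open>Schur's lemma\<close>

lemma eq_mat_by_vecI:
  fixes A B :: "complex mat"
  assumes A: "A \<in> carrier_mat n m" and B: "B \<in> carrier_mat n m"
    and eq: "\<And>v. v \<in> carrier_vec m \<Longrightarrow> A *\<^sub>v v = B *\<^sub>v v"
  shows "A = B"
proof (rule eq_matI)
  fix i j assume ij: "i < dim_row B" "j < dim_col B"
  then have "(A *\<^sub>v unit_vec m j) $ i = (B *\<^sub>v unit_vec m j) $ i" using eq by simp
  then show "A $$ (i, j) = B $$ (i, j)" using ij A B by simp
qed (use A B in auto)

lemma zero_mat_mult_vec: "v \<in> carrier_vec m \<Longrightarrow> 0\<^sub>m n m *\<^sub>v v = (0\<^sub>v n :: complex vec)"
  by (rule eq_vecI) auto

lemma smult_one_mat_mult_vec: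
  "v \<in> carrier_vec n \<Longrightarrow> (k \<cdot>\<^sub>m 1\<^sub>m n) *\<^sub>v v = k \<cdot>\<^sub>v (v :: complex vec)"
  by (rule eq_vecI) auto

lemma (in group) is_rep_iff:
  "is_rep G n \<rho> \<longleftrightarrow> n > 0 \<and> (\<forall>g\<in>carrier G. \<rho> g \<in> carrier_mat n n) \<and>
     (\<forall>g\<in>carrier G. \<forall>h\<in>carrier G. \<rho> (g \<otimes> h) = \<rho> g * \<rho> h) \<and> \<rho> \<one> = 1\<^sub>m n"
  (is "?L \<longleftrightarrow> ?R")
proof
  assume L: ?L
  have U: "\<rho> g \<in> Units (ring_mat TYPE(complex) n ())" if "g \<in> carrier G" for g
    using L that by (auto simp: is_rep_def GL_complex_def hom_def units_of_def)
  have c: "\<rho> g \<in> carrier_mat n n" if "g \<in> carrier G" for g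
    using U[OF that] by (auto simp: Units_def ring_mat_simps)
  have m: "\<rho> (g \<otimes> h) = \<rho> g * \<rho> h" if "g \<in> carrier G" "h \<in> carrier G" for g h
    using L that by (auto simp: is_rep_def GL_complex_def hom_def units_of_def ring_mat_simps)
  \<comment> \<open>\<open>\<rho> \<one>\<close> is idempotent and has a left inverse, so it is the
    identity.\<close>
  have "\<rho> \<one> = 1\<^sub>m n"
  proof -
    obtain B where B: "B \<in> carrier_mat n n" "B * \<rho> \<one> = 1\<^sub>m n"
      using U[of \<one>] by (auto simp: Units_def ring_mat_simps)
    have "\<rho> \<one> = (B * \<rho> \<one>) * \<rho> \<one>" using c[of \<one>] B by simp
    also have "\<dots> = B * (\<rho> \<one> * \<rho> \<one>)" using c[of \<one>] B(1) by (simp add: assoc_mult_mat[of B n n _ n _ n])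
    also have "\<dots> = B * \<rho> \<one>" using m[of \<one> \<one>] by simp
    finally show ?thesis using B by simp
  qed
  then show ?R using L c m by (simp add: is_rep_def)
next
  assume R: ?R
  have "\<rho> g \<in> Units (ring_mat TYPE(complex) n ())" if g: "g \<in> carrier G" for g
  proof -
    have "\<rho> g * \<rho> (inv g) = 1\<^sub>m n" "\<rho> (inv g) * \<rho> g = 1\<^sub>m n"
      using R g by (metis inv_closed r_inv, metis inv_closed l_inv)
    then show ?thesis using R g by (auto simp: Units_def ring_mat_simps)
  qed
  then show ?L using R by (auto simp: is_rep_def GL_complex_def hom_def units_of_def ring_mat_simps)
qed

text \<open>The zero matrix depends on the size, so the size is an argument and the sum is taken
  entry by entry.\<close>

definition msum :: "nat \<Rightarrow> nat \<Rightarrow> ('a \<Rightarrow> complex mat) \<Rightarrow> 'a set \<Rightarrow> complex mat" where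
  "msum n m F X = mat n m (\<lambda>ij. \<Sum>x\<in>X. F x $$ ij)"

lemma msum_carrier [simp]: "msum n m F X \<in> carrier_mat n m"
  by (simp add: msum_def)

lemma msum_cong: "(\<And>x. x \<in> X \<Longrightarrow> F x = F' x) \<Longrightarrow> msum n m F X = msum n m F' X"
  by (simp add: msum_def)

lemma mult_msum:
  assumes "B \<in> carrier_mat k n" "\<And>x. x \<in> X \<Longrightarrow> F x \<in> carrier_mat n m"
  shows "B * msum n m F X = msum k m (\<lambda>x. B * F x) X"
proof (rule eq_matI)
  fix i j assume ij: "i < dim_row (msum k m (\<lambda>x. B * F x) X)" "j < dim_col (msum k m (\<lambda>x. B * F x) X)"
  then have ij': "i < k" "j < m" by (simp_all add: msum_def)
  have *: "(\<Sum>l<n. B $$ (i, l) * F x $$ (l, j)) = (B * F x) $$ (i, j)" if "x \<in> X" for x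
    using assms(2)[OF that] assms(1) ij' by (auto simp: scalar_prod_def atLeast0LessThan intro!: sum.cong)
  have "(B * msum n m F X) $$ (i, j) = (\<Sum>l<n. B $$ (i, l) * (\<Sum>x\<in>X. F x $$ (l, j)))"
    using ij' assms(1) by (auto simp: msum_def scalar_prod_def atLeast0LessThan intro!: sum.cong)
  also have "\<dots> = (\<Sum>x\<in>X. \<Sum>l<n. B $$ (i, l) * F x $$ (l, j))"
    by (simp add: sum_distrib_left sum.swap[of _ X])
  also have "\<dots> = (\<Sum>x\<in>X. (B * F x) $$ (i, j))"
    by (rule sum.cong) (simp_all add: *)
  finally show "(B * msum n m F X) $$ (i, j) = msum k m (\<lambda>x. B * F x) X $$ (i, j)"
    using ij' by (simp add: msum_def)
qed (use assms in \<open>auto simp: msum_def\<close>)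

lemma msum_mult:
  assumes "B \<in> carrier_mat m k" "\<And>x. x \<in> X \<Longrightarrow> F x \<in> carrier_mat n m"
  shows "msum n m F X * B = msum n k (\<lambda>x. F x * B) X"
proof (rule eq_matI)
  fix i j assume ij: "i < dim_row (msum n k (\<lambda>x. F x * B) X)" "j < dim_col (msum n k (\<lambda>x. F x * B) X)"
  then have ij': "i < n" "j < k" by (simp_all add: msum_def)
  have *: "(\<Sum>l<m. F x $$ (i, l) * B $$ (l, j)) = (F x * B) $$ (i, j)" if "x \<in> X" for x
    using assms(2)[OF that] assms(1) ij' by (auto simp: scalar_prod_def atLeast0LessThan intro!: sum.cong)
  have "(msum n m F X * B) $$ (i, j) = (\<Sum>l<m. (\<Sum>x\<in>X. F x $$ (i, l)) * B $$ (l, j))"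
    using ij' assms(1) by (auto simp: msum_def scalar_prod_def atLeast0LessThan intro!: sum.cong)
  also have "\<dots> = (\<Sum>x\<in>X. \<Sum>l<m. F x $$ (i, l) * B $$ (l, j))"
    by (simp add: sum_distrib_right sum.swap[of _ X])
  also have "\<dots> = (\<Sum>x\<in>X. (F x * B) $$ (i, j))"
    by (rule sum.cong) (simp_all add: *)
  finally show "(msum n m F X * B) $$ (i, j) = msum n k (\<lambda>x. F x * B) X $$ (i, j)"
    using ij' by (simp add: msum_def)
qed (use assms in \<open>auto simp: msum_def\<close>)

lemma mat_trace_msum:
  assumes "\<And>x. x \<in> X \<Longrightarrow> F x \<in> carrier_mat n n"
  shows "mat_trace (msum n n F X) = (\<Sum>x\<in>X. mat_trace (F x))"
proof -
  have "mat_trace (msum n n F X) = (\<Sum>x\<in>X. \<Sum>i<n. F x $$ (i, i))"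
    by (simp add: mat_trace_def msum_def sum.swap[of _ X])
  also have "\<dots> = (\<Sum>x\<in>X. mat_trace (F x))"
    using assms by (auto simp: mat_trace_def intro!: sum.cong)
  finally show ?thesis .
qed

lemma (in group) sum_left_translate:
  assumes "h \<in> carrier G"
  shows "(\<Sum>g\<in>carrier G. f (h \<otimes> g)) = (\<Sum>g\<in>carrier G. f g)"
proof (rule sum.reindex_bij_witness[where i = "\<lambda>g. inv h \<otimes> g" and j = "\<lambda>g. h \<otimes> g"])
  show "inv h \<otimes> (h \<otimes> g) = g" if "g \<in> carrier G" for g using assms that by (simp add: m_assoc[symmetric])
  show "h \<otimes> (inv h \<otimes> g) = g" if "g \<in> carrier G" for g using assms that by (simp add: m_assoc[symmetric])
qed (use assms in auto)

text \<open>Multiplication by \<open>\<rho> h\<close> only permutes the summands: substitute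
  \<open>h \<otimes> g\<close> for \<open>g\<close> and use
  \<open>inv (h \<otimes> g) \<otimes> h = inv g\<close>.\<close>

lemma (in group) averaged_intertwines:
  assumes \<rho>: "is_rep G n \<rho>" and \<sigma>: "is_rep G m \<sigma>" and A: "A \<in> carrier_mat n m" and h: "h \<in> carrier G"
  defines "T \<equiv> msum n m (\<lambda>g. \<rho> g * A * \<sigma> (inv g)) (carrier G)"
  shows "\<rho> h * T = T * \<sigma> h"
proof -
  have c: "\<rho> g \<in> carrier_mat n n" "\<sigma> g \<in> carrier_mat m m" if "g \<in> carrier G" for g
    using \<rho> \<sigma> that by (auto simp: is_rep_iff)
  have m: "\<rho> (g \<otimes> g') = \<rho> g * \<rho> g'" "\<sigma> (g \<otimes> g') = \<sigma> g * \<sigma> g'" if "g \<in> carrier G" "g' \<in> carrier G" for g g'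
    using \<rho> \<sigma> that by (auto simp: is_rep_iff)
  have c3: "\<rho> g * A * \<sigma> (inv g) \<in> carrier_mat n m" if "g \<in> carrier G" for g
    using c that A by (meson mult_carrier_mat inv_closed)
  have "\<rho> h * T = msum n m (\<lambda>g. \<rho> h * (\<rho> g * A * \<sigma> (inv g))) (carrier G)"
    unfolding T_def using c c3 h by (intro mult_msum) auto
  also have "\<dots> = msum n m (\<lambda>g. \<rho> (h \<otimes> g) * A * \<sigma> (inv (h \<otimes> g) \<otimes> h)) (carrier G)"
  proof (rule msum_cong)
    fix g assume g: "g \<in> carrier G"
    have "inv (h \<otimes> g) \<otimes> h = inv g" using g h by (simp add: inv_mult_group m_assoc)
    moreover have "\<rho> h * (\<rho> g * A * \<sigma> (inv g)) = \<rho> h * \<rho> g * A * \<sigma> (inv g)"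
      using c[OF g] c[OF h] c[of "inv g"] A g
      by (simp add: assoc_mult_mat[of _ n n _ m _ m] assoc_mult_mat[of _ n n _ n _ m])
    ultimately show "\<rho> h * (\<rho> g * A * \<sigma> (inv g)) = \<rho> (h \<otimes> g) * A * \<sigma> (inv (h \<otimes> g) \<otimes> h)"
      using m g h by simp
  qed
  also have "\<dots> = msum n m (\<lambda>g. \<rho> g * A * \<sigma> (inv g \<otimes> h)) (carrier G)"
    unfolding msum_def by (subst sum_left_translate[OF h]) simp
  also have "\<dots> = msum n m (\<lambda>g. \<rho> g * A * \<sigma> (inv g) * \<sigma> h) (carrier G)"
  proof (rule msum_cong)
    fix g assume g: "g \<in> carrier G"
    have "\<rho> g * A \<in> carrier_mat n m" using c g A by (meson mult_carrier_mat)
    then show "\<rho> g * A * \<sigma> (inv g \<otimes> h) = \<rho> g * A * \<sigma> (inv g) * \<sigma> h"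
      using m g h c A by (simp add: assoc_mult_mat[of _ n m _ m _ m])
  qed
  also have "\<dots> = T * \<sigma> h"
    unfolding T_def using c c3 h by (intro msum_mult[symmetric]) auto
  finally show ?thesis .
qed

lemma irreducible_repD:
  assumes "irreducible_rep G n \<rho>" and "W \<subseteq> carrier_vec n" "0\<^sub>v n \<in> W"
    "\<And>v w. v \<in> W \<Longrightarrow> w \<in> W \<Longrightarrow> v + w \<in> W" "\<And>c v. v \<in> W \<Longrightarrow> c \<cdot>\<^sub>v v \<in> W"
    "\<And>g w. g \<in> carrier G \<Longrightarrow> w \<in> W \<Longrightarrow> \<rho> g *\<^sub>v w \<in> W"
  shows "W = {0\<^sub>v n} \<or> W = carrier_vec n"
proof -
  have "VectorSpace.subspace class_ring W (module_vec TYPE(complex) n)"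
    using assms by (simp add: subspace_vec_iff)
  then show ?thesis using assms by (simp add: irreducible_rep_def)
qed

text \<open>Kernel and image of \<open>T\<close> are invariant subspaces, so the kernel is zero and
  the image is everything. Injectivity gives a left inverse, and surjectivity makes it a right
  inverse too.\<close>

lemma (in group) schur_invertible:
  assumes \<rho>: "irreducible_rep G n \<rho>" and \<sigma>: "irreducible_rep G m \<sigma>" and T: "T \<in> carrier_mat n m"
    and comm: "\<And>g. g \<in> carrier G \<Longrightarrow> \<rho> g * T = T * \<sigma> g" and nz: "T \<noteq> 0\<^sub>m n m"
  obtains B where "B \<in> carrier_mat m n" "T * B = 1\<^sub>m n" "B * T = 1\<^sub>m m"
proof -
  have c: "\<rho> g \<in> carrier_mat n n" "\<sigma> g \<in> carrier_mat m m" if "g \<in> carrier G" for g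
    using \<rho> \<sigma> that by (auto simp: is_rep_iff irreducible_rep_def)
  have comm_vec: "\<rho> g *\<^sub>v (T *\<^sub>v v) = T *\<^sub>v (\<sigma> g *\<^sub>v v)" if "g \<in> carrier G" "v \<in> carrier_vec m" for g v
    using comm[OF that(1)] c[OF that(1)] T that(2) by (metis assoc_mult_mat_vec)
  let ?K = "{v \<in> carrier_vec m. T *\<^sub>v v = 0\<^sub>v n}"
  have T0: "T *\<^sub>v 0\<^sub>v m = 0\<^sub>v n" using T by auto
  have "?K = {0\<^sub>v m} \<or> ?K = carrier_vec m"
  proof (rule irreducible_repD[OF \<sigma>])
    show "v + w \<in> ?K" if "v \<in> ?K" "w \<in> ?K" for v w
      using that T by (auto simp: mult_add_distrib_mat_vec)
    show "k \<cdot>\<^sub>v v \<in> ?K" if "v \<in> ?K" for k v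
      using that T by (auto simp: mult_mat_vec[of _ n m])
    show "\<sigma> g *\<^sub>v w \<in> ?K" if "g \<in> carrier G" "w \<in> ?K" for g w
    proof -
      have "T *\<^sub>v (\<sigma> g *\<^sub>v w) = \<rho> g *\<^sub>v 0\<^sub>v n" using comm_vec[of g w] that by simp
      also have "\<dots> = 0\<^sub>v n" using c[OF that(1)] by auto
      finally show ?thesis using c[OF that(1)] that(2) by auto
    qed
  qed (use T0 in auto)
  moreover have "?K \<noteq> carrier_vec m"
  proof
    assume K: "?K = carrier_vec m"
    have "T = 0\<^sub>m n m"
    proof (rule eq_mat_by_vecI[OF T])
      show "T *\<^sub>v v = 0\<^sub>m n m *\<^sub>v v" if v: "v \<in> carrier_vec m" for v
      proof -
        have "v \<in> ?K" using v unfolding K .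
        then show ?thesis using v by (simp add: zero_mat_mult_vec)
      qed
    qed simp
    then show False using nz by simp
  qed
  ultimately have K: "?K = {0\<^sub>v m}" by blast
  have inj: "v = 0\<^sub>v m" if "v \<in> carrier_vec m" "T *\<^sub>v v = 0\<^sub>v n" for v
    using K that by blast
  obtain B where B: "B \<in> carrier_mat m n" "B * T = 1\<^sub>m m"
    using injective_mat_left_inverse[OF T inj] by blast
  let ?I = "(\<lambda>v. T *\<^sub>v v) ` carrier_vec m"
  have "?I = {0\<^sub>v n} \<or> ?I = carrier_vec n"
  proof (rule irreducible_repD[OF \<rho>])
    show "?I \<subseteq> carrier_vec n" using T by auto
    show "0\<^sub>v n \<in> ?I" using T0 by (metis image_eqI zero_carrier_vec)
    show "v + w \<in> ?I" if "v \<in> ?I" "w \<in> ?I" for v w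
      using that T by (auto simp: mult_add_distrib_mat_vec[symmetric])
    show "k \<cdot>\<^sub>v v \<in> ?I" if "v \<in> ?I" for k v
      using that T by (auto simp: mult_mat_vec[of _ n m, symmetric])
    show "\<rho> g *\<^sub>v w \<in> ?I" if g: "g \<in> carrier G" and "w \<in> ?I" for g w
      using that(2) comm_vec[OF g] c[OF g] by auto
  qed
  moreover have "?I \<noteq> {0\<^sub>v n}"
  proof
    assume "?I = {0\<^sub>v n}"
    then have "T *\<^sub>v v = 0\<^sub>v n" if "v \<in> carrier_vec m" for v using that by blast
    then have "T = 0\<^sub>m n m" by (intro eq_mat_by_vecI[OF T]) (auto simp: zero_mat_mult_vec)
    then show False using nz by simp
  qed
  ultimately have I: "?I = carrier_vec n" by blast
  have "T * B = 1\<^sub>m n"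
  proof (rule eq_mat_by_vecI)
    fix w :: "complex vec" assume w: "w \<in> carrier_vec n"
    then obtain v where v: "v \<in> carrier_vec m" "w = T *\<^sub>v v" using I by blast
    have "T * B *\<^sub>v w = T *\<^sub>v (B *\<^sub>v (T *\<^sub>v v))"
      using T B w v by (simp add: assoc_mult_mat_vec[of _ n m _ n])
    also have "B *\<^sub>v (T *\<^sub>v v) = v"
      using B T v assoc_mult_mat_vec[OF B(1) T v(1)] by simp
    finally show "T * B *\<^sub>v w = 1\<^sub>m n *\<^sub>v w" using v w by simp
  qed (use T B in auto)
  then show ?thesis using that B by blast
qed

text \<open>\<open>T\<close> conjugates one representation into the other. Because
  \<open>mat_trace_comm\<close> holds for rectangular factors, \<open>n = m\<close> need not be
  established first.\<close>

lemma (in group) schur_character_eq: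
  assumes \<rho>: "irreducible_rep G n \<rho>" and \<sigma>: "irreducible_rep G m \<sigma>" and T: "T \<in> carrier_mat n m"
    and comm: "\<And>g. g \<in> carrier G \<Longrightarrow> \<rho> g * T = T * \<sigma> g" and nz: "T \<noteq> 0\<^sub>m n m"
  shows "rep_character G \<rho> = rep_character G \<sigma>"
proof -
  obtain B where B: "B \<in> carrier_mat m n" "T * B = 1\<^sub>m n" "B * T = 1\<^sub>m m"
    using schur_invertible[OF assms] by blast
  have "mat_trace (\<rho> g) = mat_trace (\<sigma> g)" if g: "g \<in> carrier G" for g
  proof -
    have c: "\<rho> g \<in> carrier_mat n n" "\<sigma> g \<in> carrier_mat m m"
      using \<rho> \<sigma> g by (auto simp: is_rep_iff irreducible_rep_def)
    have "mat_trace (\<rho> g) = mat_trace (\<rho> g * T * B)"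
      using B c T by (simp add: assoc_mult_mat[of _ n n _ m _ n])
    also have "\<dots> = mat_trace (T * (\<sigma> g * B))"
      using comm[OF g] B c T by (simp add: assoc_mult_mat[of _ n m _ m _ n])
    also have "\<dots> = mat_trace (\<sigma> g * B * T)"
      using B c T by (intro mat_trace_comm) auto
    also have "\<dots> = mat_trace (\<sigma> g)"
      using B c T by (simp add: assoc_mult_mat[of _ m m _ n _ m])
    finally show ?thesis .
  qed
  then show ?thesis by (auto simp: rep_character_def)
qed

lemma complex_eigenvector:
  fixes T :: "complex mat"
  assumes "T \<in> carrier_mat n n" "n > 0"
  obtains c v where "v \<in> carrier_vec n" "v \<noteq> 0\<^sub>v n" "T *\<^sub>v v = c \<cdot>\<^sub>v v"
proof -
  have "degree (char_poly T) = n" using degree_monic_char_poly[OF assms(1)] by simp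
  then have "\<not> constant (poly (char_poly T))" using assms(2) by (simp add: constant_degree)
  then obtain c where "poly (char_poly T) c = 0" using fundamental_theorem_of_algebra by blast
  then have "eigenvalue T c" using eigenvalue_root_char_poly[OF assms(1)] by simp
  then show ?thesis using that assms by (auto simp: eigenvalue_def eigenvector_def)
qed

text \<open>Subtract an eigenvalue: \<open>T - k \<cdot>\<^sub>m 1\<^sub>m n\<close> still commutes
  with the representation but kills an eigenvector, so it is not invertible and must be
  zero.\<close>

lemma (in group) schur_scalar:
  assumes \<rho>: "irreducible_rep G n \<rho>" and T: "T \<in> carrier_mat n n"
    and comm: "\<And>g. g \<in> carrier G \<Longrightarrow> \<rho> g * T = T * \<rho> g"
  obtains c where "T = c \<cdot>\<^sub>m 1\<^sub>m n"
proof -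
  have c: "\<rho> g \<in> carrier_mat n n" if "g \<in> carrier G" for g
    using \<rho> that by (auto simp: is_rep_iff irreducible_rep_def)
  have "n > 0" using \<rho> by (auto simp: is_rep_def irreducible_rep_def)
  then obtain k v where v: "v \<in> carrier_vec n" "v \<noteq> 0\<^sub>v n" "T *\<^sub>v v = k \<cdot>\<^sub>v v"
    using complex_eigenvector[OF T] by blast
  define S where "S = T - k \<cdot>\<^sub>m 1\<^sub>m n"
  have S: "S \<in> carrier_mat n n" using T by (simp add: S_def minus_carrier_mat)
  have Sv: "S *\<^sub>v v = 0\<^sub>v n" 
    using T v by (simp add: S_def minus_mult_distrib_mat_vec[of _ n n] smult_one_mat_mult_vec)
  have "\<rho> g * S = S * \<rho> g" if "g \<in> carrier G" for g
    using c[OF that] T comm[OF that]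
    by (simp add: S_def mult_minus_distrib_mat[of _ n n _ n] minus_mult_distrib_mat[of _ n n _ _ n] mult_smult_distrib[of _ n n _ n] mult_smult_assoc_mat[of _ n n _ n])
  then have "S = 0\<^sub>m n n"
  proof (rule_tac ccontr)
    assume *: "\<And>g. g \<in> carrier G \<Longrightarrow> \<rho> g * S = S * \<rho> g" and "S \<noteq> 0\<^sub>m n n"
    then obtain B where B: "B \<in> carrier_mat n n" "B * S = 1\<^sub>m n"
      using schur_invertible[OF \<rho> \<rho> S] by blast
    have "v = B *\<^sub>v (S *\<^sub>v v)" using B S v assoc_mult_mat_vec[OF B(1) S v(1)] by simp
    also have "\<dots> = 0\<^sub>v n" using B Sv by auto
    finally show False using v by simp
  qed
  then have "T = k \<cdot>\<^sub>m 1\<^sub>m n"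
  proof -
    have "T $$ (i, j) = (k \<cdot>\<^sub>m 1\<^sub>m n) $$ (i, j)" if "i < n" "j < n" for i j
    proof -
      have "S $$ (i, j) = 0" using \<open>S = 0\<^sub>m n n\<close> that by simp
      then show ?thesis using T that by (simp add: S_def)
    qed
    then show ?thesis using T by (intro eq_matI) auto
  qed
  then show ?thesis using that by blast
qed

section \<open>Orthogonality relations and decomposition into irreducibles\<close>

text \<open>Associativity with dimensions in place of carrier sets: no size variable is left open,
  so simplification can discharge the side conditions.\<close>

lemma assoc_mult_mat_dim:
  "dim_col A = dim_row B \<Longrightarrow> dim_col B = dim_row C \<Longrightarrow> (A * B) * C = A * (B * (C :: complex mat))"
  by (rule assoc_mult_mat[of A "dim_row A" "dim_row B" B "dim_row C" C "dim_col C"]) auto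

text \<open>Averaging an elementary matrix thus produces sums of products of matrix coefficients,
  which is how Schur's lemma yields the orthogonality relations.\<close>

lemma elementary_mat_mult:
  fixes X Y :: "complex mat"
  assumes "X \<in> carrier_mat n n" "Y \<in> carrier_mat m m" "i < n" "j < n" "k < m" "l < m"
  shows "(X * mat n m (\<lambda>ab. if ab = (j, k) then 1 else 0) * Y) $$ (i, l) = X $$ (i, j) * Y $$ (k, l)"
proof -
  let ?A = "mat n m (\<lambda>ab. if ab = (j, k) then 1 else 0) :: complex mat"
  have XA: "(X * ?A) $$ (i, b) = (if b = k then X $$ (i, j) else 0)" if "b < m" for b
  proof -
    have "(X * ?A) $$ (i, b) = (\<Sum>a<n. X $$ (i, a) * (if a = j \<and> b = k then 1 else 0))"
      using that assms by (auto simp: scalar_prod_def atLeast0LessThan intro!: sum.cong)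
    also have "\<dots> = (\<Sum>a<n. if a = j then (if b = k then X $$ (i, j) else 0) else 0)"
      by (intro sum.cong) auto
    finally show ?thesis using assms by simp
  qed
  have "(X * ?A * Y) $$ (i, l) = (\<Sum>b<m. (X * ?A) $$ (i, b) * Y $$ (b, l))"
    using assms by (auto simp: scalar_prod_def atLeast0LessThan intro!: sum.cong simp del: index_mult_mat(1) simp add: index_mult_mat(1)[of _ "X * ?A"])
  also have "\<dots> = (\<Sum>b<m. if b = k then X $$ (i, j) * Y $$ (k, l) else 0)"
    by (intro sum.cong) (auto simp del: index_mult_mat(1) simp add: XA)
  finally show ?thesis using assms by simp
qed

lemma (in group) averaged_carrier:
  assumes \<rho>: "is_rep G n \<rho>" and \<sigma>: "is_rep G m \<sigma>" and A: "A \<in> carrier_mat n m" and g: "g \<in> carrier G"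
  shows "\<rho> g * A * \<sigma> (inv g) \<in> carrier_mat n m"
  using assms unfolding is_rep_iff by (meson mult_carrier_mat inv_closed)

text \<open>The sum is an entry of the average of the elementary matrix at \<open>(j, k)\<close>.
  This average is an intertwiner, and a nonzero one would make the characters equal.\<close>

lemma (in group) matrix_coefficients_orthogonal:
  assumes \<rho>: "irreducible_rep G n \<rho>" and \<sigma>: "irreducible_rep G m \<sigma>"
    and ne: "rep_character G \<rho> \<noteq> rep_character G \<sigma>"
    and "i < n" "j < n" "k < m" "l < m"
  shows "(\<Sum>g\<in>carrier G. \<rho> g $$ (i, j) * \<sigma> (inv g) $$ (k, l)) = 0"
proof -
  have reps: "is_rep G n \<rho>" "is_rep G m \<sigma>" using \<rho> \<sigma> by (auto simp: irreducible_rep_def)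
  let ?A = "mat n m (\<lambda>ab. if ab = (j, k) then 1 else 0) :: complex mat"
  let ?T = "msum n m (\<lambda>g. \<rho> g * ?A * \<sigma> (inv g)) (carrier G)"
  have "?T = 0\<^sub>m n m"
    using schur_character_eq[OF \<rho> \<sigma>, of ?T] averaged_intertwines[OF reps, of ?A] ne by fastforce
  then have T0: "?T $$ (i, l) = 0" using assms by simp
  have entry: "(\<rho> g * ?A * \<sigma> (inv g)) $$ (i, l) = \<rho> g $$ (i, j) * \<sigma> (inv g) $$ (k, l)"
    if "g \<in> carrier G" for g
    using that assms(4-) reps by (intro elementary_mat_mult) (auto simp: is_rep_iff)
  have "?T $$ (i, l) = (\<Sum>g\<in>carrier G. \<rho> g $$ (i, j) * \<sigma> (inv g) $$ (k, l))"
    using assms(4-) entry by (simp add: msum_def del: index_mult_mat)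
  then show ?thesis using T0 by simp
qed

text \<open>Here the averaged elementary matrix is a scalar matrix. The scalar is read off from the
  trace, since each summand has the trace of the elementary matrix itself.\<close>

lemma (in group) matrix_coefficients_orthonormal:
  assumes fin: "finite (carrier G)" and \<rho>: "irreducible_rep G n \<rho>"
    and ij: "i < n" "j < n" "k < n" "l < n"
  shows "(\<Sum>g\<in>carrier G. \<rho> g $$ (i, j) * \<rho> (inv g) $$ (k, l)) =
    (if i = l \<and> j = k then of_nat (card (carrier G)) / of_nat n else 0)"
proof -
  have rep: "is_rep G n \<rho>" using \<rho> by (auto simp: irreducible_rep_def)
  have c: "\<rho> g \<in> carrier_mat n n" if "g \<in> carrier G" for g using rep that by (auto simp: is_rep_iff)
  let ?A = "mat n n (\<lambda>ab. if ab = (j, k) then 1 else 0) :: complex mat"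
  let ?T = "msum n n (\<lambda>g. \<rho> g * ?A * \<rho> (inv g)) (carrier G)"
  obtain t where t: "?T = t \<cdot>\<^sub>m 1\<^sub>m n"
    using schur_scalar[OF \<rho>, of ?T] averaged_intertwines[OF rep rep, of ?A] by auto
  have tr: "mat_trace (\<rho> g * ?A * \<rho> (inv g)) = (if j = k then 1 else 0)" if g: "g \<in> carrier G" for g
  proof -
    have "\<rho> (inv g) * \<rho> g = 1\<^sub>m n" using rep g by (metis inv_closed is_rep_iff l_inv)
    moreover have "mat_trace (\<rho> g * ?A * \<rho> (inv g)) = mat_trace (\<rho> (inv g) * (\<rho> g * ?A))"
      using c[OF g] c[of "inv g"] g by (intro mat_trace_comm[of _ n n]) auto
    moreover have "\<rho> (inv g) * (\<rho> g * ?A) = (\<rho> (inv g) * \<rho> g) * ?A"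
      using c[OF g] c[of "inv g"] g by (simp add: assoc_mult_mat_dim carrier_matD)
    ultimately have "mat_trace (\<rho> g * ?A * \<rho> (inv g)) = mat_trace ?A" by simp
    also have "\<dots> = (\<Sum>a<n. if a = j then (if j = k then 1 else 0) else 0)"
      by (auto simp: mat_trace_def intro!: sum.cong)
    finally show ?thesis using ij by simp
  qed
  have "mat_trace ?T = (\<Sum>g\<in>carrier G. mat_trace (\<rho> g * ?A * \<rho> (inv g)))"
    using averaged_carrier[OF rep rep, of ?A] by (intro mat_trace_msum) simp
  also have "\<dots> = (if j = k then of_nat (card (carrier G)) else 0)"
    using tr by simp
  finally have "t * of_nat n = (if j = k then of_nat (card (carrier G)) else 0)"
    unfolding t by (simp add: mat_trace_smult[of _ n])
  then have t': "t = (if j = k then of_nat (card (carrier G)) / of_nat n else 0)"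
    using ij by (auto simp: field_simps split: if_splits)
  have "(\<rho> g * ?A * \<rho> (inv g)) $$ (i, l) = \<rho> g $$ (i, j) * \<rho> (inv g) $$ (k, l)"
    if "g \<in> carrier G" for g
    using that ij c by (intro elementary_mat_mult) auto
  then have "(\<Sum>g\<in>carrier G. \<rho> g $$ (i, j) * \<rho> (inv g) $$ (k, l)) = ?T $$ (i, l)"
    using ij by (simp add: msum_def del: index_mult_mat)
  also have "\<dots> = (if i = l then t else 0)" unfolding t using ij by simp
  finally show ?thesis using t' by simp
qed

text \<open>Expansion into matrix coefficients reduces this to the two preceding relations. The case
  \<open>x = \<one>\<close> is the orthogonality of irreducible characters; general \<open>x\<close>
  is needed for the convolution in \<open>induced_eq_of_constituent\<close>.\<close>

lemma (in group) irr_convolution: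
  assumes fin: "finite (carrier G)" and \<theta>: "\<theta> \<in> Irr G" and \<psi>: "\<psi> \<in> Irr G" and x: "x \<in> carrier G"
  shows "(\<Sum>g\<in>carrier G. \<theta> (inv g) * \<psi> (g \<otimes> x)) =
    (if \<theta> = \<psi> then of_nat (card (carrier G)) / \<theta> \<one> * \<theta> x else 0)"
proof -
  obtain n \<rho> where \<rho>: "irreducible_rep G n \<rho>" "\<psi> = rep_character G \<rho>"
    using \<psi> by (auto simp: Irr_def)
  \<comment> \<open>Equal characters are given one common representation, so that the coefficients
    of a single \<open>\<rho>\<close> are compared in that case.\<close>
  obtain m \<sigma> where \<sigma>: "irreducible_rep G m \<sigma>" "\<theta> = rep_character G \<sigma>" "\<theta> = \<psi> \<Longrightarrow> \<sigma> = \<rho> \<and> m = n"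
    using \<theta> \<rho> by (auto simp: Irr_def)
  have reps: "is_rep G n \<rho>" "is_rep G m \<sigma>" using \<rho> \<sigma> by (auto simp: irreducible_rep_def)
  have c: "\<rho> g \<in> carrier_mat n n" "\<sigma> g \<in> carrier_mat m m" if "g \<in> carrier G" for g
    using reps that by (auto simp: is_rep_iff)
  have \<psi>_eq: "\<psi> (g \<otimes> x) = (\<Sum>i<n. \<Sum>j<n. \<rho> g $$ (i, j) * \<rho> x $$ (j, i))" if g: "g \<in> carrier G" for g
  proof -
    have "\<psi> (g \<otimes> x) = mat_trace (\<rho> g * \<rho> x)" using g x \<rho>(2) reps by (simp add: rep_character_def is_rep_iff)
    then show ?thesis using c[OF g] c[OF x]
      by (auto simp: mat_trace_def scalar_prod_def atLeast0LessThan intro!: sum.cong)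
  qed
  have \<theta>_eq: "\<theta> (inv g) = (\<Sum>l<m. \<sigma> (inv g) $$ (l, l))" if g: "g \<in> carrier G" for g
    using g c(2)[of "inv g"] \<sigma>(2) by (auto simp: rep_character_def mat_trace_def)
  let ?c = "\<lambda>i j l. \<Sum>g\<in>carrier G. \<rho> g $$ (i, j) * \<sigma> (inv g) $$ (l, l)"
  have "\<theta> (inv g) * \<psi> (g \<otimes> x) =
    (\<Sum>i<n. \<Sum>j<n. \<Sum>l<m. \<rho> x $$ (j, i) * (\<rho> g $$ (i, j) * \<sigma> (inv g) $$ (l, l)))"
    if "g \<in> carrier G" for g
    unfolding \<psi>_eq[OF that] \<theta>_eq[OF that] by (simp add: sum_distrib_left sum_distrib_right mult_ac)
  then have "(\<Sum>g\<in>carrier G. \<theta> (inv g) * \<psi> (g \<otimes> x)) =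
    (\<Sum>g\<in>carrier G. \<Sum>i<n. \<Sum>j<n. \<Sum>l<m. \<rho> x $$ (j, i) * (\<rho> g $$ (i, j) * \<sigma> (inv g) $$ (l, l)))"
    by (rule sum.cong[OF refl])
  also have "\<dots> = (\<Sum>i<n. \<Sum>j<n. \<Sum>l<m. \<rho> x $$ (j, i) * ?c i j l)"
    by (simp only: sum.swap[of _ _ "carrier G"] sum_distrib_left)
  also have "\<dots> = (if \<theta> = \<psi> then of_nat (card (carrier G)) / \<theta> \<one> * \<theta> x else 0)"
  proof (cases "\<theta> = \<psi>")
    case False
    then have "?c i j l = 0" if "i < n" "j < n" "l < m" for i j l
      using matrix_coefficients_orthogonal[OF \<rho>(1) \<sigma>(1)] \<rho>(2) \<sigma>(2) that by metis
    then show ?thesis using False by simp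
  next
    case True
    then have eq: "\<sigma> = \<rho>" "m = n" using \<sigma>(3) by auto
    define q where "q = of_nat (card (carrier G)) / (of_nat n :: complex)"
    have "(\<Sum>i<n. \<Sum>j<n. \<Sum>l<m. \<rho> x $$ (j, i) * ?c i j l) =
      (\<Sum>i<n. \<Sum>j<n. \<Sum>l<n. if l = i then if j = i then \<rho> x $$ (i, i) * q else 0 else 0)"
      unfolding eq by (intro sum.cong refl) (auto simp: matrix_coefficients_orthonormal[OF fin \<rho>(1)] q_def)
    also have "\<dots> = (\<Sum>l<n. \<rho> x $$ (l, l)) * q"
      by (simp add: sum_distrib_right)
    also have "\<dots> = of_nat (card (carrier G)) / \<theta> \<one> * \<theta> x"
      using True \<rho>(2) reps c[OF x] x by (auto simp: rep_character_def is_rep_iff mat_trace_def q_def)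
    finally show ?thesis using True by simp
  qed
  finally show ?thesis .
qed

text \<open>The value at the inverse stands for the complex conjugate, with which it agrees on
  characters of a finite group. The form is bilinear and symmetric instead of Hermitian.\<close>

definition cinner :: "('a, 'b) monoid_scheme \<Rightarrow> ('a \<Rightarrow> complex) \<Rightarrow> ('a \<Rightarrow> complex) \<Rightarrow> complex" where
  "cinner G \<alpha> \<beta> = (\<Sum>g\<in>carrier G. \<alpha> g * \<beta> (inv\<^bsub>G\<^esub> g)) / of_nat (card (carrier G))"

lemma (in group) character_one:
  "is_rep G n \<rho> \<Longrightarrow> rep_character G \<rho> \<one> = of_nat n"
  by (auto simp: is_rep_iff rep_character_def)

lemma (in group) irr_degree:
  assumes "\<chi> \<in> Irr G"
  obtains n :: nat where "n > 0" "\<chi> \<one> = of_nat n"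
  using assms character_one by (auto simp: Irr_def irreducible_rep_def is_rep_def)

lemma (in group) cinner_irr:
  assumes fin: "finite (carrier G)" and "\<chi> \<in> Irr G" and "\<psi> \<in> Irr G"
  shows "cinner G \<chi> \<psi> = (if \<chi> = \<psi> then 1 else 0)"
proof -
  obtain n where n: "n > 0" "\<chi> \<one> = of_nat n" using irr_degree assms(2) by blast
  have "cinner G \<chi> \<psi> = (\<Sum>g\<in>carrier G. \<psi> (inv g) * \<chi> (g \<otimes> \<one>)) / of_nat (card (carrier G))"
    by (simp add: cinner_def mult.commute)
  moreover have "card (carrier G) > 0" using fin by (simp add: card_gt_0_iff) blast
  ultimately show ?thesis using irr_convolution[OF fin assms(3,2) one_closed] n by auto
qed

text \<open>\<open>\<rho>1\<close> is the action on an invariant subspace \<open>W\<close>, and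
  \<open>\<rho>2\<close> the action on the quotient by \<open>W\<close>, written in coordinates of a
  complement. The complement need not be invariant: block triangular form is enough for the traces.
  The last clause lets kernels be followed through the decomposition.\<close>

lemma (in group) reducible_rep_split:
  assumes \<rho>: "is_rep G n \<rho>" and red: "\<not> irreducible_rep G n \<rho>"
  obtains r s \<rho>1 \<rho>2 where "is_rep G r \<rho>1" "is_rep G s \<rho>2" "r < n" "s < n"
    "\<And>g. g \<in> carrier G \<Longrightarrow> mat_trace (\<rho> g) = mat_trace (\<rho>1 g) + mat_trace (\<rho>2 g)"
    "\<And>g. g \<in> carrier G \<Longrightarrow> \<rho> g = 1\<^sub>m n \<Longrightarrow> \<rho>1 g = 1\<^sub>m r \<and> \<rho>2 g = 1\<^sub>m s"
proof -
  have c: "\<rho> g \<in> carrier_mat n n" if "g \<in> carrier G" for g using \<rho> that by (auto simp: is_rep_iff)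
  obtain W where W: "VectorSpace.subspace class_ring W (module_vec TYPE(complex) n)"
    "\<And>g w. g \<in> carrier G \<Longrightarrow> w \<in> W \<Longrightarrow> \<rho> g *\<^sub>v w \<in> W" "W \<noteq> {0\<^sub>v n}" "W \<noteq> carrier_vec n"
    using \<rho> red by (auto simp: irreducible_rep_def)
  obtain r A B where A: "A \<in> carrier_mat n r" and B: "B \<in> carrier_mat r n" and BA: "B * A = 1\<^sub>m r"
    and W_iff: "\<And>w. w \<in> carrier_vec n \<Longrightarrow> w \<in> W \<longleftrightarrow> A *\<^sub>v (B *\<^sub>v w) = w"
    using subspace_factorization[OF W(1)] by metis
  define P where "P = A * B"
  have P: "P \<in> carrier_mat n n" using A B by (simp add: P_def)
  have PA: "P * A = A" using A B BA by (simp add: P_def assoc_mult_mat_dim)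
  have PP: "P * P = P" using PA A B P by (metis P_def assoc_mult_mat)
  define Q where "Q = 1\<^sub>m n - P"
  have Q: "Q \<in> carrier_mat n n" using P by (simp add: Q_def minus_carrier_mat)
  have PQ: "P + Q = 1\<^sub>m n" using P by (intro eq_matI) (auto simp: Q_def)
  have XQ: "X * Q = X - X * P" if "X \<in> carrier_mat k n" for X k
    using that P by (simp add: Q_def mult_minus_distrib_mat[of _ _ n _ n])
  have QX: "Q * X = X - P * X" if "X \<in> carrier_mat n k" for X k
    using that P by (simp add: Q_def minus_mult_distrib_mat[of _ n n])
  have QP: "Q * P = 0\<^sub>m n n" using QX[OF P] PP P by simp
  have PQ0: "P * Q = 0\<^sub>m n n" using XQ[OF P] PP P by simp
  \<comment> \<open>\<open>W'\<close> is the kernel of the projection \<open>P\<close> onto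
    \<open>W\<close>, a complement that the group may move.\<close>
  define W' where "W' = {w \<in> carrier_vec n. P *\<^sub>v w = 0\<^sub>v n}"
  have "VectorSpace.subspace class_ring W' (module_vec TYPE(complex) n)"
    unfolding subspace_vec_iff W'_def using P
    by (auto simp: mult_add_distrib_mat_vec[of _ n n] mult_mat_vec[of _ n n])
  then obtain s C D where C: "C \<in> carrier_mat n s" and D: "D \<in> carrier_mat s n" and DC: "D * C = 1\<^sub>m s"
    and W'_iff: "\<And>w. w \<in> carrier_vec n \<Longrightarrow> w \<in> W' \<longleftrightarrow> C *\<^sub>v (D *\<^sub>v w) = w"
    using subspace_factorization by metis
  have PC: "P * C = 0\<^sub>m n s"
  proof (rule eq_mat_by_vecI)
    fix v :: "complex vec" assume v: "v \<in> carrier_vec s"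
    have "C *\<^sub>v (D *\<^sub>v (C *\<^sub>v v)) = C *\<^sub>v v"
      using assoc_mult_mat_vec[OF D C v] DC v by simp
    then have "C *\<^sub>v v \<in> W'" using W'_iff C v by simp
    then show "P * C *\<^sub>v v = 0\<^sub>m n s *\<^sub>v v"
      using assoc_mult_mat_vec[OF P C v] v by (simp add: W'_def zero_mat_mult_vec)
  qed (use P C in auto)
  have CDQ: "C * (D * Q) = Q"
  proof (rule eq_mat_by_vecI)
    fix v :: "complex vec" assume v: "v \<in> carrier_vec n"
    have "P *\<^sub>v (Q *\<^sub>v v) = 0\<^sub>v n"
      using assoc_mult_mat_vec[OF P Q v] PQ0 v by (simp add: zero_mat_mult_vec)
    then have "C *\<^sub>v (D *\<^sub>v (Q *\<^sub>v v)) = Q *\<^sub>v v"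
      using W'_iff[of "Q *\<^sub>v v"] Q v by (simp add: W'_def)
    moreover have "C * (D * Q) *\<^sub>v v = C *\<^sub>v (D *\<^sub>v (Q *\<^sub>v v))"
      using assoc_mult_mat_vec[of C n s "D * Q" n v] assoc_mult_mat_vec[OF D Q v] C D Q v by simp
    ultimately show "C * (D * Q) *\<^sub>v v = Q *\<^sub>v v" by simp
  qed (use C D Q in auto)
  \<comment> \<open>\<open>E\<close> gives coordinates along \<open>W'\<close> and vanishes on
    \<open>W\<close>, so it is the coordinate map of the quotient by \<open>W\<close>.\<close>
  define E where "E = D * Q"
  have E: "E \<in> carrier_mat s n" using D Q by (simp add: E_def)
  have CE: "C * E = Q" using CDQ by (simp add: E_def)
  have EC: "E * C = 1\<^sub>m s"
  proof -
    have "E * C = D * (Q * C)" using C D Q by (simp add: E_def assoc_mult_mat_dim)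
    also have "Q * C = C" using QX[OF C] PC C by (intro eq_matI) auto
    finally show ?thesis using DC by simp
  qed
  have EP: "E * P = 0\<^sub>m s n"
    using D Q P QP by (simp add: E_def assoc_mult_mat_dim)
  have P\<rho>A: "P * (\<rho> g * A) = \<rho> g * A" if g: "g \<in> carrier G" for g
  proof (rule eq_mat_by_vecI)
    fix v :: "complex vec" assume v: "v \<in> carrier_vec r"
    have "A *\<^sub>v (B *\<^sub>v (A *\<^sub>v v)) = A *\<^sub>v v"
      using assoc_mult_mat_vec[OF B A v] BA v by simp
    then have "A *\<^sub>v v \<in> W" using W_iff A v by simp
    then have w: "\<rho> g *\<^sub>v (A *\<^sub>v v) \<in> W" using W(2) g by blast
    have eq: "\<rho> g * A *\<^sub>v v = \<rho> g *\<^sub>v (A *\<^sub>v v)" using assoc_mult_mat_vec[OF c[OF g] A v] .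
    have "P *\<^sub>v (\<rho> g *\<^sub>v (A *\<^sub>v v)) = \<rho> g *\<^sub>v (A *\<^sub>v v)"
      using W_iff[of "\<rho> g *\<^sub>v (A *\<^sub>v v)"] w c[OF g] A B v
      by (simp add: P_def assoc_mult_mat_vec[OF A B])
    moreover have "P * (\<rho> g * A) *\<^sub>v v = P *\<^sub>v (\<rho> g * A *\<^sub>v v)"
      using assoc_mult_mat_vec[of P n n "\<rho> g * A" r v] P A c[OF g] v by simp
    ultimately show "P * (\<rho> g * A) *\<^sub>v v = \<rho> g * A *\<^sub>v v" using eq by simp
  qed (use P A c[OF g] in auto)
  \<comment> \<open>\<open>\<rho> g\<close> maps the image of \<open>P\<close> into
    \<open>W\<close>, where \<open>E\<close> vanishes. This makes the action on the quotient
    multiplicative.\<close>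
  have E\<rho>Q: "E * (\<rho> g * Q) = E * \<rho> g" if g: "g \<in> carrier G" for g
  proof -
    have "E * (\<rho> g * P) = E * (\<rho> g * A) * B"
      using A B c[OF g] E by (simp add: P_def assoc_mult_mat_dim)
    also have "\<dots> = (E * P) * (\<rho> g * A) * B"
      using P\<rho>A[OF g] A B P c[OF g] E by (simp add: assoc_mult_mat_dim)
    also have "\<dots> = 0\<^sub>m s n" using EP A B c[OF g] by simp
    finally have "E * \<rho> g * P = 0\<^sub>m s n" using E P c[OF g] by (simp add: assoc_mult_mat_dim)
    moreover have "E * (\<rho> g * Q) = E * \<rho> g - E * \<rho> g * P"
      using XQ[of "E * \<rho> g" s] E c[OF g] Q by (simp add: assoc_mult_mat_dim)
    ultimately show ?thesis using E c[OF g] by (intro eq_matI) auto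
  qed
  have mult: "\<rho> (g \<otimes> h) = \<rho> g * \<rho> h" if "g \<in> carrier G" "h \<in> carrier G" for g h
    using \<rho> that by (simp add: is_rep_iff)
  define \<rho>1 where "\<rho>1 g = B * (\<rho> g * A)" for g
  define \<rho>2 where "\<rho>2 g = E * (\<rho> g * C)" for g
  have m1: "\<rho>1 (g \<otimes> h) = \<rho>1 g * \<rho>1 h" if "g \<in> carrier G" "h \<in> carrier G" for g h
  proof -
    have "\<rho>1 g * \<rho>1 h = B * (\<rho> g * (P * (\<rho> h * A)))"
      using A B c[OF that(1)] c[OF that(2)] by (simp add: \<rho>1_def P_def assoc_mult_mat_dim)
    also have "\<dots> = \<rho>1 (g \<otimes> h)"
      using P\<rho>A[OF that(2)] mult[OF that] A B c[OF that(1)] c[OF that(2)]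
      by (simp add: \<rho>1_def assoc_mult_mat_dim)
    finally show ?thesis by simp
  qed
  have m2: "\<rho>2 (g \<otimes> h) = \<rho>2 g * \<rho>2 h" if "g \<in> carrier G" "h \<in> carrier G" for g h
  proof -
    have "\<rho>2 g * \<rho>2 h = E * (\<rho> g * (C * E)) * (\<rho> h * C)"
      using C E c[OF that(1)] c[OF that(2)] by (simp add: \<rho>2_def assoc_mult_mat_dim)
    also have "\<dots> = E * \<rho> g * (\<rho> h * C)" using E\<rho>Q[OF that(1)] by (simp add: CE)
    also have "\<dots> = \<rho>2 (g \<otimes> h)"
      using mult[OF that] C E c[OF that(1)] c[OF that(2)]
      by (simp add: \<rho>2_def assoc_mult_mat_dim)
    finally show ?thesis by simp
  qed
  have tr: "mat_trace (\<rho> g) = mat_trace (\<rho>1 g) + mat_trace (\<rho>2 g)" if g: "g \<in> carrier G" for g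
  proof -
    have "mat_trace (\<rho>1 g) = mat_trace (\<rho> g * A * B)"
      unfolding \<rho>1_def using A B c[OF g] by (intro mat_trace_comm[of _ r n]) auto
    moreover have "mat_trace (\<rho>2 g) = mat_trace (\<rho> g * C * E)"
      unfolding \<rho>2_def using C E c[OF g] by (intro mat_trace_comm[of _ s n]) auto
    moreover have "\<rho> g = \<rho> g * A * B + \<rho> g * C * E"
    proof -
      have "\<rho> g = \<rho> g * (P + Q)" using c[OF g] by (simp add: PQ)
      also have "\<dots> = \<rho> g * P + \<rho> g * Q" using c[OF g] P Q by (simp add: mult_add_distrib_mat[of _ n n _ n])
      also have "\<dots> = \<rho> g * A * B + \<rho> g * C * E"
        using A B C E c[OF g] by (simp add: P_def CE[symmetric] assoc_mult_mat_dim)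
      finally show ?thesis .
    qed
    moreover have "mat_trace (\<rho> g * A * B + \<rho> g * C * E) = mat_trace (\<rho> g * A * B) + mat_trace (\<rho> g * C * E)"
      using A B C E c[OF g] by (intro mat_trace_add[of _ n]) (auto intro!: mult_carrier_mat)
    ultimately show ?thesis by simp
  qed
  have id: "\<rho>1 g = 1\<^sub>m r" "\<rho>2 g = 1\<^sub>m s" if "\<rho> g = 1\<^sub>m n" for g
    using that A C BA EC by (simp_all add: \<rho>1_def \<rho>2_def)
  have one: "\<rho> \<one> = 1\<^sub>m n" using \<rho> by (simp add: is_rep_iff)
  \<comment> \<open>The sizes add up because the traces do so at the identity. Hence both parts are
    smaller once neither is zero.\<close>
  have "complex_of_nat n = of_nat r + of_nat s" using tr[of \<one>] one id[OF one] by simp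
  then have n: "n = r + s" by (metis of_nat_add of_nat_eq_iff)
  have r: "r > 0"
  proof (rule ccontr)
    assume "\<not> r > 0"
    then have "w = 0\<^sub>v n" if "w \<in> W" for w
      using that W_iff[of w] W(1) A B mult_mat_vec_zero_cols[of A n "B *\<^sub>v w"]
      by (auto simp: subspace_vec_iff)
    then show False using W(1,3) by (auto simp: subspace_vec_iff)
  qed
  have s: "s > 0"
  proof (rule ccontr)
    assume "\<not> s > 0"
    then have "C * E = 0\<^sub>m n n" using C E by (intro eq_matI) (auto simp: scalar_prod_def)
    then have "P = 1\<^sub>m n" using PQ CE P by simp
    then have "w \<in> W" if "w \<in> carrier_vec n" for w
      using W_iff[OF that] that assoc_mult_mat_vec[OF A B that] by (simp add: P_def)
    then show False using W(1,4) by (auto simp: subspace_vec_iff)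
  qed
  show ?thesis
  proof
    show "is_rep G r \<rho>1" unfolding is_rep_iff using r m1 id(1)[OF one] A B c by (auto simp: \<rho>1_def)
    show "is_rep G s \<rho>2" unfolding is_rep_iff using s m2 id(2)[OF one] C E c by (auto simp: \<rho>2_def)
    show "r < n" "s < n" using n r s by auto
  qed (use tr id in auto)
qed

text \<open>A list is used because constituents may repeat. The clause on
  \<open>\<rho> x = 1\<^sub>m n\<close> records that the kernel of a representation lies in the
  kernel of each constituent; \<open>irr_nontrivial_below_index\<close> depends on it.\<close>

lemma (in group) character_decomposition:
  assumes "is_rep G n \<rho>"
  shows "\<exists>\<psi>s. (\<forall>\<psi>\<in>set \<psi>s. \<psi> \<in> Irr G \<and> (\<forall>x\<in>carrier G. \<rho> x = 1\<^sub>m n \<longrightarrow> \<psi> x = \<psi> \<one>)) \<and>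
    rep_character G \<rho> = (\<lambda>g. \<Sum>\<psi>\<leftarrow>\<psi>s. \<psi> g)"
  using assms
proof (induction n arbitrary: \<rho> rule: less_induct)
  case (less n)
  show ?case
  proof (cases "irreducible_rep G n \<rho>")
    case True
    then have "rep_character G \<rho> \<in> Irr G" by (auto simp: Irr_def)
    moreover have "rep_character G \<rho> x = rep_character G \<rho> \<one>" if "x \<in> carrier G" "\<rho> x = 1\<^sub>m n" for x
      using that less.prems by (simp add: rep_character_def is_rep_iff)
    ultimately show ?thesis by (intro exI[of _ "[rep_character G \<rho>]"]) simp
  next
    case False
    obtain r s \<rho>1 \<rho>2 where *: "is_rep G r \<rho>1" "is_rep G s \<rho>2" "r < n" "s < n"
      "\<And>g. g \<in> carrier G \<Longrightarrow> mat_trace (\<rho> g) = mat_trace (\<rho>1 g) + mat_trace (\<rho>2 g)"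
      "\<And>g. g \<in> carrier G \<Longrightarrow> \<rho> g = 1\<^sub>m n \<Longrightarrow> \<rho>1 g = 1\<^sub>m r \<and> \<rho>2 g = 1\<^sub>m s"
      by (rule reducible_rep_split[OF less.prems False]) (rule that)
    obtain \<psi>s1 where 1: "\<And>\<psi>. \<psi> \<in> set \<psi>s1 \<Longrightarrow> \<psi> \<in> Irr G \<and> (\<forall>x\<in>carrier G. \<rho>1 x = 1\<^sub>m r \<longrightarrow> \<psi> x = \<psi> \<one>)"
      "rep_character G \<rho>1 = (\<lambda>g. \<Sum>\<psi>\<leftarrow>\<psi>s1. \<psi> g)"
      using less.IH[OF *(3,1)] by blast
    obtain \<psi>s2 where 2: "\<And>\<psi>. \<psi> \<in> set \<psi>s2 \<Longrightarrow> \<psi> \<in> Irr G \<and> (\<forall>x\<in>carrier G. \<rho>2 x = 1\<^sub>m s \<longrightarrow> \<psi> x = \<psi> \<one>)"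
      "rep_character G \<rho>2 = (\<lambda>g. \<Sum>\<psi>\<leftarrow>\<psi>s2. \<psi> g)"
      using less.IH[OF *(4,2)] by blast
    have "rep_character G \<rho> g = (\<Sum>\<psi>\<leftarrow>\<psi>s1 @ \<psi>s2. \<psi> g)" for g
      using fun_cong[OF 1(2), of g] fun_cong[OF 2(2), of g] *(5)[of g]
      by (auto simp: rep_character_def split: if_splits)
    moreover have "\<psi> \<in> Irr G \<and> (\<forall>x\<in>carrier G. \<rho> x = 1\<^sub>m n \<longrightarrow> \<psi> x = \<psi> \<one>)"
      if "\<psi> \<in> set (\<psi>s1 @ \<psi>s2)" for \<psi>
      using that 1(1)[of \<psi>] 2(1)[of \<psi>] *(6) by auto
    ultimately show ?thesis by (intro exI[of _ "\<psi>s1 @ \<psi>s2"] conjI ballI ext) auto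
  qed
qed

section \<open>Class functions and induction\<close>

lemma (in group) sum_right_translate:
  assumes "h \<in> carrier G"
  shows "(\<Sum>g\<in>carrier G. f (g \<otimes> h)) = (\<Sum>g\<in>carrier G. f g)"
proof (rule sum.reindex_bij_witness[where i = "\<lambda>g. g \<otimes> inv h" and j = "\<lambda>g. g \<otimes> h"])
  show "g \<otimes> h \<otimes> inv h = g" if "g \<in> carrier G" for g using assms that by (simp add: m_assoc)
  show "g \<otimes> inv h \<otimes> h = g" if "g \<in> carrier G" for g using assms that by (simp add: m_assoc)
qed (use assms in auto)

lemma (in group) sum_inverse:
  "(\<Sum>g\<in>carrier G. f (inv g)) = (\<Sum>g\<in>carrier G. f g)"
  by (rule sum.reindex_bij_witness[where i = "\<lambda>g. inv g" and j = "\<lambda>g. inv g"]) auto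

lemma (in group) conj_inv_cancel:
  assumes "x \<in> carrier G" "g \<in> carrier G"
  shows "inv x \<otimes> (x \<otimes> g \<otimes> inv x) \<otimes> x = g"
proof -
  have "inv x \<otimes> (x \<otimes> g \<otimes> inv x) \<otimes> x = (inv x \<otimes> x) \<otimes> g \<otimes> (inv x \<otimes> x)"
    using assms by (simp only: m_assoc m_closed inv_closed)
  then show ?thesis using assms by simp
qed

lemma (in group) conj_conj:
  assumes "x \<in> carrier G" "y \<in> carrier G" "g \<in> carrier G"
  shows "x \<otimes> (y \<otimes> g \<otimes> inv y) \<otimes> inv x = (x \<otimes> y) \<otimes> g \<otimes> inv (x \<otimes> y)"
  using assms by (simp add: m_assoc inv_mult_group)

lemma (in group) inv_conj:
  assumes "x \<in> carrier G" "g \<in> carrier G"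
  shows "inv (x \<otimes> g \<otimes> inv x) = x \<otimes> inv g \<otimes> inv x"
  using assms by (simp add: m_assoc inv_mult_group)

lemma (in group) sum_conjugate:
  assumes x: "x \<in> carrier G"
  shows "(\<Sum>g\<in>carrier G. f (x \<otimes> g \<otimes> inv x)) = (\<Sum>g\<in>carrier G. f g)"
  using sum_left_translate[OF x, of "\<lambda>g. f (g \<otimes> inv x)"] sum_right_translate[of "inv x" f] x by simp

lemma (in group) card_carrier_pos:
  "finite (carrier G) \<Longrightarrow> card (carrier G) > 0"
  using one_closed card_gt_0_iff by blast

lemma (in group) card_subgroup_pos:
  assumes "finite (carrier G)" "subgroup H G"
  shows "card H > 0"
  using assms subgroup.one_closed[OF assms(2)] finite_subset[OF subgroup.subset[OF assms(2)]]
  by (auto simp: card_gt_0_iff)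

lemma of_nat_sum_list_map: "of_nat (\<Sum>x\<leftarrow>xs. f x) = (\<Sum>x\<leftarrow>xs. of_nat (f x))"
  by (induction xs) simp_all

definition class_function :: "('a, 'b) monoid_scheme \<Rightarrow> ('a \<Rightarrow> complex) \<Rightarrow> bool" where
  "class_function G f \<longleftrightarrow> (\<forall>x\<in>carrier G. \<forall>g\<in>carrier G. f (x \<otimes>\<^bsub>G\<^esub> g \<otimes>\<^bsub>G\<^esub> inv\<^bsub>G\<^esub> x) = f g)"

lemma (in group) class_function_rep_character:
  assumes "is_rep G n \<rho>"
  shows "class_function G (rep_character G \<rho>)"
  unfolding class_function_def
proof (intro ballI)
  fix x g assume xg: "x \<in> carrier G" "g \<in> carrier G"
  have c: "\<rho> x \<in> carrier_mat n n" "\<rho> g \<in> carrier_mat n n" "\<rho> (inv x) \<in> carrier_mat n n"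
    using assms xg by (auto simp: is_rep_iff)
  have "\<rho> (inv x) * \<rho> x = 1\<^sub>m n" using assms xg by (metis inv_closed is_rep_iff l_inv)
  moreover have "mat_trace (\<rho> x * \<rho> g * \<rho> (inv x)) = mat_trace (\<rho> (inv x) * (\<rho> x * \<rho> g))"
    using c by (intro mat_trace_comm[of _ n n]) auto
  moreover have "\<rho> (inv x) * (\<rho> x * \<rho> g) = (\<rho> (inv x) * \<rho> x) * \<rho> g"
    using c by (simp add: assoc_mult_mat_dim)
  moreover have "\<rho> (x \<otimes> g \<otimes> inv x) = \<rho> x * \<rho> g * \<rho> (inv x)"
    using assms xg by (simp add: is_rep_iff)
  ultimately show "rep_character G \<rho> (x \<otimes> g \<otimes> inv x) = rep_character G \<rho> g"
    using xg c by (simp add: rep_character_def)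
qed

lemma is_character_if_irr: "\<chi> \<in> Irr G \<Longrightarrow> is_character G \<chi>"
  by (auto simp: Irr_def is_character_def irreducible_rep_def)

lemma (in group) class_function_character: "is_character G \<chi> \<Longrightarrow> class_function G \<chi>"
  using class_function_rep_character by (auto simp: is_character_def)

lemma character_outside: "is_character G \<chi> \<Longrightarrow> g \<notin> carrier G \<Longrightarrow> \<chi> g = 0"
  by (auto simp: is_character_def rep_character_def)

lemma (in group) class_function_induced:
  "class_function G (induced_character G H \<phi>)"
  unfolding class_function_def
proof (intro ballI)
  fix x g assume xg: "x \<in> carrier G" "g \<in> carrier G"
  have "(\<Sum>y\<in>carrier G. \<phi> (y \<otimes> (x \<otimes> g \<otimes> inv x) \<otimes> inv y)) = (\<Sum>y\<in>carrier G. \<phi> ((y \<otimes> x) \<otimes> g \<otimes> inv (y \<otimes> x)))"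
    using xg by (intro sum.cong) (simp_all add: conj_conj)
  also have "\<dots> = (\<Sum>y\<in>carrier G. \<phi> (y \<otimes> g \<otimes> inv y))"
    using sum_right_translate[OF xg(1), of "\<lambda>y. \<phi> (y \<otimes> g \<otimes> inv y)"] .
  finally show "induced_character G H \<phi> (x \<otimes> g \<otimes> inv x) = induced_character G H \<phi> g"
    using xg by (simp add: induced_character_def)
qed

section \<open>Frobenius reciprocity and transitivity of induction\<close>

lemma (in group) cinner_commute: "cinner G \<alpha> \<beta> = cinner G \<beta> \<alpha>"
  using sum_inverse[of "\<lambda>g. \<alpha> g * \<beta> (inv g)"] by (simp add: cinner_def mult.commute)

lemma (in group) cinner_subgroup:
  assumes "subgroup H G"
  shows "cinner (G\<lparr>carrier := H\<rparr>) \<alpha> \<beta> = (\<Sum>h\<in>H. \<alpha> h * \<beta> (inv h)) / of_nat (card H)"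
  using m_inv_consistent[OF assms] by (simp add: cinner_def)

text \<open>For a fixed \<open>x\<close> in the sum that defines the induced character, conjugation
  by \<open>x\<close> turns the sum over \<open>G\<close> into one over \<open>H\<close>, so every
  \<open>x\<close> contributes the same. There is no need to cut \<open>\<beta>\<close> down to
  \<open>H\<close>, since the inner product over \<open>H\<close> reads only values there.\<close>

lemma (in group) frobenius_reciprocity:
  assumes fin: "finite (carrier G)" and H: "subgroup H G" and out: "\<And>g. g \<notin> H \<Longrightarrow> \<phi> g = 0"
    and \<beta>: "class_function G \<beta>"
  shows "cinner G (induced_character G H \<phi>) \<beta> = cinner (G\<lparr>carrier := H\<rparr>) \<phi> \<beta>"
proof -
  have HG: "H \<subseteq> carrier G" using H by (rule subgroup.subset)
  have "(\<Sum>g\<in>carrier G. (\<Sum>x\<in>carrier G. \<phi> (x \<otimes> g \<otimes> inv x)) * \<beta> (inv g)) =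
    (\<Sum>x\<in>carrier G. \<Sum>g\<in>carrier G. \<phi> (x \<otimes> g \<otimes> inv x) * \<beta> (inv g))"
    by (subst sum.swap) (simp add: sum_distrib_right)
  also have "\<dots> = (\<Sum>x\<in>carrier G. \<Sum>g\<in>H. \<phi> g * \<beta> (inv g))"
  proof (rule sum.cong[OF refl])
    fix x assume x: "x \<in> carrier G"
    have "(\<Sum>g\<in>carrier G. \<phi> (x \<otimes> g \<otimes> inv x) * \<beta> (inv g)) =
      (\<Sum>g\<in>carrier G. \<phi> (x \<otimes> g \<otimes> inv x) * \<beta> (inv (x \<otimes> g \<otimes> inv x)))"
      using \<beta> x by (intro sum.cong refl) (auto simp: inv_conj class_function_def)
    also have "\<dots> = (\<Sum>g\<in>carrier G. \<phi> g * \<beta> (inv g))"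
      using sum_conjugate[OF x, of "\<lambda>g. \<phi> g * \<beta> (inv g)"] .
    also have "\<dots> = (\<Sum>g\<in>H. \<phi> g * \<beta> (inv g))"
      using fin HG out by (intro sum.mono_neutral_right) auto
    finally show "(\<Sum>g\<in>carrier G. \<phi> (x \<otimes> g \<otimes> inv x) * \<beta> (inv g)) = (\<Sum>g\<in>H. \<phi> g * \<beta> (inv g))" .
  qed
  finally have *: "(\<Sum>g\<in>carrier G. (\<Sum>x\<in>carrier G. \<phi> (x \<otimes> g \<otimes> inv x)) * \<beta> (inv g)) =
    of_nat (card (carrier G)) * (\<Sum>g\<in>H. \<phi> g * \<beta> (inv g))" by simp
  have "cinner G (induced_character G H \<phi>) \<beta> =
    (\<Sum>g\<in>carrier G. (\<Sum>x\<in>carrier G. \<phi> (x \<otimes> g \<otimes> inv x)) * \<beta> (inv g)) / (of_nat (card H) * of_nat (card (carrier G)))"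
    by (simp add: cinner_def induced_character_def sum_divide_distrib[symmetric])
  then show ?thesis using card_carrier_pos[OF fin] by (simp add: * cinner_subgroup[OF H])
qed

lemma (in group) induced_character_trans:
  assumes fin: "finite (carrier G)" and K: "subgroup K G" and H: "subgroup H (G\<lparr>carrier := K\<rparr>)"
    and out: "\<And>g. g \<notin> H \<Longrightarrow> \<phi> g = 0"
  shows "induced_character G K (induced_character (G\<lparr>carrier := K\<rparr>) H \<phi>) = induced_character G H \<phi>"
proof
  fix g
  have HK: "H \<subseteq> K" using subgroup.subset[OF H] by simp
  have KG: "K \<subseteq> carrier G" using K by (rule subgroup.subset)
  have cK: "card K > 0" using card_subgroup_pos[OF fin K] .
  show "induced_character G K (induced_character (G\<lparr>carrier := K\<rparr>) H \<phi>) g = induced_character G H \<phi> g"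
  proof (cases "g \<in> carrier G")
    case g: True
    have "induced_character (G\<lparr>carrier := K\<rparr>) H \<phi> (x \<otimes> g \<otimes> inv x) =
        (\<Sum>k\<in>K. \<phi> ((k \<otimes> x) \<otimes> g \<otimes> inv (k \<otimes> x))) / of_nat (card H)" if x: "x \<in> carrier G" for x
    proof (cases "x \<otimes> g \<otimes> inv x \<in> K")
      case True
      then show ?thesis using x g KG m_inv_consistent[OF K]
        by (auto simp: induced_character_def conj_conj intro!: sum.cong arg_cong[where f = "\<lambda>s. s / _"])
    next
      case False
      \<comment> \<open>The inner induced character is zero outside \<open>K\<close>. The sum over
        \<open>K\<close> must vanish as well: conjugation by \<open>k\<close> keeps an element
        outside \<open>K\<close>, hence outside \<open>H\<close>.\<close>
      have "\<phi> ((k \<otimes> x) \<otimes> g \<otimes> inv (k \<otimes> x)) = 0" if k: "k \<in> K" for k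
      proof (rule out, rule notI)
        assume "(k \<otimes> x) \<otimes> g \<otimes> inv (k \<otimes> x) \<in> H"
        then have "k \<otimes> (x \<otimes> g \<otimes> inv x) \<otimes> inv k \<in> K"
          using HK k KG x g conj_conj[of k x g] by (metis subsetD)
        then have "inv k \<otimes> (k \<otimes> (x \<otimes> g \<otimes> inv x) \<otimes> inv k) \<otimes> k \<in> K"
          using k K by (meson subgroup.m_closed subgroup.m_inv_closed)
        then show False using False k KG x g by (auto simp: conj_inv_cancel)
      qed
      then show ?thesis using False by (simp add: induced_character_def)
    qed
    then have "(\<Sum>x\<in>carrier G. induced_character (G\<lparr>carrier := K\<rparr>) H \<phi> (x \<otimes> g \<otimes> inv x)) =
      (\<Sum>x\<in>carrier G. \<Sum>k\<in>K. \<phi> ((k \<otimes> x) \<otimes> g \<otimes> inv (k \<otimes> x))) / of_nat (card H)"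
      by (simp add: sum_divide_distrib)
    also have "(\<Sum>x\<in>carrier G. \<Sum>k\<in>K. \<phi> ((k \<otimes> x) \<otimes> g \<otimes> inv (k \<otimes> x))) =
      (\<Sum>k\<in>K. \<Sum>x\<in>carrier G. \<phi> (x \<otimes> g \<otimes> inv x))"
    proof (subst sum.swap, rule sum.cong[OF refl])
      fix k assume "k \<in> K"
      then show "(\<Sum>x\<in>carrier G. \<phi> ((k \<otimes> x) \<otimes> g \<otimes> inv (k \<otimes> x))) = (\<Sum>x\<in>carrier G. \<phi> (x \<otimes> g \<otimes> inv x))"
        using KG by (intro sum_left_translate[where f = "\<lambda>x. \<phi> (x \<otimes> g \<otimes> inv x)"]) auto
    qed
    finally show ?thesis using g cK by (simp add: induced_character_def)
  qed (simp add: induced_character_def)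
qed

section \<open>Restriction, multiplicities and norms of characters\<close>

lemma (in group) is_rep_subgroup:
  assumes "is_rep G n \<rho>" "subgroup H G"
  shows "is_rep (G\<lparr>carrier := H\<rparr>) n \<rho>"
  using assms subgroup.subset[OF assms(2)]
  by (auto simp: is_rep_iff group.is_rep_iff[OF subgroup_imp_group[OF assms(2)]])

definition restrict_to :: "'a set \<Rightarrow> ('a \<Rightarrow> complex) \<Rightarrow> 'a \<Rightarrow> complex" where
  "restrict_to H \<chi> = (\<lambda>g. if g \<in> H then \<chi> g else 0)"

lemma (in group) is_character_restrict:
  assumes "is_character G \<chi>" "subgroup H G"
  shows "is_character (G\<lparr>carrier := H\<rparr>) (restrict_to H \<chi>)"
proof -
  obtain n \<rho> where \<rho>: "is_rep G n \<rho>" "\<chi> = rep_character G \<rho>" using assms by (auto simp: is_character_def)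
  have "restrict_to H \<chi> = rep_character (G\<lparr>carrier := H\<rparr>) \<rho>"
    using subgroup.subset[OF assms(2)] \<rho> by (intro ext) (auto simp: restrict_to_def rep_character_def)
  then show ?thesis using is_rep_subgroup[OF \<rho>(1) assms(2)] by (auto simp: is_character_def)
qed

lemma (in group) character_decomposition_list:
  assumes "is_character G \<chi>"
  obtains \<psi>s where "set \<psi>s \<subseteq> Irr G" "\<chi> = (\<lambda>g. \<Sum>\<psi>\<leftarrow>\<psi>s. \<psi> g)"
  using assms character_decomposition unfolding is_character_def by (metis subsetI)

lemma cinner_sum_list_left:
  "cinner G (\<lambda>g. \<Sum>\<psi>\<leftarrow>\<psi>s. \<psi> g) \<beta> = (\<Sum>\<psi>\<leftarrow>\<psi>s. cinner G \<psi> \<beta>)"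
proof (induction \<psi>s)
  case (Cons \<psi> \<psi>s)
  have "cinner G (\<lambda>g. \<Sum>\<psi>\<leftarrow>\<psi>#\<psi>s. \<psi> g) \<beta> = cinner G \<psi> \<beta> + cinner G (\<lambda>g. \<Sum>\<psi>\<leftarrow>\<psi>s. \<psi> g) \<beta>"
    by (simp add: cinner_def algebra_simps sum.distrib add_divide_distrib)
  then show ?case using Cons by simp
qed (simp add: cinner_def)

lemma (in group) cinner_irr_list:
  assumes fin: "finite (carrier G)" and \<psi>s: "set \<psi>s \<subseteq> Irr G" and \<theta>: "\<theta> \<in> Irr G"
  shows "cinner G (\<lambda>g. \<Sum>\<psi>\<leftarrow>\<psi>s. \<psi> g) \<theta> = of_nat (count_list \<psi>s \<theta>)"
  unfolding cinner_sum_list_left using \<psi>s by (induction \<psi>s) (simp_all add: cinner_irr[OF fin _ \<theta>])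

lemma (in group) cinner_characters_nat:
  assumes fin: "finite (carrier G)" and "is_character G \<alpha>" "is_character G \<beta>"
  obtains k :: nat where "cinner G \<alpha> \<beta> = of_nat k"
proof -
  obtain as where as: "set as \<subseteq> Irr G" "\<alpha> = (\<lambda>g. \<Sum>\<psi>\<leftarrow>as. \<psi> g)" using character_decomposition_list assms by blast
  obtain bs where bs: "set bs \<subseteq> Irr G" "\<beta> = (\<lambda>g. \<Sum>\<psi>\<leftarrow>bs. \<psi> g)" using character_decomposition_list assms by blast
  have "cinner G \<psi> \<beta> = of_nat (count_list bs \<psi>)" if "\<psi> \<in> Irr G" for \<psi>
    using cinner_irr_list[OF fin bs(1) that] bs(2) cinner_commute by metis
  then have "cinner G \<alpha> \<beta> = (\<Sum>\<psi>\<leftarrow>as. of_nat (count_list bs \<psi>))"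
    unfolding as(2) cinner_sum_list_left using as(1)
    by (intro arg_cong[where f = sum_list] map_cong) auto
  also have "\<dots> = of_nat (\<Sum>\<psi>\<leftarrow>as. count_list bs \<psi>)"
    by (simp add: of_nat_sum_list_map)
  finally show ?thesis using that by blast
qed

text \<open>The norm is the sum of the squared multiplicities, which over a list of constituents is
  the sum of the counts of its entries. It is at least the length of the list, so norm 1 leaves a
  single constituent.\<close>

lemma (in group) cinner_character_self:
  assumes fin: "finite (carrier G)" and \<chi>: "is_character G \<chi>"
  obtains k :: nat where "k > 0" "cinner G \<chi> \<chi> = of_nat k" "k = 1 \<Longrightarrow> \<chi> \<in> Irr G"
proof -
  obtain as where as: "set as \<subseteq> Irr G" "\<chi> = (\<lambda>g. \<Sum>\<psi>\<leftarrow>as. \<psi> g)" using character_decomposition_list \<chi> by blast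
  have "cinner G \<psi> \<chi> = of_nat (count_list as \<psi>)" if "\<psi> \<in> Irr G" for \<psi>
    using cinner_irr_list[OF fin as(1) that] as(2) cinner_commute by metis
  then have "cinner G \<chi> \<chi> = (\<Sum>\<psi>\<leftarrow>as. of_nat (count_list as \<psi>))"
    by (subst as(2), unfold cinner_sum_list_left) (use as(1) in \<open>intro arg_cong[where f = sum_list] map_cong, auto\<close>)
  also have "\<dots> = of_nat (\<Sum>\<psi>\<leftarrow>as. count_list as \<psi>)"
    by (simp add: of_nat_sum_list_map)
  finally have self: "cinner G \<chi> \<chi> = of_nat (\<Sum>\<psi>\<leftarrow>as. count_list as \<psi>)" .
  have "(\<Sum>\<psi>\<leftarrow>as. 1) \<le> (\<Sum>\<psi>\<leftarrow>as. count_list as \<psi>)"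
    by (rule sum_list_mono) (simp add: Suc_le_eq count_list_0_iff flip: neq0_conv)
  then have le: "length as \<le> (\<Sum>\<psi>\<leftarrow>as. count_list as \<psi>)" by (simp add: sum_list_triv)
  have ne: "as \<noteq> []"
  proof
    assume "as = []"
    then have "\<chi> \<one> = 0" using as(2) by simp
    then show False using \<chi> character_one by (auto simp: is_character_def is_rep_def)
  qed
  show ?thesis
  proof
    show "(\<Sum>\<psi>\<leftarrow>as. count_list as \<psi>) > 0" using le ne by (cases as) auto
    show "\<chi> \<in> Irr G" if "(\<Sum>\<psi>\<leftarrow>as. count_list as \<psi>) = 1"
    proof -
      have "length as = 1" using le ne unfolding that by (cases as) auto
      then obtain \<psi> where "as = [\<psi>]" by (auto simp: length_Suc_conv)
      then show ?thesis using as by simp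
    qed
  qed (rule self)
qed

lemma (in group) irr_if_cinner_one:
  assumes fin: "finite (carrier G)" and \<chi>: "is_character G \<chi>" and one: "cinner G \<chi> \<chi> = 1"
  shows "\<chi> \<in> Irr G"
  using cinner_character_self[OF fin \<chi>] one by (metis of_nat_1 of_nat_eq_iff)

section \<open>Permutation characters and linear characters\<close>

lemma (in group) conj_mem_iff_coset_fixed:
  assumes U: "subgroup U G" and x: "x \<in> carrier G" and g: "g \<in> carrier G"
  shows "x \<otimes> g \<otimes> inv x \<in> U \<longleftrightarrow> (U #> x) #> g = U #> x"
proof -
  have UG: "U \<subseteq> carrier G" using U by (rule subgroup.subset)
  have "(U #> x) #> g = U #> x \<longleftrightarrow> U #> (x \<otimes> g \<otimes> inv x) = U"
    using coset_mult_inv1[of U "x \<otimes> g" x] coset_mult_inv2[of U "x \<otimes> g" x] UG x g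
    by (auto simp: coset_mult_assoc)
  also have "\<dots> \<longleftrightarrow> x \<otimes> g \<otimes> inv x \<in> U"
    using coset_join1[of U "x \<otimes> g \<otimes> inv x"] coset_join2[of "x \<otimes> g \<otimes> inv x" U] U UG x g by auto
  finally show ?thesis by simp
qed

lemma (in group) sum_over_rcosets:
  assumes fin: "finite (carrier G)" and U: "subgroup U G"
    and f: "\<And>x. x \<in> carrier G \<Longrightarrow> f x = F (U #> x)"
  shows "(\<Sum>x\<in>carrier G. f x) = of_nat (card U) * (\<Sum>C\<in>rcosets U. F C :: complex)"
proof -
  have UG: "U \<subseteq> carrier G" using U by (rule subgroup.subset)
  have C: "finite C" "C \<subseteq> carrier G" if "C \<in> rcosets U" for C
    using that UG fin rcosets_part_G[OF U] by (auto intro: finite_subset)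
  have "(\<Sum>x\<in>carrier G. f x) = (\<Sum>x\<in>\<Union>(rcosets U). f x)" using rcosets_part_G[OF U] by simp
  also have "\<dots> = (\<Sum>C\<in>rcosets U. \<Sum>x\<in>C. f x)"
    using C rcos_disjoint[OF U] by (subst sum.Union_disjoint) (auto simp: pairwise_def disjnt_def)
  also have "\<dots> = (\<Sum>C\<in>rcosets U. of_nat (card U) * F C)"
  proof (rule sum.cong[OF refl])
    fix C assume CR: "C \<in> rcosets U"
    have "f x = F C" if "x \<in> C" for x
    proof -
      obtain y where y: "y \<in> carrier G" "C = U #> y" using CR by (auto simp: RCOSETS_def)
      then have "U #> x = C" using repr_independence[of x U y] that U by simp
      then show ?thesis using f[of x] C[OF CR] that by auto
    qed
    then show "(\<Sum>x\<in>C. f x) = of_nat (card U) * F C"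
      using card_rcosets_equal[OF CR UG] by simp
  qed
  finally show ?thesis by (simp add: sum_distrib_left)
qed

text \<open>Row \<open>i\<close> of the matrix marks the coset to which right multiplication by
  \<open>g\<close> carries coset \<open>i\<close>; with this convention the matrices multiply in the
  right order. The trace counts fixed cosets. The last clause says that the core of \<open>U\<close>
  lies in the kernel.\<close>

lemma (in group) permutation_rep:
  assumes fin: "finite (carrier G)" and U: "subgroup U G"
  obtains n \<rho> where "is_rep G n \<rho>"
    "rep_character G \<rho> = induced_character G U (\<lambda>g. if g \<in> U then 1 else 0)"
    "\<forall>g\<in>carrier G. (\<forall>x\<in>carrier G. x \<otimes> g \<otimes> inv x \<in> U) \<longrightarrow> \<rho> g = 1\<^sub>m n"
proof -
  have UG: "U \<subseteq> carrier G" using U by (rule subgroup.subset)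
  have finR: "finite (rcosets U)"
    using fin rcosets_part_G[OF U] by (metis finite_UnionD)
  define n where "n = card (rcosets U)"
  obtain e where e: "bij_betw e {..<n} (rcosets U)"
    using ex_bij_betw_nat_finite[OF finR] by (auto simp: n_def atLeast0LessThan)
  have inj: "e i = e j \<longleftrightarrow> i = j" if "i < n" "j < n" for i j
    using e that by (auto simp: bij_betw_def inj_on_def)
  have eR: "e i \<in> rcosets U" if "i < n" for i using e that by (auto simp: bij_betw_def)
  have eG: "e i \<subseteq> carrier G" if "i < n" for i using eR[OF that] rcosets_part_G[OF U] by blast
  have act: "C #> g \<in> rcosets U" if C: "C \<in> rcosets U" and g: "g \<in> carrier G" for C g
  proof -
    obtain y where "y \<in> carrier G" "C = U #> y" using C by (auto simp: RCOSETS_def)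
    then show ?thesis using g UG by (auto simp: RCOSETS_def coset_mult_assoc)
  qed
  have ex: "\<exists>j<n. C = e j" if "C \<in> rcosets U" for C using e that by (auto simp: bij_betw_def)
  define \<rho> :: "'a \<Rightarrow> complex mat" where "\<rho> g = mat n n (\<lambda>(i, j). if e i #> g = e j then 1 else 0)" for g
  have "n > 0"
    using finR U UG by (auto simp: n_def card_gt_0_iff RCOSETS_def)
  moreover have "\<rho> (g \<otimes> h) = \<rho> g * \<rho> h" if g: "g \<in> carrier G" and h: "h \<in> carrier G" for g h
  proof (rule eq_matI)
    fix i k assume "i < dim_row (\<rho> g * \<rho> h)" "k < dim_col (\<rho> g * \<rho> h)"
    then have ik: "i < n" "k < n" by (simp_all add: \<rho>_def)
    obtain j0 where j0: "j0 < n" "e i #> g = e j0" using ex[OF act[OF eR[OF ik(1)] g]] by blast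
    have "(\<rho> g * \<rho> h) $$ (i, k) = (\<Sum>j<n. (if e i #> g = e j then 1 else 0) * (if e j #> h = e k then 1 else 0))"
      using ik by (auto simp: \<rho>_def scalar_prod_def atLeast0LessThan intro!: sum.cong)
    also have "\<dots> = (\<Sum>j<n. if j = j0 then (if e j0 #> h = e k then 1 else 0) else 0)"
      using j0 inj by (intro sum.cong) auto
    also have "\<dots> = (if e i #> (g \<otimes> h) = e k then 1 else 0)"
      using j0 coset_mult_assoc[OF eG[OF ik(1)] g h] by simp
    finally show "\<rho> (g \<otimes> h) $$ (i, k) = (\<rho> g * \<rho> h) $$ (i, k)" using ik by (simp add: \<rho>_def)
  qed (simp_all add: \<rho>_def)
  moreover have id: "\<rho> g = 1\<^sub>m n"
    if g: "g \<in> carrier G" and "\<And>x. x \<in> carrier G \<Longrightarrow> x \<otimes> g \<otimes> inv x \<in> U" for g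
  proof -
    have "C #> g = C" if "C \<in> rcosets U" for C
      using that conj_mem_iff_coset_fixed[OF U _ g] \<open>\<And>x. x \<in> carrier G \<Longrightarrow> x \<otimes> g \<otimes> inv x \<in> U\<close>
      by (auto simp: RCOSETS_def)
    then show ?thesis using eR inj by (intro eq_matI) (auto simp: \<rho>_def)
  qed
  ultimately have rep: "is_rep G n \<rho>"
    using subgroup.one_closed[OF U] by (auto simp: is_rep_iff \<rho>_def[of "_ :: 'a"])
  have "rep_character G \<rho> g = induced_character G U (\<lambda>g. if g \<in> U then 1 else 0) g" for g
  proof (cases "g \<in> carrier G")
    case g: True
    have "(\<Sum>x\<in>carrier G. (if x \<otimes> g \<otimes> inv x \<in> U then 1 else 0)) =
      of_nat (card U) * (\<Sum>C\<in>rcosets U. if C #> g = C then 1 else (0 :: complex))"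
      using conj_mem_iff_coset_fixed[OF U _ g] by (intro sum_over_rcosets[OF fin U]) simp
    also have "(\<Sum>C\<in>rcosets U. if C #> g = C then 1 else 0) = (\<Sum>i<n. if e i #> g = e i then 1 else (0 :: complex))"
      using sum.reindex_bij_betw[OF e, of "\<lambda>C. if C #> g = C then 1 else (0 :: complex)"] by simp
    also have "\<dots> = mat_trace (\<rho> g)"
      by (auto simp: mat_trace_def \<rho>_def intro!: sum.cong)
    finally show ?thesis using g card_subgroup_pos[OF fin U] by (simp add: induced_character_def rep_character_def)
  qed (simp add: induced_character_def rep_character_def)
  then show ?thesis using that rep id by blast
qed

section \<open>Linear characters as homomorphisms, and twisting by them\<close>

lemma (in group) linear_character_iff:
  "linear_character G \<nu> \<longleftrightarrow> (\<forall>g. g \<notin> carrier G \<longrightarrow> \<nu> g = 0) \<and> \<nu> \<one> = 1 \<and>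
     (\<forall>g\<in>carrier G. \<forall>h\<in>carrier G. \<nu> (g \<otimes> h) = \<nu> g * \<nu> h)" (is "?L \<longleftrightarrow> ?R")
proof
  assume L: ?L
  then obtain n \<rho> where \<rho>: "is_rep G n \<rho>" "\<nu> = rep_character G \<rho>" "\<nu> \<one> = 1"
    by (auto simp: linear_character_def is_character_def)
  then have "n = 1" using character_one by (metis of_nat_1 of_nat_eq_iff)
  then have c: "\<rho> g \<in> carrier_mat 1 1" if "g \<in> carrier G" for g using \<rho> that by (auto simp: is_rep_iff)
  have "\<nu> (g \<otimes> h) = \<nu> g * \<nu> h" if "g \<in> carrier G" "h \<in> carrier G" for g h
  proof -
    have "\<rho> (g \<otimes> h) = \<rho> g * \<rho> h" using \<rho> that by (simp add: is_rep_iff)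
    then show ?thesis using that c[OF that(1)] c[OF that(2)] \<rho>(2)
      by (auto simp: rep_character_def mat_trace_def scalar_prod_def)
  qed
  then show ?R using \<rho> by (auto simp: rep_character_def)
next
  assume R: ?R
  define \<rho> where "\<rho> g = mat 1 1 (\<lambda>_. \<nu> g)" for g
  have "is_rep G 1 \<rho>" unfolding is_rep_iff
  proof (intro conjI ballI)
    show "\<rho> (g \<otimes> h) = \<rho> g * \<rho> h" if "g \<in> carrier G" "h \<in> carrier G" for g h
      using R that by (intro eq_matI) (auto simp: \<rho>_def scalar_prod_def)
    show "\<rho> \<one> = 1\<^sub>m 1" using R by (intro eq_matI) (auto simp: \<rho>_def)
  qed (auto simp: \<rho>_def)
  moreover have "\<nu> = rep_character G \<rho>" using R by (auto simp: rep_character_def \<rho>_def mat_trace_def)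
  ultimately show ?L using R by (auto simp: linear_character_def is_character_def)
qed

lemma (in group) linear_character_irr:
  assumes "linear_character G \<nu>"
  shows "\<nu> \<in> Irr G"
proof -
  obtain n \<rho> where \<rho>: "is_rep G n \<rho>" "\<nu> = rep_character G \<rho>" "\<nu> \<one> = 1"
    using assms by (auto simp: linear_character_def is_character_def)
  then have n: "n = 1" using character_one by (metis of_nat_1 of_nat_eq_iff)
  have "W = {0\<^sub>v 1} \<or> W = carrier_vec 1" if "VectorSpace.subspace class_ring W (module_vec TYPE(complex) 1)" for W
  proof (cases "W \<subseteq> {0\<^sub>v 1}")
    case True
    then show ?thesis using that by (auto simp: subspace_vec_iff)
  next
    case False
    then obtain w where w: "w \<in> W" "w \<noteq> 0\<^sub>v 1" by blast
    then have wc: "w \<in> carrier_vec 1" using that by (auto simp: subspace_vec_iff)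
    have "w $ 0 \<noteq> 0"
    proof
      assume "w $ 0 = 0"
      then have "w = 0\<^sub>v 1" using wc by (intro eq_vecI) auto
      then show False using w by simp
    qed
    then have "v = (v $ 0 / w $ 0) \<cdot>\<^sub>v w" if "v \<in> carrier_vec 1" for v
      using that wc by (intro eq_vecI) auto
    then have "v \<in> W" if "v \<in> carrier_vec 1" for v
      using w(1) \<open>VectorSpace.subspace class_ring W (module_vec TYPE(complex) 1)\<close> that
      unfolding subspace_vec_iff by metis
    then show ?thesis using that by (auto simp: subspace_vec_iff)
  qed
  then have "irreducible_rep G n \<rho>" using \<rho> n by (auto simp: irreducible_rep_def)
  then show ?thesis using \<rho> by (auto simp: Irr_def)
qed

lemma (in group) linear_character_nat_pow:
  assumes "linear_character G \<nu>" "g \<in> carrier G"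
  shows "\<nu> (g [^] (n :: nat)) = \<nu> g ^ n"
  using assms by (induction n) (auto simp: linear_character_iff)

lemma (in group) linear_character_order:
  assumes "finite (carrier G)" "linear_character G \<nu>" "g \<in> carrier G"
  shows "\<nu> g ^ card (carrier G) = 1"
  using linear_character_nat_pow[OF assms(2,3), of "card (carrier G)"] pow_order_eq_1[OF assms(3)] assms(2)
  by (simp add: Coset.order_def linear_character_iff)

lemma (in group) linear_character_norm:
  assumes "finite (carrier G)" "linear_character G \<nu>" "g \<in> carrier G"
  shows "cmod (\<nu> g) = 1"
proof -
  have "cmod (\<nu> g) ^ card (carrier G) = 1"
    using arg_cong[OF linear_character_order[OF assms], of cmod] by (simp add: norm_power)
  then show ?thesis using card_carrier_pos[OF assms(1)] power_eq_imp_eq_base[of "cmod (\<nu> g)" "card (carrier G)" 1] by simp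
qed

text \<open>The matrices change only by nonzero scalars, so the invariant subspaces stay the
  same.\<close>

lemma (in group) irr_times_linear:
  assumes \<nu>: "linear_character G \<nu>" and \<chi>: "\<chi> \<in> Irr G"
  shows "(\<lambda>g. \<nu> g * \<chi> g) \<in> Irr G"
proof -
  obtain n \<rho> where \<rho>: "irreducible_rep G n \<rho>" "\<chi> = rep_character G \<rho>" using \<chi> by (auto simp: Irr_def)
  have rep: "is_rep G n \<rho>" using \<rho> by (auto simp: irreducible_rep_def)
  have c: "\<rho> g \<in> carrier_mat n n" if "g \<in> carrier G" for g using rep that by (auto simp: is_rep_iff)
  have nz: "\<nu> g \<noteq> 0" if g: "g \<in> carrier G" for g
  proof
    assume "\<nu> g = 0"
    then have "\<nu> (g \<otimes> inv g) = 0" using \<nu> g by (metis inv_closed linear_character_iff mult_zero_left)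
    then show False using \<nu> g by (simp add: linear_character_iff)
  qed
  define \<sigma> where "\<sigma> g = \<nu> g \<cdot>\<^sub>m \<rho> g" for g
  have "\<sigma> (g \<otimes> h) = \<sigma> g * \<sigma> h" if "g \<in> carrier G" "h \<in> carrier G" for g h
  proof -
    have "\<rho> (g \<otimes> h) = \<rho> g * \<rho> h" "\<nu> (g \<otimes> h) = \<nu> g * \<nu> h"
      using rep \<nu> that by (simp_all add: is_rep_iff linear_character_iff)
    then show ?thesis using c[OF that(1)] c[OF that(2)]
      by (intro eq_matI) (auto simp: \<sigma>_def scalar_prod_def sum_distrib_left mult_ac)
  qed
  then have rep': "is_rep G n \<sigma>"
    using rep c \<nu> by (auto simp: is_rep_iff \<sigma>_def linear_character_iff)
  have "irreducible_rep G n \<sigma>" unfolding irreducible_rep_def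
  proof (intro conjI allI impI rep')
    fix W assume W: "VectorSpace.subspace class_ring W (module_vec TYPE(complex) n) \<and> (\<forall>g\<in>carrier G. \<forall>w\<in>W. \<sigma> g *\<^sub>v w \<in> W)"
    have "\<rho> g *\<^sub>v w \<in> W" if "g \<in> carrier G" "w \<in> W" for g w
    proof -
      have wc: "w \<in> carrier_vec n" using that W by (auto simp: subspace_vec_iff)
      have "\<rho> g *\<^sub>v w = inverse (\<nu> g) \<cdot>\<^sub>v (\<sigma> g *\<^sub>v w)"
        using nz[OF that(1)] c[OF that(1)] wc
        by (intro eq_vecI) (auto simp: \<sigma>_def scalar_prod_def sum_distrib_left field_simps intro!: sum.cong)
      then show ?thesis using W that by (auto simp: subspace_vec_iff)
    qed
    then show "W = {0\<^sub>v n} \<or> W = carrier_vec n" using \<rho> W by (auto simp: irreducible_rep_def)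
  qed
  moreover have "(\<lambda>g. \<nu> g * \<chi> g) = rep_character G \<sigma>"
  proof
    show "\<nu> g * \<chi> g = rep_character G \<sigma> g" for g
      using \<rho>(2) c[of g] by (auto simp: rep_character_def \<sigma>_def mat_trace_smult[of _ n])
  qed
  ultimately show ?thesis by (auto simp: Irr_def)
qed

lemma (in group) linear_character_power:
  assumes "linear_character G \<nu>"
  shows "linear_character G (\<lambda>g. if g \<in> carrier G then \<nu> g ^ i else 0)"
  using assms by (auto simp: linear_character_iff power_mult_distrib)

lemma (in group) trivial_linear_character: "linear_character G (\<lambda>g. if g \<in> carrier G then 1 else 0)"
  by (auto simp: linear_character_iff)

lemma (in group) sum_linear_character:
  assumes "linear_character G \<nu>" "h \<in> carrier G" "\<nu> h \<noteq> 1"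
  shows "(\<Sum>g\<in>carrier G. \<nu> g) = 0"
proof -
  have "(\<Sum>g\<in>carrier G. \<nu> g) = (\<Sum>g\<in>carrier G. \<nu> h * \<nu> g)"
    using sum_left_translate[OF assms(2), of \<nu>] assms(1,2) by (simp add: linear_character_iff)
  then have "(\<nu> h - 1) * (\<Sum>g\<in>carrier G. \<nu> g) = 0"
    by (simp add: sum_distrib_left[symmetric] left_diff_distrib)
  then show ?thesis using assms(3) by simp
qed

section \<open>Linear characters of M-groups, and induction from primitive characters\<close>

lemma induced_character_one:
  assumes "group G" "finite (carrier G)" "subgroup H G"
  shows "induced_character G H \<phi> \<one>\<^bsub>G\<^esub> * of_nat (card H) = of_nat (card (carrier G)) * \<phi> \<one>\<^bsub>G\<^esub>"
proof -
  interpret group G by fact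
  show ?thesis using card_subgroup_pos[OF assms(2,3)] by (simp add: induced_character_def)
qed

lemma two_le_sum_list:
  fixes f :: "'a \<Rightarrow> nat"
  assumes "x \<in> set xs" "y \<in> set xs" "x \<noteq> y"
  shows "f x + f y \<le> (\<Sum>z\<leftarrow>xs. f z)"
proof -
  have "f x + f y = (\<Sum>z\<in>{x, y}. f z)" using assms by simp
  also have "\<dots> \<le> (\<Sum>z\<in>set xs. f z)" using assms by (intro sum_mono2) auto
  also have "\<dots> \<le> (\<Sum>z\<in>set xs. count_list xs z * f z)"
    by (intro sum_mono) (simp add: Suc_le_eq count_list_0_iff flip: neq0_conv)
  also have "\<dots> = (\<Sum>z\<leftarrow>xs. f z)" by (simp add: sum_list_map_eq_sum_count)
  finally show ?thesis .
qed

abbreviation trivial_character :: "('a, 'b) monoid_scheme \<Rightarrow> 'a \<Rightarrow> complex" where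
  "trivial_character G \<equiv> (\<lambda>g. if g \<in> carrier G then 1 else 0)"

text \<open>By Frobenius reciprocity the permutation character on the cosets of \<open>U\<close>
  contains the trivial character exactly once. Its degree is the index of \<open>U\<close>, so a
  further constituent exists and has smaller degree than that. All conjugates of elements of
  \<open>N\<close> lie in \<open>U\<close>, hence \<open>N\<close> acts trivially. The degree bound
  is multiplied by \<open>card U\<close> to avoid a quotient.\<close>

lemma (in group) irr_nontrivial_below_index:
  assumes fin: "finite (carrier G)" and U: "subgroup U G" "U \<noteq> carrier G" and NU: "N \<subseteq> U"
    and N: "\<And>x n. x \<in> carrier G \<Longrightarrow> n \<in> N \<Longrightarrow> x \<otimes> n \<otimes> inv x \<in> N"
  obtains \<psi> d where "\<psi> \<in> Irr G" "\<psi> \<noteq> trivial_character G" "\<forall>n\<in>N. \<psi> n = \<psi> \<one>"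
    "\<psi> \<one> = of_nat d" "d * card U < card (carrier G)"
proof -
  have UG: "U \<subseteq> carrier G" using U by (simp add: subgroup.subset)
  let ?\<pi> = "induced_character G U (\<lambda>g. if g \<in> U then 1 else 0)"
  obtain n \<rho> where \<rho>: "is_rep G n \<rho>" "rep_character G \<rho> = ?\<pi>"
    "\<forall>g\<in>carrier G. (\<forall>x\<in>carrier G. x \<otimes> g \<otimes> inv x \<in> U) \<longrightarrow> \<rho> g = 1\<^sub>m n"
    by (rule permutation_rep[OF fin U(1)])
  obtain \<psi>s where \<psi>s: "\<forall>\<psi>\<in>set \<psi>s. \<psi> \<in> Irr G \<and> (\<forall>x\<in>carrier G. \<rho> x = 1\<^sub>m n \<longrightarrow> \<psi> x = \<psi> \<one>)"
    "?\<pi> = (\<lambda>g. \<Sum>\<psi>\<leftarrow>\<psi>s. \<psi> g)"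
    using character_decomposition[OF \<rho>(1)] \<rho>(2) by auto
  let ?one = "trivial_character G"
  have one: "?one \<in> Irr G" using linear_character_irr trivial_linear_character by blast
  have "cinner G ?\<pi> ?one = cinner (G\<lparr>carrier := U\<rparr>) (\<lambda>g. if g \<in> U then 1 else 0) ?one"
    using one class_function_character is_character_if_irr by (intro frobenius_reciprocity[OF fin U(1)]) auto
  also have "\<dots> = 1"
    using UG card_subgroup_pos[OF fin U(1)] by (simp add: cinner_subgroup[OF U(1)] subset_iff)
  finally have "of_nat (count_list \<psi>s ?one) = (1 :: complex)"
    using cinner_irr_list[OF fin _ one, of \<psi>s] \<psi>s by auto
  then have cnt: "count_list \<psi>s ?one = 1" using of_nat_eq_1_iff by blast
  then have one_in: "?one \<in> set \<psi>s" using count_notin by fastforce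
  have "\<exists>d :: nat. d > 0 \<and> \<psi> \<one> = of_nat d" if "\<psi> \<in> Irr G" for \<psi> using irr_degree[OF that] by metis
  then obtain deg where deg: "\<And>\<psi>. \<psi> \<in> Irr G \<Longrightarrow> deg \<psi> > (0 :: nat) \<and> \<psi> \<one> = of_nat (deg \<psi>)" by metis
  have "?\<pi> \<one> = (\<Sum>\<psi>\<leftarrow>\<psi>s. of_nat (deg \<psi>))"
    unfolding \<psi>s(2) using \<psi>s(1) deg by (intro arg_cong[where f = sum_list] map_cong) auto
  then have "?\<pi> \<one> = of_nat (\<Sum>\<psi>\<leftarrow>\<psi>s. deg \<psi>)" by (simp add: of_nat_sum_list_map)
  moreover have "?\<pi> \<one> * of_nat (card U) = of_nat (card (carrier G))"
    using induced_character_one[OF group_axioms fin U(1), of "\<lambda>g. if g \<in> U then 1 else 0"]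
      subgroup.one_closed[OF U(1)] by simp
  ultimately have "of_nat ((\<Sum>\<psi>\<leftarrow>\<psi>s. deg \<psi>) * card U) = (of_nat (card (carrier G)) :: complex)" by simp
  then have degsum: "(\<Sum>\<psi>\<leftarrow>\<psi>s. deg \<psi>) * card U = card (carrier G)" using of_nat_eq_iff by blast
  \<comment> \<open>Otherwise the permutation character would be the trivial one, of degree 1, and
    \<open>U\<close> would have index 1.\<close>
  have "\<exists>\<psi>\<in>set \<psi>s. \<psi> \<noteq> ?one"
  proof (rule ccontr)
    assume "\<not> ?thesis"
    then have "filter ((=) ?one) \<psi>s = \<psi>s" by (auto simp: filter_id_conv)
    then have "length \<psi>s = 1" using cnt by (simp add: count_list_eq_length_filter)
    then have "\<psi>s = [?one]" using one_in by (auto simp: length_Suc_conv)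
    then have "card U = card (carrier G)" using degsum deg[OF one] by simp
    then show False using U(2) UG fin card_subset_eq by blast
  qed
  then obtain \<psi> where \<psi>: "\<psi> \<in> set \<psi>s" "\<psi> \<noteq> ?one" by blast
  have \<psi>I: "\<psi> \<in> Irr G" using \<psi> \<psi>s by blast
  have "deg \<psi> + deg ?one \<le> (\<Sum>\<psi>\<leftarrow>\<psi>s. deg \<psi>)" using two_le_sum_list[OF \<psi>(1) one_in \<psi>(2)] .
  then have "deg \<psi> < (\<Sum>\<psi>\<leftarrow>\<psi>s. deg \<psi>)" using deg[OF one] by linarith
  then have "deg \<psi> * card U < card (carrier G)"
    using card_subgroup_pos[OF fin U(1)] degsum by (metis mult_less_mono1)
  moreover have "\<psi> n = \<psi> \<one>" if "n \<in> N" for n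
  proof -
    have "n \<in> carrier G" using that NU UG by blast
    moreover have "\<forall>x\<in>carrier G. x \<otimes> n \<otimes> inv x \<in> U" using N that NU by blast
    ultimately show ?thesis using \<psi>s(1) \<psi>(1) \<rho>(3) by blast
  qed
  ultimately show ?thesis using that[OF \<psi>I \<psi>(2) _ conjunct2[OF deg[OF \<psi>I]]] by simp
qed

text \<open>Equality case of the triangle inequality: every real part is at most 1, and their sum
  leaves no room for a smaller one.\<close>

lemma sum_norm_le_one_eq_card:
  fixes f :: "'a \<Rightarrow> complex"
  assumes "finite A" "(\<Sum>x\<in>A. f x) = of_nat (card A)" "\<And>x. x \<in> A \<Longrightarrow> cmod (f x) \<le> 1" "x \<in> A"
  shows "f x = 1"
proof -
  have le: "Re (f y) \<le> 1" if "y \<in> A" for y using assms(3)[OF that] complex_Re_le_cmod[of "f y"] by linarith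
  have "(\<Sum>x\<in>A. Re (f x)) = of_nat (card A)" using arg_cong[OF assms(2), of Re] by simp
  then have "(\<Sum>x\<in>A. 1 - Re (f x)) = 0" using assms(1) by (simp add: sum_subtractf)
  then have "1 - Re (f x) = 0"
    using le assms(1,4) sum_nonneg_eq_0_iff[of A "\<lambda>x. 1 - Re (f x)"] by auto
  then have "Re (f x) = 1" by simp
  moreover have "(cmod (f x))\<^sup>2 \<le> 1" using assms(3)[OF assms(4)] by (simp add: power_le_one)
  ultimately have "Im (f x) = 0" by (simp add: cmod_power2)
  then show ?thesis using \<open>Re (f x) = 1\<close> by (simp add: complex_eq_iff)
qed

text \<open>A nontrivial character of least degree with \<open>N\<close> in its kernel is linear: were it induced from
  a linear character of a proper subgroup \<open>U\<close>, then \<open>N \<subseteq> U\<close> and the permutation character on the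
  cosets of \<open>U\<close> would have a nontrivial constituent of smaller degree.\<close>

lemma (in group) M_group_linear_character:
  assumes M: "M_group G" and N: "subgroup N G" "N \<noteq> carrier G"
    and conj: "\<And>x n. x \<in> carrier G \<Longrightarrow> n \<in> N \<Longrightarrow> x \<otimes> n \<otimes> inv x \<in> N"
  obtains \<nu> where "linear_character G \<nu>" "\<nu> \<noteq> trivial_character G" "\<forall>n\<in>N. \<nu> n = 1"
proof -
  have fin: "finite (carrier G)" using M by (simp add: M_group_def)
  have NG: "N \<subseteq> carrier G" using N by (simp add: subgroup.subset)
  let ?P = "\<lambda>d. \<exists>\<chi>\<in>Irr G. \<chi> \<noteq> trivial_character G \<and> (\<forall>n\<in>N. \<chi> n = \<chi> \<one>) \<and> \<chi> \<one> = of_nat d"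
  \<comment> \<open>With \<open>N\<close> itself as the subgroup, this shows that some degree
    qualifies, so a least one exists.\<close>
  obtain \<psi> d0 where "\<psi> \<in> Irr G" "\<psi> \<noteq> trivial_character G" "\<forall>n\<in>N. \<psi> n = \<psi> \<one>"
    "\<psi> \<one> = of_nat d0" "d0 * card N < card (carrier G)"
    by (rule irr_nontrivial_below_index[OF fin N subset_refl conj])
  then have "\<exists>d. ?P d" by blast
  then obtain d where d: "?P d" "\<And>d'. d' < d \<Longrightarrow> \<not> ?P d'" using exists_least_iff[of ?P] by blast
  then obtain \<chi> where \<chi>: "\<chi> \<in> Irr G" "\<chi> \<noteq> trivial_character G" "\<And>n. n \<in> N \<Longrightarrow> \<chi> n = \<chi> \<one>" "\<chi> \<one> = of_nat d"
    by blast
  obtain U \<mu> where U: "subgroup U G" and \<mu>: "linear_character (G\<lparr>carrier := U\<rparr>) \<mu>" and ind: "induced_character G U \<mu> = \<chi>"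
    using M \<chi>(1) by (auto simp: M_group_def monomial_character_def)
  interpret U: group "G\<lparr>carrier := U\<rparr>" using subgroup_imp_group[OF U] .
  have UG: "U \<subseteq> carrier G" using U by (rule subgroup.subset)
  have finU: "finite U" using fin UG by (rule rev_finite_subset)
  have \<mu>1: "\<mu> \<one> = 1" using \<mu> by (simp add: linear_character_def)
  have \<mu>_out: "\<mu> g = 0" if "g \<notin> U" for g using \<mu> that by (simp add: U.linear_character_iff)
  have norm: "cmod (\<mu> g) \<le> 1" for g
    using U.linear_character_norm[OF _ \<mu>, of g] finU \<mu>_out[of g] by (cases "g \<in> U") auto
  have deg: "of_nat d * of_nat (card U) = (of_nat (card (carrier G)) :: complex)"
    using induced_character_one[OF group_axioms fin U, of \<mu>] ind \<chi>(4) \<mu>1 by simp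
  then have dU: "d * card U = card (carrier G)" by (metis of_nat_eq_iff of_nat_mult)
  \<comment> \<open>For \<open>n\<close> in the kernel of \<open>\<chi>\<close> the values of
    \<open>\<mu>\<close> at the conjugates of \<open>n\<close> have norm at most 1 and add up to the
    order of \<open>G\<close>, so each is 1. In particular \<open>\<mu> n\<close> is nonzero, and
    \<open>\<mu>\<close> vanishes outside \<open>U\<close>.\<close>
  have NU: "N \<subseteq> U"
  proof
    fix n assume n: "n \<in> N"
    have "(\<Sum>x\<in>carrier G. \<mu> (x \<otimes> n \<otimes> inv x)) = \<chi> n * of_nat (card U)"
      using n NG ind card_subgroup_pos[OF fin U] by (auto simp: induced_character_def)
    also have "\<dots> = of_nat (card (carrier G))" using \<chi>(3)[OF n] \<chi>(4) deg by simp
    finally have "\<mu> (\<one> \<otimes> n \<otimes> inv \<one>) = 1"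
      using sum_norm_le_one_eq_card[OF fin, of "\<lambda>x. \<mu> (x \<otimes> n \<otimes> inv x)" \<one>] norm by simp
    then have "\<mu> n = 1" using n NG by auto
    then show "n \<in> U" using \<mu>_out[of n] by auto
  qed
  have "U = carrier G"
  proof (rule ccontr)
    assume ne: "U \<noteq> carrier G"
    obtain \<psi> d' where \<psi>: "\<psi> \<in> Irr G" "\<psi> \<noteq> trivial_character G" "\<forall>n\<in>N. \<psi> n = \<psi> \<one>"
      "\<psi> \<one> = of_nat d'" "d' * card U < card (carrier G)"
      by (rule irr_nontrivial_below_index[OF fin U ne NU conj])
    then have "?P d'" by blast
    moreover have "d' < d" using \<psi>(5) dU mult_less_cancel2[of d' "card U" d] by simp
    ultimately show False using d(2) by blast
  qed
  then have "d = 1" using dU card_carrier_pos[OF fin] by simp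
  then have lin: "linear_character G \<chi>" using \<chi> by (simp add: linear_character_def is_character_if_irr)
  show ?thesis using that[OF lin \<chi>(2)] \<chi>(3,4) \<open>d = 1\<close> by simp
qed

text \<open>With \<open>e\<close> the least positive exponent killing all values of
  \<open>\<nu>\<close> and \<open>p\<close> a prime divisor of \<open>e\<close>, take the power of
  \<open>\<nu>\<close> with exponent \<open>e div p\<close>. Minimality of \<open>e\<close> keeps it
  nontrivial, and the kernel can only grow.\<close>

lemma (in group) linear_character_prime_order:
  assumes fin: "finite (carrier G)" and \<nu>: "linear_character G \<nu>" and nt: "\<nu> \<noteq> trivial_character G"
  obtains p \<nu>' where "prime (p :: nat)" "linear_character G \<nu>'" "\<nu>' \<noteq> trivial_character G"
    "\<forall>g\<in>carrier G. \<nu>' g ^ p = 1" "\<forall>g\<in>carrier G. \<nu> g = 1 \<longrightarrow> \<nu>' g = 1"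
proof -
  let ?P = "\<lambda>e :: nat. e > 0 \<and> (\<forall>g\<in>carrier G. \<nu> g ^ e = 1)"
  have "?P (card (carrier G))" using linear_character_order[OF fin \<nu>] card_carrier_pos[OF fin] by blast
  then obtain e where e: "?P e" "\<And>e'. e' < e \<Longrightarrow> \<not> ?P e'" using exists_least_iff[of ?P] by blast
  have "e \<noteq> 1"
  proof
    assume "e = 1"
    then have "\<nu> = trivial_character G" using e(1) \<nu> by (auto simp: linear_character_iff)
    then show False using nt by simp
  qed
  then obtain p where p: "prime p" "p dvd e" using prime_factor_nat by blast
  define k where "k = e div p"
  have ek: "e = k * p" using p by (simp add: k_def)
  have k: "k > 0" "k < e" using e(1) ek p(1) prime_gt_1_nat[of p] by auto
  let ?\<nu>' = "\<lambda>g. if g \<in> carrier G then \<nu> g ^ k else 0"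
  show ?thesis
  proof
    show "linear_character G ?\<nu>'" using linear_character_power[OF \<nu>] .
    show "?\<nu>' \<noteq> trivial_character G"
    proof
      assume "?\<nu>' = trivial_character G"
      then have "\<nu> g ^ k = 1" if "g \<in> carrier G" for g using fun_cong[of ?\<nu>' "trivial_character G" g] that by simp
      then show False using e(2)[OF k(2)] k(1) by blast
    qed
    show "\<forall>g\<in>carrier G. ?\<nu>' g ^ p = 1"
      using e(1) by (simp add: power_mult[symmetric] ek)
  qed (use p in auto)
qed

text \<open>\<open>D\<close> may be smaller than \<open>H\<close>: one use has \<open>D\<close> the
  intersection of \<open>H\<close> with a conjugate of it, the other has
  \<open>D = H = K\<close>.\<close>

lemma (in group) rep_conjugate:
  assumes D: "subgroup D G" and H: "subgroup H G" and t: "t \<in> carrier G"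
    and DH: "\<And>h. h \<in> D \<Longrightarrow> t \<otimes> h \<otimes> inv t \<in> H"
    and \<rho>: "is_rep (G\<lparr>carrier := H\<rparr>) n \<rho>"
  shows "is_rep (G\<lparr>carrier := D\<rparr>) n (\<lambda>h. \<rho> (t \<otimes> h \<otimes> inv t))"
proof -
  interpret H: group "G\<lparr>carrier := H\<rparr>" using subgroup_imp_group[OF H] .
  interpret D: group "G\<lparr>carrier := D\<rparr>" using subgroup_imp_group[OF D] .
  have DG: "D \<subseteq> carrier G" using D by (rule subgroup.subset)
  have "t \<otimes> (g \<otimes> h) \<otimes> inv t = (t \<otimes> g \<otimes> inv t) \<otimes> (t \<otimes> h \<otimes> inv t)" if "g \<in> D" "h \<in> D" for g h
  proof -
    have gh: "g \<in> carrier G" "h \<in> carrier G" using that DG by auto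
    then have "(t \<otimes> g \<otimes> inv t) \<otimes> (t \<otimes> h \<otimes> inv t) = t \<otimes> g \<otimes> (inv t \<otimes> t) \<otimes> h \<otimes> inv t"
      using t by (simp only: m_assoc m_closed inv_closed)
    then show ?thesis using gh t by (simp add: m_assoc)
  qed
  then show ?thesis using \<rho> DH t by (auto simp: H.is_rep_iff D.is_rep_iff)
qed

text \<open>By Frobenius reciprocity the norm of the induced character, here 1, is the sum of all
  \<open>S t\<close> divided by \<open>card H * card H\<close>. Each \<open>S t\<close> is a natural
  number, and for \<open>t\<close> in \<open>H\<close> it is \<open>card H\<close> times the norm
  \<open>k\<close> of \<open>\<phi>\<close>. Dropping the other terms gives
  \<open>k \<le> 1\<close>. The lemma is needed because primitivity speaks of arbitrary characters
  of proper subgroups.\<close>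

lemma (in group) irr_if_induced_irr:
  assumes fin: "finite (carrier G)" and H: "subgroup H G" and \<phi>: "is_character (G\<lparr>carrier := H\<rparr>) \<phi>"
    and irr: "induced_character G H \<phi> \<in> Irr G"
  shows "\<phi> \<in> Irr (G\<lparr>carrier := H\<rparr>)"
proof -
  interpret H: group "G\<lparr>carrier := H\<rparr>" using subgroup_imp_group[OF H] .
  have HG: "H \<subseteq> carrier G" using H by (rule subgroup.subset)
  have finH: "finite H" using fin HG by (rule rev_finite_subset)
  have out: "\<phi> g = 0" if "g \<notin> H" for g using character_outside[OF \<phi>] that by simp
  have cH: "card H > 0" using card_subgroup_pos[OF fin H] .
  obtain k where k: "k > 0" "cinner (G\<lparr>carrier := H\<rparr>) \<phi> \<phi> = of_nat k" "k = 1 \<Longrightarrow> \<phi> \<in> Irr (G\<lparr>carrier := H\<rparr>)"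
    using H.cinner_character_self[OF _ \<phi>] finH by auto
  define S where "S t = (\<Sum>h\<in>H. \<phi> h * \<phi> (t \<otimes> inv h \<otimes> inv t))" for t
  have S_in: "S t = of_nat (card H * k)" if "t \<in> H" for t
  proof -
    have "\<phi> (t \<otimes> inv h \<otimes> inv t) = \<phi> (inv h)" if h: "h \<in> H" for h
      using H.class_function_character[OF \<phi>] \<open>t \<in> H\<close> h subgroup.m_inv_closed[OF H h] m_inv_consistent[OF H]
      by (auto simp: class_function_def)
    then show ?thesis using k(2) cH by (simp add: S_def cinner_subgroup[OF H] field_simps)
  qed
  \<comment> \<open>Only those \<open>h\<close> contribute for which both \<open>h\<close> and its
    conjugate by \<open>t\<close> lie in \<open>H\<close>. They form a subgroup \<open>D\<close>,
    and there \<open>S t\<close> is \<open>card D\<close> times an inner product of two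
    characters.\<close>
  have S_nat: "\<exists>m :: nat. S t = of_nat m" if t: "t \<in> carrier G" for t
  proof -
    define D where "D = {h \<in> H. t \<otimes> h \<otimes> inv t \<in> H}"
    have D: "subgroup D G"
    proof (rule subgroupI)
      show "D \<subseteq> carrier G" using HG by (auto simp: D_def)
      have "\<one> \<in> D" using subgroup.one_closed[OF H] t by (simp add: D_def)
      then show "D \<noteq> {}" by blast
      show "inv a \<in> D" if "a \<in> D" for a
        using that H HG t inv_conj[of t a] subgroup.m_inv_closed[OF H, of a]
          subgroup.m_inv_closed[OF H, of "t \<otimes> a \<otimes> inv t"] by (auto simp: D_def)
      show "a \<otimes> b \<in> D" if "a \<in> D" "b \<in> D" for a b
      proof -
        have ab: "a \<in> carrier G" "b \<in> carrier G" using that HG by (auto simp: D_def)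
        then have "(t \<otimes> a \<otimes> inv t) \<otimes> (t \<otimes> b \<otimes> inv t) = t \<otimes> a \<otimes> (inv t \<otimes> t) \<otimes> b \<otimes> inv t"
          using t by (simp only: m_assoc m_closed inv_closed)
        then have "(t \<otimes> a \<otimes> inv t) \<otimes> (t \<otimes> b \<otimes> inv t) = t \<otimes> (a \<otimes> b) \<otimes> inv t"
          using ab t by (simp add: m_assoc)
        then show ?thesis using that subgroup.m_closed[OF H] by (auto simp: D_def) metis
      qed
    qed
    interpret D: group "G\<lparr>carrier := D\<rparr>" using subgroup_imp_group[OF D] .
    have DH: "D \<subseteq> H" by (auto simp: D_def)
    have finD: "finite D" using finH DH by (rule rev_finite_subset)
    obtain n \<rho> where \<rho>: "is_rep (G\<lparr>carrier := H\<rparr>) n \<rho>" "\<phi> = rep_character (G\<lparr>carrier := H\<rparr>) \<rho>"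
      using \<phi> by (auto simp: is_character_def)
    let ?\<alpha> = "rep_character (G\<lparr>carrier := D\<rparr>) \<rho>"
    let ?\<beta> = "rep_character (G\<lparr>carrier := D\<rparr>) (\<lambda>h. \<rho> (t \<otimes> h \<otimes> inv t))"
    have "is_rep (G\<lparr>carrier := D\<rparr>) n \<rho>"
      using \<rho>(1) DH by (auto simp: H.is_rep_iff D.is_rep_iff)
    then have \<alpha>: "is_character (G\<lparr>carrier := D\<rparr>) ?\<alpha>" by (auto simp: is_character_def)
    have "is_rep (G\<lparr>carrier := D\<rparr>) n (\<lambda>h. \<rho> (t \<otimes> h \<otimes> inv t))"
      using rep_conjugate[OF D H t _ \<rho>(1)] by (simp add: D_def)
    then have \<beta>: "is_character (G\<lparr>carrier := D\<rparr>) ?\<beta>" by (auto simp: is_character_def)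
    obtain m :: nat where m: "cinner (G\<lparr>carrier := D\<rparr>) ?\<alpha> ?\<beta> = of_nat m"
      using D.cinner_characters_nat[OF _ \<alpha> \<beta>] finD by auto
    have "S t = (\<Sum>h\<in>D. \<phi> h * \<phi> (t \<otimes> inv h \<otimes> inv t))"
      unfolding S_def
    proof (rule sum.mono_neutral_right[OF finH DH], rule ballI)
      fix h assume h: "h \<in> H - D"
      then have "t \<otimes> inv h \<otimes> inv t \<notin> H"
        using inv_conj[of t "inv h"] t HG subgroup.m_inv_closed[OF H, of "t \<otimes> inv h \<otimes> inv t"]
        by (auto simp: D_def)
      then show "\<phi> h * \<phi> (t \<otimes> inv h \<otimes> inv t) = 0" using out by simp
    qed
    also have "\<dots> = (\<Sum>h\<in>D. ?\<alpha> h * ?\<beta> (inv h))"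
    proof (rule sum.cong[OF refl])
      fix h assume h: "h \<in> D"
      have "inv h \<in> D" using subgroup.m_inv_closed[OF D h] .
      then show "\<phi> h * \<phi> (t \<otimes> inv h \<otimes> inv t) = ?\<alpha> h * ?\<beta> (inv h)"
        using h by (auto simp: \<rho>(2) rep_character_def D_def)
    qed
    also have "\<dots> = of_nat (card D * m)"
      using m card_subgroup_pos[OF fin D] by (simp add: cinner_subgroup[OF D] field_simps)
    finally show ?thesis by blast
  qed
  then obtain m where m: "\<And>t. t \<in> carrier G \<Longrightarrow> S t = of_nat (m t :: nat)" by metis
  have "1 = cinner G (induced_character G H \<phi>) (induced_character G H \<phi>)"
    using cinner_irr[OF fin irr irr] by simp
  also have "\<dots> = cinner (G\<lparr>carrier := H\<rparr>) \<phi> (induced_character G H \<phi>)"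
    by (rule frobenius_reciprocity[OF fin H out class_function_induced])
  also have "\<dots> = (\<Sum>h\<in>H. \<Sum>t\<in>carrier G. \<phi> h * \<phi> (t \<otimes> inv h \<otimes> inv t)) / of_nat (card H * card H)"
    using HG subgroup.m_inv_closed[OF H]
    by (auto simp: cinner_subgroup[OF H] induced_character_def sum_distrib_left sum_divide_distrib intro!: sum.cong)
  also have "\<dots> = (\<Sum>t\<in>carrier G. S t) / of_nat (card H * card H)"
    unfolding S_def by (subst sum.swap) simp
  also have "(\<Sum>t\<in>carrier G. S t) = of_nat (\<Sum>t\<in>carrier G. m t)" using m by simp
  finally have "of_nat (\<Sum>t\<in>carrier G. m t) = (of_nat (card H * card H) :: complex)"
    using cH by (simp add: field_simps)
  then have sum: "(\<Sum>t\<in>carrier G. m t) = card H * card H" using of_nat_eq_iff by blast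
  have "m t = card H * k" if "t \<in> H" for t
    using S_in[OF that] m[of t] that HG by (metis of_nat_eq_iff subsetD)
  then have "card H * (card H * k) = (\<Sum>t\<in>H. m t)" by simp
  also have "\<dots> \<le> (\<Sum>t\<in>carrier G. m t)" using fin HG by (intro sum_mono2) auto
  finally have "k \<le> 1" using sum cH by simp
  then show ?thesis using k by simp
qed

lemma (in group) induced_from_carrier:
  assumes "finite (carrier G)" "class_function G \<theta>" "\<And>g. g \<notin> carrier G \<Longrightarrow> \<theta> g = 0"
  shows "induced_character G (carrier G) \<theta> = \<theta>"
proof
  fix g
  show "induced_character G (carrier G) \<theta> g = \<theta> g"
    using assms card_carrier_pos[OF assms(1)] by (cases "g \<in> carrier G") (simp_all add: induced_character_def class_function_def)
qed

text \<open>Choose a subgroup of least order with an irreducible character inducing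
  \<open>\<theta>\<close>. If that character came from a proper subgroup, transitivity of induction
  would give a smaller choice.\<close>

lemma (in group) induced_from_primitive:
  assumes fin: "finite (carrier G)" and \<theta>: "\<theta> \<in> Irr G"
  obtains H \<phi> where "subgroup H G" "primitive_character (G\<lparr>carrier := H\<rparr>) \<phi>" "induced_character G H \<phi> = \<theta>"
proof -
  let ?P = "\<lambda>n. \<exists>H \<phi>. subgroup H G \<and> \<phi> \<in> Irr (G\<lparr>carrier := H\<rparr>) \<and> induced_character G H \<phi> = \<theta> \<and> card H = n"
  have ch: "is_character G \<theta>" using \<theta> by (rule is_character_if_irr)
  have "?P (card (carrier G))"
    using \<theta> subgroup_self induced_from_carrier[OF fin class_function_character[OF ch] character_outside[OF ch]]
    by (intro exI[of _ "carrier G"] exI[of _ \<theta>]) simp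
  then obtain n where n: "?P n" "\<And>n'. n' < n \<Longrightarrow> \<not> ?P n'" using exists_least_iff[of ?P] by blast
  then obtain H \<phi> where H: "subgroup H G" and \<phi>: "\<phi> \<in> Irr (G\<lparr>carrier := H\<rparr>)"
    and ind: "induced_character G H \<phi> = \<theta>" and cH: "card H = n" by blast
  interpret H: group "G\<lparr>carrier := H\<rparr>" using subgroup_imp_group[OF H] .
  have finH: "finite H" using fin subgroup.subset[OF H] by (rule rev_finite_subset)
  have "primitive_character (G\<lparr>carrier := H\<rparr>) \<phi>"
    unfolding primitive_character_def
  proof (intro conjI \<phi> notI)
    assume "\<exists>H' \<psi>. subgroup H' (G\<lparr>carrier := H\<rparr>) \<and> H' \<noteq> carrier (G\<lparr>carrier := H\<rparr>) \<and>
      is_character (G\<lparr>carrier := H, carrier := H'\<rparr>) \<psi> \<and> induced_character (G\<lparr>carrier := H\<rparr>) H' \<psi> = \<phi>"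
    then obtain H' \<psi> where H': "subgroup H' (G\<lparr>carrier := H\<rparr>)" "H' \<noteq> H"
      and \<psi>: "is_character (G\<lparr>carrier := H, carrier := H'\<rparr>) \<psi>" "induced_character (G\<lparr>carrier := H\<rparr>) H' \<psi> = \<phi>"
      by auto
    have "\<psi> \<in> Irr (G\<lparr>carrier := H, carrier := H'\<rparr>)"
      using H.irr_if_induced_irr[OF _ H'(1) \<psi>(1)] finH \<phi> \<psi>(2) by simp
    then have irr: "\<psi> \<in> Irr (G\<lparr>carrier := H'\<rparr>)" by simp
    have "\<psi> g = 0" if "g \<notin> H'" for g using character_outside[OF \<psi>(1)] that by simp
    then have ind': "induced_character G H' \<psi> = \<theta>"
      using induced_character_trans[OF fin H H'(1), of \<psi>] \<psi>(2) ind by simp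
    have "H' \<subset> H" using subgroup.subset[OF H'(1)] H'(2) by auto
    then have "card H' < n" using psubset_card_mono[OF finH] cH by simp
    moreover have "subgroup H' G" using incl_subgroup[OF H H'(1)] .
    ultimately show False using n(2)[of "card H'"] irr ind' by blast
  qed
  then show ?thesis using that H ind by blast
qed

section \<open>The kernel of a linear character of prime order\<close>

locale prime_order_character = group G for G (structure) +
  fixes \<nu> :: "'a \<Rightarrow> complex" and p :: nat
  assumes finite_carrier: "finite (carrier G)"
    and prime: "prime p"
    and linear: "linear_character G \<nu>"
    and nontrivial: "\<nu> \<noteq> trivial_character G"
    and root: "\<And>g. g \<in> carrier G \<Longrightarrow> \<nu> g ^ p = 1"
begin

definition K where "K = {g \<in> carrier G. \<nu> g = 1}"

lemma \<nu>_mult: "g \<in> carrier G \<Longrightarrow> h \<in> carrier G \<Longrightarrow> \<nu> (g \<otimes> h) = \<nu> g * \<nu> h"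
  and \<nu>_one: "\<nu> \<one> = 1"
  using linear by (auto simp: linear_character_iff)

lemma \<nu>_inv: "g \<in> carrier G \<Longrightarrow> \<nu> (inv g) * \<nu> g = 1"
  using \<nu>_mult[of "inv g" g] \<nu>_one by simp

lemma \<nu>_conj: "x \<in> carrier G \<Longrightarrow> g \<in> carrier G \<Longrightarrow> \<nu> (x \<otimes> g \<otimes> inv x) = \<nu> g"
  using \<nu>_mult \<nu>_inv[of x] by (simp add: mult_ac)

lemma K_carrier: "K \<subseteq> carrier G"
  by (auto simp: K_def)

lemma K_subgroup: "subgroup K G"
proof (rule subgroupI)
  show "K \<noteq> {}" using \<nu>_one by (auto simp: K_def)
  show "inv g \<in> K" if "g \<in> K" for g using that \<nu>_inv[of g] by (auto simp: K_def)
qed (auto simp: K_def \<nu>_mult)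

lemma K_finite: "finite K"
  using finite_carrier K_carrier by (rule rev_finite_subset)

lemma K_conj_iff: "x \<in> carrier G \<Longrightarrow> g \<in> carrier G \<Longrightarrow> x \<otimes> g \<otimes> inv x \<in> K \<longleftrightarrow> g \<in> K"
  by (simp add: K_def \<nu>_conj)

lemma K_conj: "x \<in> carrier G \<Longrightarrow> k \<in> K \<Longrightarrow> x \<otimes> k \<otimes> inv x \<in> K"
  using K_conj_iff K_carrier by blast

lemma K_inv: "k \<in> K \<Longrightarrow> inv k \<in> K"
  using K_subgroup by (rule subgroup.m_inv_closed)

lemma group_K: "group (G\<lparr>carrier := K\<rparr>)"
  using K_subgroup by (rule subgroup_imp_group)

lemma card_K_pos: "card K > 0"
  using card_subgroup_pos[OF finite_carrier K_subgroup] .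

lemma p_pos: "p > 0"
  using prime by (simp add: prime_gt_0_nat)

lemma \<nu>_power_eq_one:
  assumes g: "g \<in> carrier G" and i: "0 < i" "i < p" and eq: "\<nu> g ^ i = 1"
  shows "\<nu> g = 1"
proof -
  have "\<not> p dvd i" using i by (auto dest: dvd_imp_le)
  then have "coprime i p" using prime_imp_coprime[OF prime] by (simp add: coprime_commute)
  then obtain x y where "i * x = p * y + 1" using bezout_nat[of i p] i(1) by auto
  then have "(\<nu> g ^ i) ^ x = (\<nu> g ^ p) ^ y * \<nu> g"
    by (metis power_mult power_add power_one_right)
  then show ?thesis using eq root[OF g] by simp
qed

text \<open>The powers of \<open>\<nu>\<close> play the part of the characters of \<open>G\<close>
  modulo \<open>K\<close>: their sum is \<open>p\<close> times the indicator of \<open>K\<close>.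
  Sums over \<open>K\<close> thus become sums over twists on \<open>G\<close>.\<close>

lemma sum_powers:
  assumes "g \<in> carrier G"
  shows "(\<Sum>i<p. \<nu> g ^ i) = (if g \<in> K then of_nat p else 0)"
  using assms root[OF assms] geometric_sum[of "\<nu> g" p] by (auto simp: K_def)

lemma sum_over_K:
  "of_nat p * (\<Sum>k\<in>K. f k) = (\<Sum>i<p. \<Sum>g\<in>carrier G. \<nu> g ^ i * f g)"
proof -
  have "(\<Sum>i<p. \<Sum>g\<in>carrier G. \<nu> g ^ i * f g) = (\<Sum>g\<in>carrier G. (\<Sum>i<p. \<nu> g ^ i) * f g)"
    by (subst sum.swap) (simp add: sum_distrib_right)
  also have "\<dots> = (\<Sum>g\<in>carrier G. if g \<in> K then of_nat p * f g else 0)"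
    by (rule sum.cong) (simp_all add: sum_powers)
  also have "\<dots> = (\<Sum>k\<in>K. of_nat p * f k)"
    using finite_carrier K_carrier by (simp add: sum.If_cases Int_absorb1)
  finally show ?thesis by (simp add: sum_distrib_left)
qed

lemma sum_\<nu>_power_subgroup:
  assumes U: "subgroup U G" "\<not> U \<subseteq> K" and i: "0 < i" "i < p"
  shows "(\<Sum>u\<in>U. \<nu> u ^ i) = 0"
proof -
  interpret U: group "G\<lparr>carrier := U\<rparr>" using subgroup_imp_group[OF U(1)] .
  have UG: "U \<subseteq> carrier G" using U(1) by (rule subgroup.subset)
  obtain u where u: "u \<in> U" "u \<notin> K" using U(2) by blast
  have "linear_character (G\<lparr>carrier := U\<rparr>) (\<lambda>g. if g \<in> U then \<nu> g ^ i else 0)"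
    using UG \<nu>_mult \<nu>_one subgroup.one_closed[OF U(1)] subgroup.m_closed[OF U(1)]
    by (auto simp: U.linear_character_iff power_mult_distrib subset_iff)
  moreover have "\<nu> u ^ i \<noteq> 1" using \<nu>_power_eq_one[of u i] u UG i by (auto simp: K_def)
  ultimately have "(\<Sum>g\<in>U. if g \<in> U then \<nu> g ^ i else 0) = 0"
    using U.sum_linear_character[of "\<lambda>g. if g \<in> U then \<nu> g ^ i else 0" u] u by simp
  then show ?thesis by simp
qed

lemma K_not_carrier: "\<not> carrier G \<subseteq> K"
proof
  assume "carrier G \<subseteq> K"
  then have "\<nu> = trivial_character G" using linear by (intro ext) (auto simp: K_def linear_character_iff)
  then show False using nontrivial by simp
qed

text \<open>The set is the intersection of \<open>U\<close> with the left coset of \<open>K\<close>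
  through \<open>x\<close>. That its size does not depend on \<open>x\<close> is the quantitative
  form of \<open>G = U K\<close>. The count follows from \<open>sum_powers\<close>, since a
  nontrivial power of \<open>\<nu>\<close> sums to zero over \<open>U\<close>.\<close>

lemma card_coset_Int:
  assumes U: "subgroup U G" "\<not> U \<subseteq> K" and x: "x \<in> carrier G"
  shows "p * card {u \<in> U. inv x \<otimes> u \<in> K} = card U"
proof -
  have UG: "U \<subseteq> carrier G" using U(1) by (rule subgroup.subset)
  have finU: "finite U" using finite_carrier UG by (rule rev_finite_subset)
  have "of_nat p * of_nat (card {u \<in> U. inv x \<otimes> u \<in> K}) = (\<Sum>u\<in>U. if inv x \<otimes> u \<in> K then of_nat p else (0 :: complex))"
    using finU by (simp add: sum.If_cases Int_def)
  also have "\<dots> = (\<Sum>u\<in>U. \<Sum>i<p. \<nu> (inv x \<otimes> u) ^ i)"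
    using x UG by (intro sum.cong) (auto simp: sum_powers)
  also have "\<dots> = (\<Sum>i<p. \<nu> (inv x) ^ i * (\<Sum>u\<in>U. \<nu> u ^ i))"
    using x UG by (subst sum.swap) (auto simp: \<nu>_mult power_mult_distrib sum_distrib_left subset_iff intro!: sum.cong)
  also have "\<dots> = (\<Sum>i<p. if i = 0 then of_nat (card U) else 0)"
    using sum_\<nu>_power_subgroup[OF U] by (intro sum.cong) auto
  finally have "of_nat (p * card {u \<in> U. inv x \<otimes> u \<in> K}) = (of_nat (card U) :: complex)"
    using p_pos by simp
  then show ?thesis using of_nat_eq_iff by blast
qed

lemma card_K: "p * card K = card (carrier G)"
proof -
  have "{u \<in> carrier G. inv \<one> \<otimes> u \<in> K} = K" using K_carrier by auto
  then show ?thesis using card_coset_Int[OF subgroup_self K_not_carrier one_closed] by simp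
qed

lemma intermediate_subgroup:
  assumes T: "subgroup T G" "K \<subseteq> T"
  shows "card T = card K \<or> card T = card (carrier G)"
proof -
  interpret T: group "G\<lparr>carrier := T\<rparr>" using subgroup_imp_group[OF T(1)] .
  have "card (rcosets T) * card T = card (carrier G)"
    using lagrange[OF T(1)] by (simp add: Coset.order_def)
  then obtain b where b: "card (carrier G) = card T * b" by (metis mult.commute)
  have "card (rcosets\<^bsub>G\<lparr>carrier := T\<rparr>\<^esub> K) * card K = card T"
    using T.lagrange[OF subgroup_incl[OF K_subgroup T]] by (simp add: Coset.order_def)
  then obtain a where a: "card T = card K * a" by (metis mult.commute)
  have "card K * p = card K * (a * b)" using card_K a b by (simp add: mult_ac)
  then have "p = a * b" using card_K_pos by simp
  then have "a = 1 \<or> b = 1" using prime prime_product by blast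
  then show ?thesis using a b by auto
qed

lemma cinner_vanishing_off_K:
  assumes "\<And>g. g \<notin> K \<Longrightarrow> \<alpha> g = 0"
  shows "cinner (G\<lparr>carrier := K\<rparr>) \<alpha> \<beta> = of_nat p * cinner G \<alpha> \<beta>"
proof -
  have "(\<Sum>k\<in>K. \<alpha> k * \<beta> (inv k)) = (\<Sum>g\<in>carrier G. \<alpha> g * \<beta> (inv g))"
    using finite_carrier K_carrier assms by (intro sum.mono_neutral_left) auto
  then show ?thesis using card_K_pos p_pos
    by (simp add: cinner_subgroup[OF K_subgroup] cinner_def[of G] card_K[symmetric])
qed

lemma twist_vanishes_off_K:
  assumes "0 < i" "i < p" and eq: "(\<lambda>g. \<nu> g ^ i * \<chi> g) = \<chi>" and out: "\<And>g. g \<notin> carrier G \<Longrightarrow> \<chi> g = 0"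
    and g: "g \<notin> K"
  shows "\<chi> g = 0"
proof (cases "g \<in> carrier G")
  case True
  then have "\<nu> g ^ i \<noteq> 1" using \<nu>_power_eq_one assms(1,2) g by (auto simp: K_def)
  moreover have "\<nu> g ^ i * \<chi> g = \<chi> g" using fun_cong[OF eq, of g] .
  ultimately show ?thesis by simp
qed (rule out)

lemma irr_twist:
  assumes "\<chi> \<in> Irr G"
  shows "(\<lambda>g. \<nu> g ^ i * \<chi> g) \<in> Irr G"
proof -
  have "(\<lambda>g. (if g \<in> carrier G then \<nu> g ^ i else 0) * \<chi> g) = (\<lambda>g. \<nu> g ^ i * \<chi> g)"
    using character_outside[OF is_character_if_irr[OF assms]] by auto
  then show ?thesis using irr_times_linear[OF linear_character_power[OF linear] assms, of i] by simp
qed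

text \<open>By \<open>sum_over_K\<close> the norm over \<open>K\<close> is the sum of the inner
  products over \<open>G\<close> of \<open>\<chi>\<close> with its twists. These are irreducible,
  and only the one with \<open>i = 0\<close> equals \<open>\<chi>\<close>.\<close>

lemma restriction_irr:
  assumes \<chi>: "\<chi> \<in> Irr G" and ne: "\<And>i. 0 < i \<Longrightarrow> i < p \<Longrightarrow> (\<lambda>g. \<nu> g ^ i * \<chi> g) \<noteq> \<chi>"
  shows "cinner (G\<lparr>carrier := K\<rparr>) \<chi> \<chi> = 1"
proof -
  have "of_nat p * (\<Sum>k\<in>K. \<chi> k * \<chi> (inv k)) = (\<Sum>i<p. \<Sum>g\<in>carrier G. \<nu> g ^ i * (\<chi> g * \<chi> (inv g)))"
    by (rule sum_over_K)
  also have "\<dots> = (\<Sum>i<p. of_nat (card (carrier G)) * cinner G (\<lambda>g. \<nu> g ^ i * \<chi> g) \<chi>)"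
    using card_carrier_pos[OF finite_carrier] by (simp add: cinner_def mult.assoc)
  also have "\<dots> = (\<Sum>i<p. if i = 0 then of_nat (card (carrier G)) else 0)"
    using cinner_irr[OF finite_carrier irr_twist[OF \<chi>] \<chi>] ne cinner_irr[OF finite_carrier \<chi> \<chi>]
    by (intro sum.cong) auto
  finally show ?thesis using p_pos card_K_pos
    by (simp add: cinner_subgroup[OF K_subgroup] card_K[symmetric])
qed

text \<open>Mackey's formula for the single double coset \<open>G = U K\<close>: the restriction to
  \<open>K\<close> is induced from \<open>U \<inter> K\<close>.\<close>

lemma monomial_restriction:
  assumes U: "subgroup U G" "\<not> U \<subseteq> K" and \<mu>: "linear_character (G\<lparr>carrier := U\<rparr>) \<mu>"
  shows "monomial_character (G\<lparr>carrier := K\<rparr>) (restrict_to K (induced_character G U \<mu>))"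
proof -
  interpret U: group "G\<lparr>carrier := U\<rparr>" using subgroup_imp_group[OF U(1)] .
  define L where "L = U \<inter> K"
  have L: "subgroup L G" unfolding L_def using U(1) K_subgroup by (rule subgroups_Inter_pair)
  interpret L: group "G\<lparr>carrier := L\<rparr>" using subgroup_imp_group[OF L] .
  have LK: "subgroup L (G\<lparr>carrier := K\<rparr>)" using subgroup_incl[OF L K_subgroup] by (simp add: L_def)
  have UG: "U \<subseteq> carrier G" using U(1) by (rule subgroup.subset)
  have finU: "finite U" using finite_carrier UG by (rule rev_finite_subset)
  have \<mu>_out: "\<mu> g = 0" if "g \<notin> U" for g using \<mu> that by (simp add: U.linear_character_iff)
  have cU: "card U > 0" using card_subgroup_pos[OF finite_carrier U(1)] .
  have cL: "card L > 0" using card_subgroup_pos[OF finite_carrier L] .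
  have fibre: "card {u \<in> U. inv x \<otimes> u \<in> K} = card L" if x: "x \<in> carrier G" for x
  proof -
    have "{u \<in> U. inv \<one> \<otimes> u \<in> K} = L" using UG by (auto simp: L_def)
    then have "p * card {u \<in> U. inv x \<otimes> u \<in> K} = p * card L"
      using card_coset_Int[OF U x] card_coset_Int[OF U one_closed] by simp
    then show ?thesis using p_pos by simp
  qed
  have "restrict_to K (induced_character G U \<mu>) k = induced_character (G\<lparr>carrier := K\<rparr>) L (restrict_to L \<mu>) k" for k
  proof (cases "k \<in> K")
    case k: True
    then have kG: "k \<in> carrier G" using K_carrier by blast
    \<comment> \<open>\<open>f\<close> is the summand of the induced character at \<open>k\<close>.
      It is constant on right cosets of \<open>U\<close>, because \<open>\<mu>\<close> is a class
      function on \<open>U\<close> and zero elsewhere.\<close>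
    define f where "f x = \<mu> (x \<otimes> k \<otimes> inv x)" for x
    have f_mult: "f (u \<otimes> x) = f x" if u: "u \<in> U" and x: "x \<in> carrier G" for u x
    proof -
      have uG: "u \<in> carrier G" using u UG by blast
      have eq: "(u \<otimes> x) \<otimes> k \<otimes> inv (u \<otimes> x) = u \<otimes> (x \<otimes> k \<otimes> inv x) \<otimes> inv u"
        using conj_conj[OF uG x kG] by simp
      show ?thesis
      proof (cases "x \<otimes> k \<otimes> inv x \<in> U")
        case True
        have "class_function (G\<lparr>carrier := U\<rparr>) \<mu>"
          using \<mu> U.class_function_character by (simp add: linear_character_def)
        then have "\<mu> (u \<otimes> (x \<otimes> k \<otimes> inv x) \<otimes> inv\<^bsub>G\<lparr>carrier := U\<rparr>\<^esub> u) = \<mu> (x \<otimes> k \<otimes> inv x)"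
          using True u by (simp add: class_function_def)
        then show ?thesis using m_inv_consistent[OF U(1) u] by (simp add: f_def eq)
      next
        case False
        have "u \<otimes> (x \<otimes> k \<otimes> inv x) \<otimes> inv u \<notin> U"
        proof
          assume "u \<otimes> (x \<otimes> k \<otimes> inv x) \<otimes> inv u \<in> U"
          then have "inv u \<otimes> (u \<otimes> (x \<otimes> k \<otimes> inv x) \<otimes> inv u) \<otimes> u \<in> U"
            using u U(1) by (meson subgroup.m_closed subgroup.m_inv_closed)
          then show False using False conj_inv_cancel[OF uG, of "x \<otimes> k \<otimes> inv x"] x kG by simp
        qed
        then show ?thesis using False by (simp add: f_def eq \<mu>_out)
      qed
    qed
    \<comment> \<open>Double counting: each \<open>x\<close> is weighted by the number of
      \<open>u\<close> in \<open>U\<close> lying in the left coset of \<open>K\<close> through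
      \<open>x\<close>, which is \<open>card L\<close>. For fixed \<open>u\<close> the substitution
      \<open>x = u \<otimes> y\<close> leaves exactly the \<open>y\<close> in \<open>K\<close>, and
      \<open>f\<close> does not see \<open>u\<close>.\<close>
    have "of_nat (card L) * (\<Sum>x\<in>carrier G. f x) = (\<Sum>x\<in>carrier G. of_nat (card {u \<in> U. inv x \<otimes> u \<in> K}) * f x)"
      by (simp add: fibre sum_distrib_left)
    also have "\<dots> = (\<Sum>x\<in>carrier G. \<Sum>u\<in>U. if inv x \<otimes> u \<in> K then f x else 0)"
      using finU by (intro sum.cong) (simp_all add: sum.If_cases Int_def)
    also have "\<dots> = (\<Sum>u\<in>U. \<Sum>x\<in>carrier G. if inv x \<otimes> u \<in> K then f x else 0)"
      by (rule sum.swap)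
    also have "\<dots> = (\<Sum>u\<in>U. \<Sum>y\<in>K. f y)"
    proof (rule sum.cong[OF refl])
      fix u assume u: "u \<in> U"
      then have uG: "u \<in> carrier G" using UG by blast
      have "(\<Sum>x\<in>carrier G. if inv x \<otimes> u \<in> K then f x else 0) =
        (\<Sum>y\<in>carrier G. if inv (u \<otimes> y) \<otimes> u \<in> K then f (u \<otimes> y) else 0)"
        using sum_left_translate[OF uG, of "\<lambda>x. if inv x \<otimes> u \<in> K then f x else 0"] by simp
      also have "\<dots> = (\<Sum>y\<in>carrier G. if y \<in> K then f y else 0)"
      proof (rule sum.cong[OF refl])
        fix y assume y: "y \<in> carrier G"
        have "inv (u \<otimes> y) \<otimes> u = inv y" using y uG by (simp add: inv_mult_group m_assoc)
        moreover have "inv y \<in> K \<longleftrightarrow> y \<in> K" using K_inv[of y] K_inv[of "inv y"] y by auto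
        ultimately show "(if inv (u \<otimes> y) \<otimes> u \<in> K then f (u \<otimes> y) else 0) = (if y \<in> K then f y else 0)"
          using f_mult[OF u y] by simp
      qed
      also have "\<dots> = (\<Sum>y\<in>K. f y)"
        using finite_carrier K_carrier by (simp add: sum.If_cases Int_absorb1)
      finally show "(\<Sum>x\<in>carrier G. if inv x \<otimes> u \<in> K then f x else 0) = (\<Sum>y\<in>K. f y)" .
    qed
    finally have "(\<Sum>x\<in>carrier G. f x) / of_nat (card U) = (\<Sum>y\<in>K. f y) / of_nat (card L)"
      using cU cL by (simp add: field_simps)
    \<comment> \<open>Conjugates of \<open>k\<close> by elements of \<open>K\<close> stay in
      \<open>K\<close>, so cutting \<open>\<mu>\<close> down to \<open>L\<close> changes no
      summand.\<close>
    moreover have "f y = restrict_to L \<mu> (y \<otimes> k \<otimes> inv\<^bsub>G\<lparr>carrier := K\<rparr>\<^esub> y)" if y: "y \<in> K" for y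
      using K_conj[of y k] y k K_carrier m_inv_consistent[OF K_subgroup y] \<mu>_out
      by (auto simp: f_def restrict_to_def L_def)
    ultimately show ?thesis using k kG by (simp add: restrict_to_def[of K] induced_character_def f_def)
  qed (simp add: restrict_to_def induced_character_def)
  moreover have "linear_character (G\<lparr>carrier := L\<rparr>) (restrict_to L \<mu>)"
    unfolding L.linear_character_iff using \<mu> subgroup.one_closed[OF L] subgroup.m_closed[OF L]
    by (auto simp: U.linear_character_iff restrict_to_def L_def)
  ultimately show ?thesis
    unfolding monomial_character_def using LK by (intro exI[of _ L] exI[of _ "restrict_to L \<mu>"]) auto
qed

section \<open>Conjugates of characters of \<open>K\<close>, and characters of \<open>G\<close>
  vanishing off \<open>K\<close>\<close>

lemma induced_vanishes_off_K:
  assumes "\<And>g. g \<notin> K \<Longrightarrow> \<phi> g = 0" "g \<notin> K"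
  shows "induced_character G H \<phi> g = 0"
  using assms K_conj_iff[of _ g] by (auto simp: induced_character_def)

text \<open>The value 0 outside \<open>K\<close> makes the conjugate a character of \<open>K\<close>
  in the sense used here, so that \<open>conj_by x \<theta> = \<theta>\<close> describes the inertia
  group of \<open>\<theta>\<close>.\<close>

definition conj_by :: "'a \<Rightarrow> ('a \<Rightarrow> complex) \<Rightarrow> 'a \<Rightarrow> complex" where
  "conj_by x \<theta> = (\<lambda>k. if k \<in> K then \<theta> (x \<otimes> k \<otimes> inv x) else 0)"

lemma conj_by_irr:
  assumes \<theta>: "\<theta> \<in> Irr (G\<lparr>carrier := K\<rparr>)" and x: "x \<in> carrier G"
  shows "conj_by x \<theta> \<in> Irr (G\<lparr>carrier := K\<rparr>)"
proof -
  obtain n \<rho> where \<rho>: "irreducible_rep (G\<lparr>carrier := K\<rparr>) n \<rho>" "\<theta> = rep_character (G\<lparr>carrier := K\<rparr>) \<rho>"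
    using \<theta> by (auto simp: Irr_def)
  have "is_rep (G\<lparr>carrier := K\<rparr>) n (\<lambda>k. \<rho> (x \<otimes> k \<otimes> inv x))"
    using \<rho>(1) K_conj[OF x] by (intro rep_conjugate[OF K_subgroup K_subgroup x]) (auto simp: irreducible_rep_def)
  moreover have "\<rho> k *\<^sub>v w \<in> W"
    if inv: "\<forall>k\<in>K. \<forall>w\<in>W. \<rho> (x \<otimes> k \<otimes> inv x) *\<^sub>v w \<in> W" and k: "k \<in> K" and w: "w \<in> W" for W k w
  proof -
    have kG: "k \<in> carrier G" using k K_carrier by blast
    have "inv x \<otimes> k \<otimes> x \<in> K" using K_conj[of "inv x" k] k x by simp
    moreover have "x \<otimes> (inv x \<otimes> k \<otimes> x) \<otimes> inv x = k" using conj_inv_cancel[of "inv x" k] x kG by simp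
    ultimately show ?thesis using inv w by metis
  qed
  ultimately have "irreducible_rep (G\<lparr>carrier := K\<rparr>) n (\<lambda>k. \<rho> (x \<otimes> k \<otimes> inv x))"
    using \<rho>(1) by (auto simp: irreducible_rep_def)
  moreover have "conj_by x \<theta> = rep_character (G\<lparr>carrier := K\<rparr>) (\<lambda>k. \<rho> (x \<otimes> k \<otimes> inv x))"
    using K_conj[OF x] by (auto simp: conj_by_def \<rho>(2) rep_character_def)
  ultimately show ?thesis by (auto simp: Irr_def)
qed

text \<open>Conjugation by \<open>x\<close> permutes \<open>K\<close> and fixes
  \<open>\<chi>\<close>. For irreducible \<open>\<theta>\<close> and a character
  \<open>\<chi>\<close> of \<open>G\<close> this says that all conjugates of \<open>\<theta>\<close>
  have one multiplicity in the restriction of \<open>\<chi>\<close>.\<close>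

lemma cinner_conj_by:
  assumes x: "x \<in> carrier G" and \<chi>: "class_function G \<chi>"
  shows "cinner (G\<lparr>carrier := K\<rparr>) \<chi> (conj_by x \<theta>) = cinner (G\<lparr>carrier := K\<rparr>) \<chi> \<theta>"
proof -
  have "(\<Sum>k\<in>K. \<chi> k * conj_by x \<theta> (inv k)) = (\<Sum>k\<in>K. \<chi> k * \<theta> (inv k))"
  proof (rule sum.reindex_bij_witness[where i = "\<lambda>k. inv x \<otimes> k \<otimes> x" and j = "\<lambda>k. x \<otimes> k \<otimes> inv x"])
    fix k assume k: "k \<in> K"
    then have kG: "k \<in> carrier G" using K_carrier by blast
    show "inv x \<otimes> (x \<otimes> k \<otimes> inv x) \<otimes> x = k" using conj_inv_cancel[OF x kG] .
    show "x \<otimes> (inv x \<otimes> k \<otimes> x) \<otimes> inv x = k" using conj_inv_cancel[of "inv x" k] x kG by simp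
    show "inv x \<otimes> k \<otimes> x \<in> K" using K_conj[of "inv x" k] k x by simp
    show "x \<otimes> k \<otimes> inv x \<in> K" using K_conj[OF x k] .
    have "\<chi> (x \<otimes> k \<otimes> inv x) = \<chi> k" using \<chi> x kG by (simp add: class_function_def)
    then show "\<chi> (x \<otimes> k \<otimes> inv x) * \<theta> (inv (x \<otimes> k \<otimes> inv x)) = \<chi> k * conj_by x \<theta> (inv k)"
      using k K_inv[OF k] inv_conj[OF x kG] by (simp add: conj_by_def)
  qed
  then show ?thesis by (simp add: cinner_subgroup[OF K_subgroup])
qed

lemma induced_K_eq:
  "k \<in> K \<Longrightarrow> induced_character G K \<theta> k = (\<Sum>x\<in>carrier G. conj_by x \<theta> k) / of_nat (card K)"
  using K_carrier by (auto simp: induced_character_def conj_by_def)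

text \<open>The element \<open>\<Sum>k\<in>K. \<alpha> (inv k) k\<close> of the group algebra is central, hence acts as a scalar.\<close>

lemma class_function_acts_as_scalar:
  assumes \<chi>: "\<chi> \<in> Irr G" and \<alpha>: "class_function G \<alpha>"
  obtains c where "\<And>y. y \<in> carrier G \<Longrightarrow> (\<Sum>k\<in>K. \<alpha> (inv k) * \<chi> (k \<otimes> y)) = c * \<chi> y"
proof -
  obtain n \<rho> where \<rho>: "irreducible_rep G n \<rho>" "\<chi> = rep_character G \<rho>" using \<chi> by (auto simp: Irr_def)
  have rep: "is_rep G n \<rho>" using \<rho> by (simp add: irreducible_rep_def)
  have c: "\<rho> g \<in> carrier_mat n n" if "g \<in> carrier G" for g using rep that by (simp add: is_rep_iff)
  have cK: "\<rho> k \<in> carrier_mat n n" if "k \<in> K" for k using c K_carrier that by blast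
  have mult: "\<rho> (g \<otimes> h) = \<rho> g * \<rho> h" if "g \<in> carrier G" "h \<in> carrier G" for g h
    using rep that by (simp add: is_rep_iff)
  define T where "T = msum n n (\<lambda>k. \<alpha> (inv k) \<cdot>\<^sub>m \<rho> k) K"
  have Tg: "T * \<rho> g = msum n n (\<lambda>k. \<alpha> (inv k) \<cdot>\<^sub>m \<rho> (k \<otimes> g)) K" if g: "g \<in> carrier G" for g
  proof -
    have "T * \<rho> g = msum n n (\<lambda>k. (\<alpha> (inv k) \<cdot>\<^sub>m \<rho> k) * \<rho> g) K"
      unfolding T_def using c[OF g] cK by (intro msum_mult) auto
    also have "\<dots> = msum n n (\<lambda>k. \<alpha> (inv k) \<cdot>\<^sub>m \<rho> (k \<otimes> g)) K"
      using mult[OF _ g] K_carrier cK c[OF g] by (intro msum_cong) (auto simp: mult_smult_assoc_mat[of _ n n _ n])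
    finally show ?thesis .
  qed
  have "\<rho> g * T = T * \<rho> g" if g: "g \<in> carrier G" for g
  proof -
    have "\<rho> g * T = msum n n (\<lambda>k. \<rho> g * (\<alpha> (inv k) \<cdot>\<^sub>m \<rho> k)) K"
      unfolding T_def using c[OF g] cK by (intro mult_msum) auto
    also have "\<dots> = msum n n (\<lambda>k. \<alpha> (inv k) \<cdot>\<^sub>m \<rho> (g \<otimes> k)) K"
      using mult[OF g] K_carrier cK c[OF g] by (intro msum_cong) (auto simp: mult_smult_distrib[of _ n n _ n])
    also have "\<dots> = msum n n (\<lambda>k. \<alpha> (inv k) \<cdot>\<^sub>m \<rho> (k \<otimes> g)) K"
      unfolding msum_def
    proof (rule arg_cong[where f = "mat n n"], rule ext)
      fix ij
      show "(\<Sum>k\<in>K. (\<alpha> (inv k) \<cdot>\<^sub>m \<rho> (g \<otimes> k)) $$ ij) = (\<Sum>k\<in>K. (\<alpha> (inv k) \<cdot>\<^sub>m \<rho> (k \<otimes> g)) $$ ij)"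
      proof (rule sum.reindex_bij_witness[where i = "\<lambda>k. inv g \<otimes> k \<otimes> g" and j = "\<lambda>k. g \<otimes> k \<otimes> inv g"])
        fix k assume k: "k \<in> K"
        then have kG: "k \<in> carrier G" using K_carrier by blast
        show "inv g \<otimes> (g \<otimes> k \<otimes> inv g) \<otimes> g = k" using conj_inv_cancel[OF g kG] .
        show "g \<otimes> (inv g \<otimes> k \<otimes> g) \<otimes> inv g = k" using conj_inv_cancel[of "inv g" k] g kG by simp
        show "inv g \<otimes> k \<otimes> g \<in> K" using K_conj[of "inv g" k] k g by simp
        show "g \<otimes> k \<otimes> inv g \<in> K" using K_conj[OF g k] .
        have "\<alpha> (inv (g \<otimes> k \<otimes> inv g)) = \<alpha> (inv k)"
          using \<alpha> g kG by (simp add: inv_conj class_function_def)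
        moreover have "(g \<otimes> k \<otimes> inv g) \<otimes> g = g \<otimes> k" using g kG by (simp add: m_assoc)
        ultimately show "(\<alpha> (inv (g \<otimes> k \<otimes> inv g)) \<cdot>\<^sub>m \<rho> ((g \<otimes> k \<otimes> inv g) \<otimes> g)) $$ ij = (\<alpha> (inv k) \<cdot>\<^sub>m \<rho> (g \<otimes> k)) $$ ij"
          by simp
      qed
    qed
    finally show ?thesis using Tg[OF g] by simp
  qed
  then obtain t where t: "T = t \<cdot>\<^sub>m 1\<^sub>m n" using schur_scalar[OF \<rho>(1), of T] by (auto simp: T_def)
  show ?thesis
  proof
    fix y assume y: "y \<in> carrier G"
    have ky: "k \<otimes> y \<in> carrier G" if "k \<in> K" for k using that y K_carrier by blast
    have "mat_trace (T * \<rho> y) = (\<Sum>k\<in>K. mat_trace (\<alpha> (inv k) \<cdot>\<^sub>m \<rho> (k \<otimes> y)))"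
      unfolding Tg[OF y] using c ky by (intro mat_trace_msum) auto
    also have "\<dots> = (\<Sum>k\<in>K. \<alpha> (inv k) * \<chi> (k \<otimes> y))"
      using c ky by (intro sum.cong) (auto simp: mat_trace_smult[of _ n] \<rho>(2) rep_character_def)
    also have "mat_trace (T * \<rho> y) = t * \<chi> y"
      using c[OF y] y by (simp add: t mult_smult_assoc_mat[of _ n n _ n] mat_trace_smult[of _ n] \<rho>(2) rep_character_def)
    finally show "(\<Sum>k\<in>K. \<alpha> (inv k) * \<chi> (k \<otimes> y)) = t * \<chi> y" by simp
  qed
qed

text \<open>The inertia group contains \<open>K\<close>, because \<open>\<theta>\<close> is a class
  function on \<open>K\<close>, and the index of \<open>K\<close> is prime.\<close>

lemma inertia_card:
  assumes \<theta>: "class_function (G\<lparr>carrier := K\<rparr>) \<theta>" "\<And>g. g \<notin> K \<Longrightarrow> \<theta> g = 0"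
  shows "card {x \<in> carrier G. conj_by x \<theta> = \<theta>} = card K \<or> card {x \<in> carrier G. conj_by x \<theta> = \<theta>} = card (carrier G)"
    (is "card ?T = _ \<or> _")
proof (rule intermediate_subgroup)
  have mem: "x \<in> ?T \<longleftrightarrow> x \<in> carrier G \<and> (\<forall>k\<in>K. \<theta> (x \<otimes> k \<otimes> inv x) = \<theta> k)" for x
    using \<theta>(2) by (auto simp: conj_by_def fun_eq_iff)
  show "K \<subseteq> ?T"
    unfolding subset_iff mem
    using \<theta>(1) K_carrier m_inv_consistent[OF K_subgroup] by (auto simp: class_function_def)
  show "subgroup ?T G"
  proof (rule subgroupI)
    show "?T \<subseteq> carrier G" by auto
    have "\<one> \<in> ?T" unfolding mem using K_carrier by auto
    then show "?T \<noteq> {}" by blast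
    show "inv x \<in> ?T" if "x \<in> ?T" for x
      unfolding mem
    proof (intro conjI ballI)
      have x: "x \<in> carrier G" "\<And>k. k \<in> K \<Longrightarrow> \<theta> (x \<otimes> k \<otimes> inv x) = \<theta> k" using that unfolding mem by auto
      then show "inv x \<in> carrier G" by simp
      fix k assume k: "k \<in> K"
      have "inv x \<otimes> k \<otimes> x \<in> K" using K_conj[of "inv x" k] k x by simp
      moreover have "x \<otimes> (inv x \<otimes> k \<otimes> x) \<otimes> inv x = k"
        using conj_inv_cancel[of "inv x" k] x k K_carrier by auto
      ultimately show "\<theta> (inv x \<otimes> k \<otimes> inv (inv x)) = \<theta> k" using x(2)[of "inv x \<otimes> k \<otimes> x"] x(1) by simp
    qed
    show "x \<otimes> y \<in> ?T" if "x \<in> ?T" "y \<in> ?T" for x y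
      unfolding mem
    proof (intro conjI ballI)
      have x: "x \<in> carrier G" "\<And>k. k \<in> K \<Longrightarrow> \<theta> (x \<otimes> k \<otimes> inv x) = \<theta> k" using that(1) unfolding mem by auto
      have y: "y \<in> carrier G" "\<And>k. k \<in> K \<Longrightarrow> \<theta> (y \<otimes> k \<otimes> inv y) = \<theta> k" using that(2) unfolding mem by auto
      show "x \<otimes> y \<in> carrier G" using x y by simp
      fix k assume k: "k \<in> K"
      then show "\<theta> (x \<otimes> y \<otimes> k \<otimes> inv (x \<otimes> y)) = \<theta> k"
        using x(2)[OF K_conj[OF y(1) k]] y(2)[OF k] conj_conj[OF x(1) y(1), of k] K_carrier by auto
    qed
  qed
qed

text \<open>Convolve \<open>\<chi>\<close> over \<open>K\<close> with the induced character
  \<open>\<Theta>\<close>. Centrality gives a multiple of \<open>\<chi>\<close>; summing over the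
  conjugates of \<open>\<theta>\<close>, all of multiplicity \<open>m\<close>, gives a multiple of
  \<open>\<Theta>\<close>. Both functions vanish off \<open>K\<close>, hence they are proportional.
  Comparing norms then leaves \<open>m = 1\<close> and factor 1.\<close>

lemma induced_eq_of_constituent:
  assumes \<theta>: "\<theta> \<in> Irr (G\<lparr>carrier := K\<rparr>)" and \<chi>: "\<chi> \<in> Irr G" and \<chi>_off: "\<And>g. g \<notin> K \<Longrightarrow> \<chi> g = 0"
    and nz: "cinner (G\<lparr>carrier := K\<rparr>) \<chi> \<theta> \<noteq> 0"
  shows "induced_character G K \<theta> = \<chi>"
proof -
  interpret K: group "G\<lparr>carrier := K\<rparr>" by (rule group_K)
  have finK: "finite (carrier (G\<lparr>carrier := K\<rparr>))" using K_finite by simp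
  have \<theta>_ch: "is_character (G\<lparr>carrier := K\<rparr>) \<theta>" and \<chi>_ch: "is_character G \<chi>"
    using \<theta> \<chi> by (simp_all add: is_character_if_irr)
  have \<theta>_off: "\<theta> g = 0" if "g \<notin> K" for g using character_outside[OF \<theta>_ch] that by simp
  have \<chi>_cf: "class_function G \<chi>" using class_function_character[OF \<chi>_ch] .
  define \<Theta> where "\<Theta> = induced_character G K \<theta>"
  have \<Theta>_off: "\<Theta> g = 0" if "g \<notin> K" for g unfolding \<Theta>_def using induced_vanishes_off_K \<theta>_off that by blast
  have \<Theta>_cf: "class_function G \<Theta>" unfolding \<Theta>_def by (rule class_function_induced)
  obtain m :: nat where m: "cinner (G\<lparr>carrier := K\<rparr>) (restrict_to K \<chi>) \<theta> = of_nat m"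
    using K.cinner_characters_nat[OF finK is_character_restrict[OF \<chi>_ch K_subgroup] \<theta>_ch] by blast
  have m': "cinner (G\<lparr>carrier := K\<rparr>) \<chi> \<theta> = of_nat m"
    using m by (simp add: cinner_subgroup[OF K_subgroup] restrict_to_def)
  then have m_pos: "m > 0" using nz by (cases m) auto
  obtain \<psi>s where \<psi>s: "set \<psi>s \<subseteq> Irr (G\<lparr>carrier := K\<rparr>)" "restrict_to K \<chi> = (\<lambda>g. \<Sum>\<psi>\<leftarrow>\<psi>s. \<psi> g)"
    using K.character_decomposition_list[OF is_character_restrict[OF \<chi>_ch K_subgroup]] by blast
  have \<chi>_eq: "\<chi> k = (\<Sum>\<psi>\<leftarrow>\<psi>s. \<psi> k)" if "k \<in> K" for k
    using fun_cong[OF \<psi>s(2), of k] that by (simp add: restrict_to_def)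
  obtain c where c: "\<And>y. y \<in> carrier G \<Longrightarrow> (\<Sum>k\<in>K. \<Theta> (inv k) * \<chi> (k \<otimes> y)) = c * \<chi> y"
    using class_function_acts_as_scalar[OF \<chi> \<Theta>_cf] by blast
  \<comment> \<open>The constant of \<open>irr_convolution\<close> over \<open>K\<close>; it serves
    every conjugate of \<open>\<theta>\<close>, since conjugates have equal degree.\<close>
  define q where "q = of_nat (card K) / \<theta> \<one>"
  have conv: "(\<Sum>k\<in>K. conj_by x \<theta> (inv k) * \<chi> (k \<otimes> y)) = of_nat m * q * conj_by x \<theta> y"
    if x: "x \<in> carrier G" and y: "y \<in> K" for x y
  proof -
    have irr: "conj_by x \<theta> \<in> Irr (G\<lparr>carrier := K\<rparr>)" using conj_by_irr[OF \<theta> x] .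
    have one: "conj_by x \<theta> \<one> = \<theta> \<one>" using x subgroup.one_closed[OF K_subgroup] by (simp add: conj_by_def)
    have cv: "(\<Sum>k\<in>K. conj_by x \<theta> (inv k) * \<psi> (k \<otimes> y)) = (if conj_by x \<theta> = \<psi> then q * conj_by x \<theta> y else 0)"
      if "\<psi> \<in> Irr (G\<lparr>carrier := K\<rparr>)" for \<psi>
      using K.irr_convolution[OF finK irr that, of y] y m_inv_consistent[OF K_subgroup] one
      by (auto simp: q_def)
    have "(\<Sum>k\<in>K. conj_by x \<theta> (inv k) * \<chi> (k \<otimes> y)) = (\<Sum>k\<in>K. conj_by x \<theta> (inv k) * (\<Sum>\<psi>\<leftarrow>\<psi>s. \<psi> (k \<otimes> y)))"
      using y subgroup.m_closed[OF K_subgroup] by (intro sum.cong) (auto simp: \<chi>_eq)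
    also have "\<dots> = (\<Sum>\<psi>\<leftarrow>\<psi>s. \<Sum>k\<in>K. conj_by x \<theta> (inv k) * \<psi> (k \<otimes> y))"
      by (induction \<psi>s) (simp_all add: algebra_simps sum.distrib)
    also have "\<dots> = (\<Sum>\<psi>\<leftarrow>\<psi>s. if conj_by x \<theta> = \<psi> then q * conj_by x \<theta> y else 0)"
      using \<psi>s(1) cv by (intro arg_cong[where f = sum_list] map_cong) auto
    also have "\<dots> = of_nat (count_list \<psi>s (conj_by x \<theta>)) * (q * conj_by x \<theta> y)"
      by (induction \<psi>s) (auto simp: algebra_simps)
    also have "of_nat (count_list \<psi>s (conj_by x \<theta>)) = cinner (G\<lparr>carrier := K\<rparr>) (restrict_to K \<chi>) (conj_by x \<theta>)"
      unfolding \<psi>s(2) using K.cinner_irr_list[OF finK \<psi>s(1) irr] by simp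
    also have "\<dots> = cinner (G\<lparr>carrier := K\<rparr>) \<chi> (conj_by x \<theta>)"
      by (simp add: cinner_subgroup[OF K_subgroup] restrict_to_def)
    also have "\<dots> = of_nat m" using cinner_conj_by[OF x \<chi>_cf] m' by simp
    finally show ?thesis by simp
  qed
  have scalar: "c * \<chi> y = of_nat m * q * \<Theta> y" if y: "y \<in> K" for y
  proof -
    have "c * \<chi> y = (\<Sum>k\<in>K. \<Theta> (inv k) * \<chi> (k \<otimes> y))" using c[of y] y K_carrier by auto
    also have "\<dots> = (\<Sum>k\<in>K. \<Sum>x\<in>carrier G. conj_by x \<theta> (inv k) * \<chi> (k \<otimes> y)) / of_nat (card K)"
      by (simp add: \<Theta>_def induced_K_eq K_inv sum_divide_distrib sum_distrib_right)
    also have "\<dots> = (\<Sum>x\<in>carrier G. of_nat m * q * conj_by x \<theta> y) / of_nat (card K)"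
      by (subst sum.swap) (simp add: conv y)
    also have "\<dots> = of_nat m * q * \<Theta> y"
      using y by (simp add: \<Theta>_def induced_K_eq sum_distrib_left[symmetric])
    finally show ?thesis .
  qed
  \<comment> \<open>At the identity the multiple of \<open>\<Theta>\<close> in \<open>scalar\<close>
    is nonzero, which forces \<open>c\<close> to be nonzero and allows division by it.\<close>
  obtain d where d: "d > 0" "\<theta> \<one> = of_nat d" using K.irr_degree[OF \<theta>] by auto
  have "\<Theta> \<one> * of_nat (card K) = of_nat (card (carrier G)) * \<theta> \<one>"
    unfolding \<Theta>_def by (rule induced_character_one[OF group_axioms finite_carrier K_subgroup])
  then have "\<Theta> \<one> \<noteq> 0" using d card_carrier_pos[OF finite_carrier] by auto
  moreover have "q \<noteq> 0" using d card_K_pos by (simp add: q_def)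
  ultimately have "c \<noteq> 0" using scalar[OF subgroup.one_closed[OF K_subgroup]] m_pos by auto
  define e where "e = of_nat m * q / c"
  have \<chi>_scaled: "\<chi> y = e * \<Theta> y" for y
    using scalar[of y] \<chi>_off[of y] \<Theta>_off[of y] \<open>c \<noteq> 0\<close> by (cases "y \<in> K") (auto simp: e_def field_simps)
  have self: "cinner G \<chi> \<chi> = 1" using cinner_irr[OF finite_carrier \<chi> \<chi>] by simp
  have \<Theta>_frob: "cinner G \<Theta> \<beta> = cinner (G\<lparr>carrier := K\<rparr>) \<theta> \<beta>" if "class_function G \<beta>" for \<beta>
    unfolding \<Theta>_def by (rule frobenius_reciprocity[OF finite_carrier K_subgroup _ that]) (rule \<theta>_off)
  have "cinner G \<chi> \<chi> = e * cinner G \<Theta> \<chi>"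
    using \<chi>_scaled by (subst cinner_def, subst \<chi>_scaled) (simp add: cinner_def sum_distrib_left mult.assoc)
  also have "cinner G \<Theta> \<chi> = of_nat m" using \<Theta>_frob[OF \<chi>_cf] m' K.cinner_commute by simp
  finally have em: "e * of_nat m = 1" using self by simp
  \<comment> \<open>The norm of \<open>\<Theta>\<close> is the index of \<open>K\<close> in the
    inertia group \<open>?T\<close>, as only conjugates equal to \<open>\<theta>\<close> have
    nonzero inner product with it. Together with \<open>e * m = 1\<close> this yields
    \<open>m * m * card K = card ?T\<close>.\<close>
  let ?T = "{x \<in> carrier G. conj_by x \<theta> = \<theta>}"
  have "cinner G \<Theta> \<chi> = e * cinner G \<Theta> \<Theta>"
    by (simp add: cinner_def \<chi>_scaled sum_distrib_left mult_ac)
  then have "of_nat m = e * cinner G \<Theta> \<Theta>" using \<Theta>_frob[OF \<chi>_cf] m' K.cinner_commute by simp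
  moreover have "cinner G \<Theta> \<Theta> * of_nat (card K) = of_nat (card ?T)"
  proof -
    have "cinner G \<Theta> \<Theta> = (\<Sum>k\<in>K. \<Theta> k * \<theta> (inv k)) / of_nat (card K)"
      using \<Theta>_frob[OF \<Theta>_cf] K.cinner_commute[of \<theta> \<Theta>] by (simp add: cinner_subgroup[OF K_subgroup])
    also have "(\<Sum>k\<in>K. \<Theta> k * \<theta> (inv k)) = (\<Sum>k\<in>K. \<Sum>x\<in>carrier G. conj_by x \<theta> k * \<theta> (inv k)) / of_nat (card K)"
      by (simp add: \<Theta>_def induced_K_eq sum_divide_distrib sum_distrib_right)
    also have "\<dots> = (\<Sum>x\<in>carrier G. cinner (G\<lparr>carrier := K\<rparr>) (conj_by x \<theta>) \<theta>)"
      by (subst sum.swap) (simp add: cinner_subgroup[OF K_subgroup] sum_divide_distrib)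
    also have "\<dots> = (\<Sum>x\<in>carrier G. if conj_by x \<theta> = \<theta> then 1 else 0)"
      using K.cinner_irr[OF finK conj_by_irr[OF \<theta>] \<theta>] by (intro sum.cong) auto
    also have "\<dots> = of_nat (card ?T)"
      using finite_carrier by (simp add: sum.If_cases Int_def)
    finally show ?thesis using card_K_pos by simp
  qed
  ultimately have "of_nat m * of_nat m * of_nat (card K) = (of_nat m * e) * (of_nat (card ?T) :: complex)"
    by (metis mult.assoc mult.left_commute)
  then have "of_nat (m * m * card K) = (of_nat (card ?T) :: complex)" using em by (simp add: mult.commute)
  then have mm: "m * m * card K = card ?T" using of_nat_eq_iff by blast
  \<comment> \<open>An inertia group equal to \<open>G\<close> would give \<open>m * m = p\<close>,
    but a prime is not a square.\<close>
  have "card ?T \<noteq> card (carrier G)"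
  proof
    assume "card ?T = card (carrier G)"
    then have "m * m = p" using mm card_K card_K_pos by (metis mult_right_cancel neq0_conv)
    then show False using prime prime_product[of m m] by auto
  qed
  then have "card ?T = card K"
    using inertia_card[OF K.class_function_character[OF \<theta>_ch] \<theta>_off] by blast
  then have "m = 1" using mm card_K_pos by simp
  then have "e = 1" using em by simp
  then show ?thesis using \<chi>_scaled by (auto simp: \<Theta>_def)
qed

end

section \<open>Normal subgroups of M-groups\<close>

text \<open>The regular character, taken as the permutation character on the cosets of the trivial
  subgroup, vanishes except at the identity. Its inner product with \<open>\<theta>\<close> over
  \<open>H\<close> is therefore nonzero, and so is that of some constituent.\<close>

lemma (in group) irr_constituent_above:
  assumes fin: "finite (carrier G)" and H: "subgroup H G" and \<theta>: "\<theta> \<in> Irr (G\<lparr>carrier := H\<rparr>)"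
  obtains \<chi> where "\<chi> \<in> Irr G" "cinner (G\<lparr>carrier := H\<rparr>) \<chi> \<theta> \<noteq> 0"
proof -
  interpret H: group "G\<lparr>carrier := H\<rparr>" using subgroup_imp_group[OF H] .
  have HG: "H \<subseteq> carrier G" using H by (rule subgroup.subset)
  have finH: "finite H" using fin HG by (rule rev_finite_subset)
  let ?r = "induced_character G {\<one>} (\<lambda>g. if g \<in> {\<one>} then 1 else 0)"
  obtain n \<rho> where \<rho>: "is_rep G n \<rho>" "rep_character G \<rho> = ?r"
    by (rule permutation_rep[OF fin triv_subgroup])
  obtain \<psi>s where \<psi>s: "set \<psi>s \<subseteq> Irr G" "?r = (\<lambda>g. \<Sum>\<psi>\<leftarrow>\<psi>s. \<psi> g)"
    using character_decomposition_list[of ?r] \<rho> by (metis is_character_def)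
  have r: "?r h = (if h = \<one> then of_nat (card (carrier G)) else 0)" if h: "h \<in> carrier G" for h
  proof -
    have "x \<otimes> h \<otimes> inv x = \<one> \<longleftrightarrow> h = \<one>" if "x \<in> carrier G" for x
      using conj_inv_cancel[OF that h] that h by (metis inv_closed l_inv r_inv r_one)
    then show ?thesis using h by (simp add: induced_character_def)
  qed
  obtain d where d: "d > 0" "\<theta> \<one> = of_nat d" using H.irr_degree[OF \<theta>] by auto
  have "(\<Sum>h\<in>H. ?r h * \<theta> (inv h)) = (\<Sum>h\<in>H. if h = \<one> then of_nat (card (carrier G)) * \<theta> \<one> else 0)"
  proof (rule sum.cong[OF refl])
    fix h assume h: "h \<in> H"
    show "?r h * \<theta> (inv h) = (if h = \<one> then of_nat (card (carrier G)) * \<theta> \<one> else 0)"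
      unfolding r[OF subsetD[OF HG h]] by simp
  qed
  also have "\<dots> = of_nat (card (carrier G)) * \<theta> \<one>"
    using finH subgroup.one_closed[OF H] by simp
  finally have "cinner (G\<lparr>carrier := H\<rparr>) ?r \<theta> \<noteq> 0"
    using d card_carrier_pos[OF fin] card_subgroup_pos[OF fin H] by (simp add: cinner_subgroup[OF H])
  then have nz: "(\<Sum>\<psi>\<leftarrow>\<psi>s. cinner (G\<lparr>carrier := H\<rparr>) \<psi> \<theta>) \<noteq> 0"
    unfolding \<psi>s(2) cinner_sum_list_left .
  have zero: "(\<Sum>\<psi>\<leftarrow>\<psi>s. f \<psi>) = 0" if "\<forall>\<psi>\<in>set \<psi>s. f \<psi> = (0 :: complex)" for f
    using that by (induction \<psi>s) auto
  obtain \<psi> where "\<psi> \<in> set \<psi>s" "cinner (G\<lparr>carrier := H\<rparr>) \<psi> \<theta> \<noteq> 0"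
    using nz zero[of "\<lambda>\<psi>. cinner (G\<lparr>carrier := H\<rparr>) \<psi> \<theta>"] by blast
  then show ?thesis using that \<psi>s(1) by blast
qed

lemma (in prime_order_character) M_group_K:
  assumes M: "M_group G" and super: "super_M_group G"
  shows "M_group (G\<lparr>carrier := K\<rparr>)"
  unfolding M_group_def
proof (intro conjI ballI)
  interpret K: group "G\<lparr>carrier := K\<rparr>" by (rule group_K)
  show "group (G\<lparr>carrier := K\<rparr>)" by (rule group_K)
  show finK: "finite (carrier (G\<lparr>carrier := K\<rparr>))" using K_finite by simp
  fix \<theta> assume \<theta>: "\<theta> \<in> Irr (G\<lparr>carrier := K\<rparr>)"
  obtain \<chi> where \<chi>: "\<chi> \<in> Irr G" and nz: "cinner (G\<lparr>carrier := K\<rparr>) \<chi> \<theta> \<noteq> 0"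
    using irr_constituent_above[OF finite_carrier K_subgroup \<theta>] by blast
  have \<chi>_ch: "is_character G \<chi>" using \<chi> by (rule is_character_if_irr)
  show "monomial_character (G\<lparr>carrier := K\<rparr>) \<theta>"
  proof (cases "\<exists>i. 0 < i \<and> i < p \<and> (\<lambda>g. \<nu> g ^ i * \<chi> g) = \<chi>")
    case True
    then have "\<chi> g = 0" if "g \<notin> K" for g
      using twist_vanishes_off_K character_outside[OF \<chi>_ch] that by blast
    then have ind: "induced_character G K \<theta> = \<chi>" using induced_eq_of_constituent[OF \<theta> \<chi> _ nz] by blast
    obtain H \<phi> where H: "subgroup H (G\<lparr>carrier := K\<rparr>)" and \<phi>: "primitive_character (G\<lparr>carrier := K, carrier := H\<rparr>) \<phi>"
      and ind': "induced_character (G\<lparr>carrier := K\<rparr>) H \<phi> = \<theta>"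
      using K.induced_from_primitive[OF finK \<theta>] by blast
    have "\<phi> \<in> Irr (G\<lparr>carrier := K, carrier := H\<rparr>)" using \<phi> by (simp add: primitive_character_def)
    then have "\<phi> g = 0" if "g \<notin> H" for g
      using character_outside[OF is_character_if_irr, of \<phi> _ g] that by fastforce
    then have "induced_character G H \<phi> = \<chi>"
      using induced_character_trans[OF finite_carrier K_subgroup H, of \<phi>] ind ind' by simp
    moreover have "super_monomial G \<chi>" using super \<chi> by (simp add: super_M_group_def)
    moreover have "subgroup H G" using incl_subgroup[OF K_subgroup H] .
    ultimately have "linear_character (G\<lparr>carrier := K, carrier := H\<rparr>) \<phi>"
      using \<phi> by (auto simp: super_monomial_def)
    then show ?thesis using H ind' by (auto simp: monomial_character_def)
  next
    case False
    then have one: "cinner (G\<lparr>carrier := K\<rparr>) \<chi> \<chi> = 1" using restriction_irr[OF \<chi>] by blast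
    have res: "cinner (G\<lparr>carrier := K\<rparr>) (restrict_to K \<chi>) (restrict_to K \<chi>) = 1"
      "cinner (G\<lparr>carrier := K\<rparr>) (restrict_to K \<chi>) \<theta> \<noteq> 0"
      using one nz K_inv by (simp_all add: cinner_subgroup[OF K_subgroup] restrict_to_def)
    have "restrict_to K \<chi> \<in> Irr (G\<lparr>carrier := K\<rparr>)"
      using K.irr_if_cinner_one[OF finK is_character_restrict[OF \<chi>_ch K_subgroup] res(1)] .
    then have \<theta>_eq: "\<theta> = restrict_to K \<chi>" using K.cinner_irr[OF finK _ \<theta>] res(2) by metis
    obtain U \<mu> where U: "subgroup U G" and \<mu>: "linear_character (G\<lparr>carrier := U\<rparr>) \<mu>" and ind: "induced_character G U \<mu> = \<chi>"
      using M \<chi> by (auto simp: M_group_def monomial_character_def)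
    \<comment> \<open>If \<open>U\<close> were inside \<open>K\<close>, then \<open>\<chi>\<close>
      would vanish off the normal subgroup \<open>K\<close>, and its norm over \<open>K\<close>
      would be \<open>p\<close> times its norm over \<open>G\<close>, against
      \<open>one\<close>.\<close>
    have "\<not> U \<subseteq> K"
    proof
      assume "U \<subseteq> K"
      then have "\<mu> g = 0" if "g \<notin> K" for g
        using that \<mu> character_outside[of "G\<lparr>carrier := U\<rparr>" \<mu>] by (auto simp: linear_character_def)
      then have "\<chi> g = 0" if "g \<notin> K" for g using induced_vanishes_off_K[of \<mu> g U] that ind by simp
      then have "1 = of_nat p * cinner G \<chi> \<chi>" using cinner_vanishing_off_K[of \<chi> \<chi>] one by simp
      then have "of_nat p = (1 :: complex)" using cinner_irr[OF finite_carrier \<chi> \<chi>] by simp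
      then show False using prime of_nat_eq_1_iff by (metis not_prime_1)
    qed
    then show ?thesis using monomial_restriction[OF U _ \<mu>] ind \<theta>_eq by simp
  qed
qed

text \<open>The conjecture is formulated for groups on \<open>nat\<close>. The induction can run
  inside that type because passing from \<open>G\<close> to \<open>K\<close> changes only the
  carrier.\<close>

lemma M_group_normal_nat:
  fixes G :: "nat monoid"
  assumes conj: Isaacs_conjecture
  shows "M_group G \<Longrightarrow> odd (card (carrier G)) \<Longrightarrow> N \<lhd> G \<Longrightarrow> M_group (G\<lparr>carrier := N\<rparr>)"
proof (induction "card (carrier G)" arbitrary: G rule: less_induct)
  case less
  interpret G: group G using less.prems(1) by (simp add: M_group_def)
  have fin: "finite (carrier G)" using less.prems(1) by (simp add: M_group_def)
  have N: "subgroup N G" "\<And>x n. x \<in> carrier G \<Longrightarrow> n \<in> N \<Longrightarrow> x \<otimes>\<^bsub>G\<^esub> n \<otimes>\<^bsub>G\<^esub> inv\<^bsub>G\<^esub> x \<in> N"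
    using less.prems(3) by (simp_all add: G.normal_inv_iff)
  show ?case
  proof (cases "N = carrier G")
    case True
    then show ?thesis using less.prems(1) by simp
  next
    case False
    obtain \<nu>0 where \<nu>0: "linear_character G \<nu>0" "\<nu>0 \<noteq> trivial_character G" "\<forall>n\<in>N. \<nu>0 n = 1"
      by (rule G.M_group_linear_character[OF less.prems(1) N(1) False N(2)])
    obtain p \<nu> where \<nu>: "prime (p :: nat)" "linear_character G \<nu>" "\<nu> \<noteq> trivial_character G"
      "\<forall>g\<in>carrier G. \<nu> g ^ p = 1" "\<forall>g\<in>carrier G. \<nu>0 g = 1 \<longrightarrow> \<nu> g = 1"
      by (rule G.linear_character_prime_order[OF fin \<nu>0(1,2)])
    interpret prime_order_character G \<nu> p
      using \<nu> fin by unfold_locales auto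
    have NK: "N \<subseteq> K" using \<nu>(5) \<nu>0(3) subgroup.subset[OF N(1)] by (auto simp: K_def)
    have "super_M_group G" using conj less.prems by (simp add: Isaacs_conjecture_def Coset.order_def)
    then have MK: "M_group (G\<lparr>carrier := K\<rparr>)" using M_group_K[OF less.prems(1)] by blast
    have "odd (card K)" using less.prems(2) card_K[symmetric] by simp
    moreover have "card K < card (carrier G)"
      unfolding card_K[symmetric] using card_K_pos prime_gt_1_nat[OF \<nu>(1)] by simp
    moreover have "N \<lhd> G\<lparr>carrier := K\<rparr>"
      using G.normal_Int_subgroup[OF K_subgroup less.prems(3)] NK by (simp add: Int_absorb2 Int_absorb1 Int_commute)
    ultimately have "M_group (G\<lparr>carrier := K, carrier := N\<rparr>)"
      using less.hyps[of "G\<lparr>carrier := K\<rparr>"] MK by simp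
    then show ?thesis by simp
  qed
qed

section \<open>Transport along isomorphisms and the general theorem\<close>

lemma irreducible_rep_iso:
  assumes G: "group G" and H: "group H" and h: "h \<in> iso G H" and \<rho>: "irreducible_rep H n \<rho>"
  shows "irreducible_rep G n (\<rho> \<circ> h)"
proof -
  interpret G: group G by fact
  interpret H: group H by fact
  interpret h: group_hom G H h using h by unfold_locales (simp add: iso_def)
  have surj: "h ` carrier G = carrier H" using h by (simp add: iso_def bij_betw_def)
  have "is_rep G n (\<rho> \<circ> h)" using \<rho> by (simp add: irreducible_rep_def G.is_rep_iff H.is_rep_iff)
  then show ?thesis using \<rho> by (simp add: irreducible_rep_def surj[symmetric])
qed

text \<open>Representations are pulled back along \<open>h\<close>, while the subgroup and its
  linear character are pushed forward. It serves in both directions: from \<open>G\<close> to its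
  copy on \<open>nat\<close>, and from the image of \<open>N\<close> back to
  \<open>N\<close>.\<close>

lemma M_group_iso:
  assumes M: "M_group G" and H: "group H" and h: "h \<in> iso G H"
  shows "M_group H"
  unfolding M_group_def
proof (intro conjI ballI)
  interpret G: group G using M by (simp add: M_group_def)
  interpret H: group H by fact
  interpret h: group_hom G H h using h by unfold_locales (simp add: iso_def)
  have bij: "bij_betw h (carrier G) (carrier H)" using h by (simp add: iso_def)
  have surj: "h ` carrier G = carrier H" and inj: "inj_on h (carrier G)" using bij by (simp_all add: bij_betw_def)
  show "group H" by fact
  show "finite (carrier H)" using M surj by (metis M_group_def finite_imageI)
  fix \<chi> assume "\<chi> \<in> Irr H"
  then obtain n \<rho> where \<rho>: "irreducible_rep H n \<rho>" "\<chi> = rep_character H \<rho>" by (auto simp: Irr_def)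
  have "rep_character G (\<rho> \<circ> h) \<in> Irr G"
    using irreducible_rep_iso[OF G.is_group H h \<rho>(1)] by (auto simp: Irr_def)
  then obtain U \<mu> where U: "subgroup U G" and \<mu>: "linear_character (G\<lparr>carrier := U\<rparr>) \<mu>"
    and ind: "induced_character G U \<mu> = rep_character G (\<rho> \<circ> h)"
    using M by (metis M_group_def monomial_character_def)
  interpret U: group "G\<lparr>carrier := U\<rparr>" using G.subgroup_imp_group[OF U] .
  have UG: "U \<subseteq> carrier G" using U by (rule subgroup.subset)
  define V where "V = h ` U"
  have V: "subgroup V H" unfolding V_def using h.subgroup_img_is_subgroup[OF U] .
  interpret V: group "H\<lparr>carrier := V\<rparr>" using H.subgroup_imp_group[OF V] .
  have hV: "h x \<in> V \<longleftrightarrow> x \<in> U" if "x \<in> carrier G" for x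
    using inj UG that by (auto simp: V_def dest: inj_onD)
  \<comment> \<open>The inverse of \<open>h\<close> is taken on the whole carrier of
    \<open>G\<close>, and the value is 0 outside \<open>V\<close>, so that
    \<open>\<mu>' (h x) = \<mu> x\<close> holds for all \<open>x\<close> in \<open>G\<close> and not
    just in \<open>U\<close>.\<close>
  define \<mu>' where "\<mu>' y = (if y \<in> V then \<mu> (inv_into (carrier G) h y) else 0)" for y
  have \<mu>_out: "\<mu> g = 0" if "g \<notin> U" for g using \<mu> that by (simp add: U.linear_character_iff)
  have \<mu>'_h: "\<mu>' (h x) = \<mu> x" if "x \<in> carrier G" for x
    using hV[OF that] that inj \<mu>_out by (simp add: \<mu>'_def)
  have "linear_character (H\<lparr>carrier := V\<rparr>) \<mu>'"
    unfolding V.linear_character_iff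
  proof (intro conjI allI impI ballI)
    have "\<mu>' (h \<one>\<^bsub>G\<^esub>) = 1" using \<mu> \<mu>'_h[OF G.one_closed] by (simp add: U.linear_character_iff)
    then show "\<mu>' \<one>\<^bsub>H\<lparr>carrier := V\<rparr>\<^esub> = 1" by simp
    fix a b assume "a \<in> carrier (H\<lparr>carrier := V\<rparr>)" "b \<in> carrier (H\<lparr>carrier := V\<rparr>)"
    then obtain x y where xy: "x \<in> U" "a = h x" "y \<in> U" "b = h y" by (auto simp: V_def)
    have xyG: "x \<in> carrier G" "y \<in> carrier G" using xy UG by auto
    then have "a \<otimes>\<^bsub>H\<^esub> b = h (x \<otimes>\<^bsub>G\<^esub> y)" by (simp add: xy)
    then have "\<mu>' (a \<otimes>\<^bsub>H\<^esub> b) = \<mu> (x \<otimes>\<^bsub>G\<^esub> y)"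
      using \<mu>'_h[of "x \<otimes>\<^bsub>G\<^esub> y"] xyG by simp
    also have "\<dots> = \<mu>' a * \<mu>' b" using \<mu> xy xyG \<mu>'_h by (simp add: U.linear_character_iff)
    finally show "\<mu>' (a \<otimes>\<^bsub>H\<lparr>carrier := V\<rparr>\<^esub> b) = \<mu>' a * \<mu>' b" by simp
  qed (simp add: \<mu>'_def)
  moreover have "induced_character H V \<mu>' y = \<chi> y" for y
  proof (cases "y \<in> carrier H")
    case True
    then obtain g where g: "g \<in> carrier G" "y = h g" using surj by blast
    have "(\<Sum>z\<in>carrier H. \<mu>' (z \<otimes>\<^bsub>H\<^esub> y \<otimes>\<^bsub>H\<^esub> inv\<^bsub>H\<^esub> z)) =
      (\<Sum>x\<in>carrier G. \<mu>' (h x \<otimes>\<^bsub>H\<^esub> y \<otimes>\<^bsub>H\<^esub> inv\<^bsub>H\<^esub> h x))"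
      using sum.reindex_bij_betw[OF bij, of "\<lambda>z. \<mu>' (z \<otimes>\<^bsub>H\<^esub> y \<otimes>\<^bsub>H\<^esub> inv\<^bsub>H\<^esub> z)"] by simp
    also have "\<dots> = (\<Sum>x\<in>carrier G. \<mu> (x \<otimes>\<^bsub>G\<^esub> g \<otimes>\<^bsub>G\<^esub> inv\<^bsub>G\<^esub> x))"
    proof (rule sum.cong[OF refl])
      fix x assume x: "x \<in> carrier G"
      have "h x \<otimes>\<^bsub>H\<^esub> y \<otimes>\<^bsub>H\<^esub> inv\<^bsub>H\<^esub> h x = h (x \<otimes>\<^bsub>G\<^esub> g \<otimes>\<^bsub>G\<^esub> inv\<^bsub>G\<^esub> x)" using x g by simp
      then show "\<mu>' (h x \<otimes>\<^bsub>H\<^esub> y \<otimes>\<^bsub>H\<^esub> inv\<^bsub>H\<^esub> h x) = \<mu> (x \<otimes>\<^bsub>G\<^esub> g \<otimes>\<^bsub>G\<^esub> inv\<^bsub>G\<^esub> x)"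
        using \<mu>'_h[of "x \<otimes>\<^bsub>G\<^esub> g \<otimes>\<^bsub>G\<^esub> inv\<^bsub>G\<^esub> x"] x g by simp
    qed
    moreover have "card V = card U" unfolding V_def using inj UG by (meson card_image inj_on_subset)
    ultimately have "induced_character H V \<mu>' y = induced_character G U \<mu> g"
      using True g by (simp add: induced_character_def)
    then show ?thesis using ind g True by (simp add: \<rho>(2) rep_character_def)
  qed (simp add: induced_character_def \<rho>(2) rep_character_def)
  ultimately show "monomial_character H \<chi>"
    unfolding monomial_character_def using V by blast
qed

lemma (in group) finite_group_nat_copy:
  assumes "finite (carrier G)"
  obtains G' :: "nat monoid" and h where "group G'" "h \<in> iso G G'"
proof -
  obtain f :: "'a \<Rightarrow> nat" where f: "inj_on f (carrier G)" using finite_imp_inj_to_nat_seg[OF assms] by blast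
  define k where "k = inv_into (carrier G) f"
  define G' :: "nat monoid" where
    "G' = \<lparr>carrier = f ` carrier G, monoid.mult = (\<lambda>a b. f (k a \<otimes> k b)), one = f \<one>\<rparr>"
  have kf: "k (f x) = x" if "x \<in> carrier G" for x using f that by (simp add: k_def)
  have G': "group G'"
  proof (rule groupI)
    fix x assume "x \<in> carrier G'"
    then obtain a where a: "a \<in> carrier G" "x = f a" by (auto simp: G'_def)
    then have "f (inv a) \<in> carrier G'" "f (inv a) \<otimes>\<^bsub>G'\<^esub> x = \<one>\<^bsub>G'\<^esub>" by (auto simp: G'_def kf)
    then show "\<exists>y\<in>carrier G'. y \<otimes>\<^bsub>G'\<^esub> x = \<one>\<^bsub>G'\<^esub>" by blast
  qed (auto simp: G'_def kf m_assoc)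
  moreover have "f \<in> iso G G'" using f by (auto simp: iso_def hom_def bij_betw_def G'_def kf)
  ultimately show ?thesis using that by blast
qed

theorem corollary1p4:
  fixes G :: "('a, 'b) monoid_scheme" and N :: "'a set"
  assumes "Isaacs_conjecture"
    and "M_group G" and "odd (Coset.order G)"
    and "N \<lhd> G"
  shows "M_group (G\<lparr>carrier := N\<rparr>)"
proof -
  interpret G: group G using assms(2) by (simp add: M_group_def)
  have fin: "finite (carrier G)" using assms(2) by (simp add: M_group_def)
  obtain G' :: "nat monoid" and h where G': "group G'" and h: "h \<in> iso G G'"
    using G.finite_group_nat_copy[OF fin] by blast
  interpret G': group G' by fact
  interpret h: group_hom G G' h using h by unfold_locales (simp add: iso_def)
  have bij: "bij_betw h (carrier G) (carrier G')" using h by (simp add: iso_def)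
  have N: "subgroup N G" "\<And>x n. x \<in> carrier G \<Longrightarrow> n \<in> N \<Longrightarrow> x \<otimes>\<^bsub>G\<^esub> n \<otimes>\<^bsub>G\<^esub> inv\<^bsub>G\<^esub> x \<in> N"
    using assms(4) by (simp_all add: G.normal_inv_iff)
  have NG: "N \<subseteq> carrier G" using N(1) by (rule subgroup.subset)
  have sub: "subgroup (h ` N) G'" using h.subgroup_img_is_subgroup[OF N(1)] .
  have "h ` N \<lhd> G'"
  proof (rule G'.normal_invI[OF sub])
    fix y m assume "m \<in> h ` N" "y \<in> carrier G'"
    moreover have "carrier G' = h ` carrier G" using bij by (simp add: bij_betw_def)
    ultimately obtain x n where xn: "n \<in> N" "m = h n" "x \<in> carrier G" "y = h x" by auto
    then have "y \<otimes>\<^bsub>G'\<^esub> m \<otimes>\<^bsub>G'\<^esub> inv\<^bsub>G'\<^esub> y = h (x \<otimes>\<^bsub>G\<^esub> n \<otimes>\<^bsub>G\<^esub> inv\<^bsub>G\<^esub> x)" using NG by auto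
    then show "y \<otimes>\<^bsub>G'\<^esub> m \<otimes>\<^bsub>G'\<^esub> inv\<^bsub>G'\<^esub> y \<in> h ` N" using N(2)[OF xn(3,1)] by simp
  qed
  moreover have "odd (card (carrier G'))"
    using assms(3) bij by (simp add: Coset.order_def bij_betw_same_card)
  moreover have "M_group G'" using M_group_iso[OF assms(2) G' h] .
  ultimately have M': "M_group (G'\<lparr>carrier := h ` N\<rparr>)" using M_group_normal_nat[OF assms(1)] by blast
  have "h (x \<otimes>\<^bsub>G\<^esub> y) = h x \<otimes>\<^bsub>G'\<^esub> h y" if "x \<in> N" "y \<in> N" for x y
    using that NG h.hom_mult by (meson subsetD)
  then have "h \<in> iso (G\<lparr>carrier := N\<rparr>) (G'\<lparr>carrier := h ` N\<rparr>)"
    using NG bij by (auto simp: iso_def hom_def bij_betw_def intro: inj_on_subset)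
  \<comment> \<open>The M-property has been shown for the image of \<open>N\<close>, so the inverse
    isomorphism is the one to transport it along.\<close>
  then have "inv_into N h \<in> iso (G'\<lparr>carrier := h ` N\<rparr>) (G\<lparr>carrier := N\<rparr>)"
    using group.iso_set_sym[OF G.subgroup_imp_group[OF N(1)], of h] by simp
  then show ?thesis using M_group_iso[OF M' G.subgroup_imp_group[OF N(1)]] by blast
qed

end
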